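(* Let $n\ge 1$, $T>0$, and let $(a_{jk})_{j,k=1}^n$ be real-valued coefficients on $[0,T]\times\mathbb R^n$ satisfying the standing assumptions in the context (symmetry, uniform ellipticity with constant $\kappa\in(0,1)$, Log-Lipschitz continuity in $t$ with constant $A_{LL}$, Lipschitz continuity in $x$ with bound $A$). Then for every $D>0$ there exist constants $\rho>0$, $0<\delta\le 1$ and $K>0$, depending only on $D$, $\kappa$, $A$, $A_{LL}$ and $T$ (the dimension $n$ being fixed), such that the following holds. If $u\in\mathcal H$ is a solution on $[0,T]$ of the backward-parabolic equation $$\partial_t u+\sum_{j,k=1}^n\partial_{x_j}\big(a_{jk}(t,x)\,\partial_{x_k}u\big)=0$$ with $\|u(0,\cdot)\|_{L^2}\le\rho$ and $\|u(t,\cdot)\|_{L^2}\le D$ for all $t\in[0,T]$, then $$\int_0^T\|u(t,\cdot)\|_{L^2}^2\,dt\le K\,\frac{1}{\big|\log\|u(0,\cdot)\|_{L^2}\big|^{2\delta}} .$$ Moreover, if in addition $\|u(t,\cdot)\|_{H^1}\le D$ for all $t\in[0,T]$, then $$\sup_{t\in[0,T]}\|u(t,\cdot)\|_{L^2}\le K\,\frac{1}{\big|\log\|u(0,\cdot)\|_{L^2}\big|^{\delta}} .$$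
   Context: Standing assumptions on the coefficients: (i) $a_{jk}(t,x)=a_{kj}(t,x)$ for all $(t,x)\in[0,T]\times\mathbb R^n$ and all $j,k$; (ii) there is $\kappa\in(0,1)$ with $\kappa|\xi|^2\le\sum_{j,k=1}^n a_{jk}(t,x)\xi_j\xi_k\le\kappa^{-1}|\xi|^2$ for all $(t,x,\xi)\in[0,T]\times\mathbb R^n\times\mathbb R^n$; (iii) $a_{jk}\in \mathrm{LogLip}([0,T],L^\infty(\mathbb R^n))\cap L^\infty([0,T],\mathrm{Lip}(\mathbb R^n))$, i.e. the following two quantities are finite: $$A_{LL}:=\sup\Big\{\frac{|a_{jk}(t,x)-a_{jk}(s,x)|}{|t-s|(1+|\log|t-s||)} : 1\le j,k\le n,\ t,s\in[0,T],\ x\in\mathbb R^n,\ 0<|t-s|\le1\Big\},$$ $$A:=\sup\{\|\partial_x^\alpha a_{jk}(t,\cdot)\|_{L^\infty(\mathbb R^n)} : 1\le j,k\le n,\ |\alpha|\le1,\ t\in[0,T]\}.$$ The space of admissible solutions is $$\mathcal H:=C^0([0,T],L^2(\mathbb R^n))\cap C^0([0,T),H^1(\mathbb R^n))\cap C^1([0,T),L^2(\mathbb R^n)),$$ and the equation is understood for $t\in[0,T)$, with the spatial derivatives in the sense of distributions. $L^2$ and $H^1$ denote $L^2(\mathbb R^n)$ and $H^1(\mathbb R^n)$. When $\|u(0,\cdot)\|_{L^2}=0$ the right-hand sides are read as $0$. *)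

theory Defs
  imports "HOL-Analysis.Analysis" "HOL-Probability.Essential_Supremum"
begin

subsection \<open>Test functions and distributional derivatives\<close>

definition pderiv_at :: "'n \<Rightarrow> (real^'n::finite \<Rightarrow> real) \<Rightarrow> real^'n \<Rightarrow> real" where
  "pderiv_at k f x = frechet_derivative f (at x) (axis k 1)"

primrec Ck :: "nat \<Rightarrow> (real^'n::finite \<Rightarrow> real) \<Rightarrow> bool" where
  "Ck 0 f \<longleftrightarrow> continuous_on UNIV f"
| "Ck (Suc m) f \<longleftrightarrow> (\<forall>x. f differentiable (at x)) \<and> (\<forall>k. Ck m (pderiv_at k f))"

text \<open>Real-valued test functions suffice also for complex-valued distributions, since a
  complex test function is a complex linear combination of two real ones.\<close>

definition test_functions :: "(real^'n::finite \<Rightarrow> real) set" where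
  "test_functions = {\<phi>. (\<forall>m. Ck m \<phi>) \<and> compact (closure {x. \<phi> x \<noteq> 0})}"

definition locally_integrable :: "(real^'n::finite \<Rightarrow> 'b::euclidean_space) \<Rightarrow> bool" where
  "locally_integrable f \<longleftrightarrow> (\<forall>C. compact C \<longrightarrow> set_integrable lebesgue C f)"

definition dist_of :: "(real^'n::finite \<Rightarrow> 'b::euclidean_space) \<Rightarrow> (real^'n \<Rightarrow> real) \<Rightarrow> 'b" where
  "dist_of f \<phi> = (LINT x|lebesgue. \<phi> x *\<^sub>R f x)"

definition dist_deriv ::
  "'n::finite \<Rightarrow> ((real^'n \<Rightarrow> real) \<Rightarrow> 'b::euclidean_space) \<Rightarrow> (real^'n \<Rightarrow> real) \<Rightarrow> 'b" where
  "dist_deriv k S \<phi> = - S (pderiv_at k \<phi>)"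

definition has_weak_pderiv ::
  "'n::finite \<Rightarrow> (real^'n \<Rightarrow> 'b::euclidean_space) \<Rightarrow> (real^'n \<Rightarrow> 'b) \<Rightarrow> bool" where
  "has_weak_pderiv k f g \<longleftrightarrow> locally_integrable f \<and> locally_integrable g \<and>
     (\<forall>\<phi>\<in>test_functions. dist_deriv k (dist_of f) \<phi> = dist_of g \<phi>)"

text \<open>The choice is immaterial: weak derivatives are unique almost everywhere.\<close>

definition weak_pderiv ::
  "'n::finite \<Rightarrow> (real^'n \<Rightarrow> 'b::euclidean_space) \<Rightarrow> real^'n \<Rightarrow> 'b" where
  "weak_pderiv k f = (SOME g. has_weak_pderiv k f g)"


subsection \<open>Function spaces\<close>

text \<open>Elements of the spaces are represented by functions rather than by classes modulo
  almost everywhere equality; all notions in this subsection are invariant under the choice of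
  representatives.\<close>

definition L2 :: "(real^'n::finite \<Rightarrow> complex) set" where
  "L2 = {f. f \<in> borel_measurable lebesgue \<and> integrable lebesgue (\<lambda>x. (norm (f x))\<^sup>2)}"

definition L2norm :: "(real^'n::finite \<Rightarrow> complex) \<Rightarrow> real" where
  "L2norm f = sqrt (LINT x|lebesgue. (norm (f x))\<^sup>2)"

definition H1 :: "(real^'n::finite \<Rightarrow> complex) set" where
  "H1 = {f \<in> L2. \<forall>k. \<exists>g\<in>L2. has_weak_pderiv k f g}"

definition H1norm :: "(real^'n::finite \<Rightarrow> complex) \<Rightarrow> real" where
  "H1norm f = sqrt ((L2norm f)\<^sup>2 + (\<Sum>k\<in>UNIV. (L2norm (weak_pderiv k f))\<^sup>2))"

text \<open>\<open>C0_into I X N\<close> is $C^0(I,X)$, where \<open>N\<close> is the norm of \<open>X\<close>; \<open>has_L2_deriv I u v\<close> says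
  that \<open>v\<close> is the derivative of \<open>u\<close> on \<open>I\<close> as an $L^2$-valued map (one-sided at end points
  belonging to \<open>I\<close>).\<close>

definition C0_into ::
  "real set \<Rightarrow> (real^'n::finite \<Rightarrow> complex) set \<Rightarrow> ((real^'n \<Rightarrow> complex) \<Rightarrow> real)
    \<Rightarrow> (real \<Rightarrow> real^'n \<Rightarrow> complex) set" where
  "C0_into I X N = {u. \<forall>t\<in>I. u t \<in> X \<and>
     ((\<lambda>s. N (\<lambda>x. u s x - u t x)) \<longlongrightarrow> 0) (at t within I)}"

definition has_L2_deriv ::
  "real set \<Rightarrow> (real \<Rightarrow> real^'n::finite \<Rightarrow> complex) \<Rightarrow> (real \<Rightarrow> real^'n \<Rightarrow> complex) \<Rightarrow> bool" where
  "has_L2_deriv I u v \<longleftrightarrow> (\<forall>t\<in>I. u t \<in> L2 \<and> v t \<in> L2 \<and>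
     ((\<lambda>s. L2norm (\<lambda>x. (u s x - u t x) /\<^sub>R (s - t) - v t x)) \<longlongrightarrow> 0) (at t within I))"

definition C1_into_L2 :: "real set \<Rightarrow> (real \<Rightarrow> real^'n::finite \<Rightarrow> complex) set" where
  "C1_into_L2 I = {u. \<exists>v\<in>C0_into I L2 L2norm. has_L2_deriv I u v}"

definition solution_space :: "real \<Rightarrow> (real \<Rightarrow> real^'n::finite \<Rightarrow> complex) set" where
  "solution_space T =
     C0_into {0..T} L2 L2norm \<inter> C0_into {0..<T} H1 H1norm \<inter> C1_into_L2 {0..<T}"


subsection \<open>Coefficients\<close>

definition LogLip_const ::
  "real \<Rightarrow> ('n::finite \<Rightarrow> 'n \<Rightarrow> real \<Rightarrow> real^'n \<Rightarrow> real) \<Rightarrow> ereal" where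
  "LogLip_const T a = Sup {ereal (\<bar>a j k t x - a j k s x\<bar> / (\<bar>t - s\<bar> * (1 + \<bar>ln \<bar>t - s\<bar>\<bar>)))
     | j k t s x. t \<in> {0..T} \<and> s \<in> {0..T} \<and> 0 < \<bar>t - s\<bar> \<and> \<bar>t - s\<bar> \<le> 1}"

definition Linf_norm :: "(real^'n::finite \<Rightarrow> real) \<Rightarrow> ereal" where
  "Linf_norm f = esssup lebesgue (\<lambda>x. ereal \<bar>f x\<bar>)"

text \<open>$L^\infty$ norm of the distributional derivative. The infimum is over functions that agree
  almost everywhere, and it is \<open>\<infinity>\<close> if the derivative is not a locally integrable function.\<close>

definition Linf_norm_pderiv :: "'n::finite \<Rightarrow> (real^'n \<Rightarrow> real) \<Rightarrow> ereal" where
  "Linf_norm_pderiv l f = Inf {Linf_norm g | g. has_weak_pderiv l f g}"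

definition Lip_const ::
  "real \<Rightarrow> ('n::finite \<Rightarrow> 'n \<Rightarrow> real \<Rightarrow> real^'n \<Rightarrow> real) \<Rightarrow> ereal" where
  "Lip_const T a = Sup ({Linf_norm (a j k t) | j k t. t \<in> {0..T}} \<union>
     {Linf_norm_pderiv l (a j k t) | j k l t. t \<in> {0..T}})"

definition admissible_coeffs ::
  "real \<Rightarrow> real \<Rightarrow> real \<Rightarrow> real \<Rightarrow> ('n::finite \<Rightarrow> 'n \<Rightarrow> real \<Rightarrow> real^'n \<Rightarrow> real) \<Rightarrow> bool" where
  "admissible_coeffs T \<kappa> A A_LL a \<longleftrightarrow>
     (\<forall>j k. \<forall>t\<in>{0..T}. \<forall>x. a j k t x = a k j t x) \<and>
     (\<forall>t\<in>{0..T}. \<forall>x \<xi>.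
        \<kappa> * (norm \<xi>)\<^sup>2 \<le> (\<Sum>j\<in>UNIV. \<Sum>k\<in>UNIV. a j k t x * \<xi> $ j * \<xi> $ k) \<and>
        (\<Sum>j\<in>UNIV. \<Sum>k\<in>UNIV. a j k t x * \<xi> $ j * \<xi> $ k) \<le> inverse \<kappa> * (norm \<xi>)\<^sup>2) \<and>
     (\<forall>j k. \<forall>t\<in>{0..T}. \<exists>L. L-lipschitz_on UNIV (a j k t)) \<and>
     LogLip_const T a = ereal A_LL \<and>
     Lip_const T a = ereal A"


subsection \<open>The backward-parabolic equation\<close>

definition solves_backward_parabolic ::
  "real \<Rightarrow> ('n::finite \<Rightarrow> 'n \<Rightarrow> real \<Rightarrow> real^'n \<Rightarrow> real) \<Rightarrow> (real \<Rightarrow> real^'n \<Rightarrow> complex) \<Rightarrow> bool" where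
  "solves_backward_parabolic T a u \<longleftrightarrow> (\<exists>v. has_L2_deriv {0..<T} u v \<and>
     (\<forall>t\<in>{0..<T}. \<forall>\<phi>\<in>test_functions.
        dist_of (v t) \<phi> +
        (\<Sum>j\<in>UNIV. \<Sum>k\<in>UNIV.
           dist_deriv j (dist_of (\<lambda>x. a j k t x *\<^sub>R weak_pderiv k (u t) x)) \<phi>) = 0))"

end

theory Submission
  imports Defs "HOL-Real_Asymp.Real_Asymp" "HOL-Computational_Algebra.Polynomial"
begin

text \<open>Write \<open>H(t)\<close> for the squared norm of \<open>u(t)\<close> and \<open>E(t)\<close> for the energy, so that \<open>H' = 2 E \<ge> 0\<close>.
  Since \<open>\<langle>u'(t), w\<rangle> = B\<^sub>t(u(t), w)\<close> with a symmetric form \<open>B\<^sub>t\<close>, the derivative of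
  \<open>r \<mapsto> \<langle>u(t + r), u(t - r)\<rangle>\<close> is \<open>(B\<^sub>t\<^sub>+\<^sub>r - B\<^sub>t\<^sub>-\<^sub>r)(u(t + r), u(t - r))\<close>, which the Log-Lipschitz condition
  and ellipticity bound by \<open>\<omega>(2 r) (E(t + r) + E(t - r))\<close> up to a constant, where
  \<open>\<omega>(r) = r (1 + \<bar>ln r\<bar>)\<close>. Integrating and using the Cauchy-Schwarz inequality yields the almost
  logarithmic convexity
  \<open>H(t) \<le> sqrt (H(t + \<tau>) H(t - \<tau>)) + C \<omega>(2 \<tau>) (H(t + \<tau>) - H(t - \<tau>))\<close>.

  Consecutive increments of \<open>ln H\<close> over steps \<open>\<tau>\<close> therefore lose at most a factor
  \<open>1 - 12 C \<omega>(2 \<tau>)\<close>, hence at most a small power of \<open>\<tau>\<close> over a time interval of fixed short length.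
  So an increment of size 1 at scale \<open>\<sigma>^3\<close> forces later increments of size 1 at the coarser
  scale \<open>\<sigma>\<close>, and after finitely many stages one gets a dichotomy: either \<open>ln H\<close> has grown little from time
  0, or \<open>H\<close> grows exponentially with rate \<open>1 / \<sigma>\<close> up to time \<open>T\<close>. As \<open>H\<close> is bounded, choosing \<open>\<sigma>\<close> as a
  small power of \<open>1 / \<bar>ln H(0)\<bar>\<close> gives the estimates.\<close>

subsection \<open>Almost logarithmically convex functions\<close>

text \<open>Under a Log-Lipschitz bound the energy need not be differentiable in time, so convexity
  of \<open>ln H\<close> through a second derivative is out of reach; pairing two reflected times
  needs only first derivatives of \<open>u\<close> and differences of coefficients. The price is an
  error \<open>C \<omega>(2 \<tau>)\<close> in each of about \<open>1 / \<tau>\<close> steps, whose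
  sum diverges logarithmically as \<tau> tends to 0: over a length L the increments may shrink by a
  power of \<tau> with exponent proportional to \<open>C L\<close>. With L a small multiple of
  \<open>1 / C\<close> and \<tau> = \<open>\<sigma>^3\<close> they stay above
  \<open>2 \<sigma>^2\<close>, and about \<open>\<sigma>^-2\<close> of them fit into a window of
  length \<sigma>. Crossing [0, T] takes J of order \<open>T / L\<close> stages, each of which cubes
  the scale; hence the smallest scale \<open>\<sigma> ^ (3 ^ J)\<close> and the exponent \<delta> =
  \<open>1 / (4 * 3 ^ J)\<close>. On the analytic side, the equation is given only against real test
  functions but must be paired with \<open>u(s)\<close>. In place of density of test functions,
  double integrals against an explicit bump kernel are used: Fubini moves the derivative of the
  kernel from one factor to the other, and then the radius tends to 0.\<close>

definition loglip_modulus :: "real \<Rightarrow> real" where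
  "loglip_modulus r = r * (1 + \<bar>ln r\<bar>)"

text \<open>The restriction \<open>2 * \<tau> \<le> 1\<close> matches the Log-Lipschitz constant,
  which only sees time differences up to 1: the outer times are \<open>2 * \<tau>\<close> apart. The
  form with a square root, instead of one in \<open>ln H\<close>, makes sense where \<open>H\<close>
  vanishes.\<close>

definition almost_log_convex :: "real \<Rightarrow> real \<Rightarrow> (real \<Rightarrow> real) \<Rightarrow> bool" where
  "almost_log_convex C T H \<longleftrightarrow> (\<forall>t \<tau>. 0 < \<tau> \<and> 2 * \<tau> \<le> 1 \<and> 0 \<le> t - \<tau> \<and> t + \<tau> \<le> T \<longrightarrow>
     H t \<le> sqrt (H (t + \<tau>) * H (t - \<tau>)) + C * loglip_modulus (2 * \<tau>) * (H (t + \<tau>) - H (t - \<tau>)))"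

lemma loglip_modulus_nonneg: "0 \<le> r \<Longrightarrow> 0 \<le> loglip_modulus r"
  by (simp add: loglip_modulus_def)

text \<open>Here \<open>q\<close> and \<open>p\<close> are the previous and the next increment of
  \<open>ln H\<close>, and the last assumption is almost logarithmic convexity divided by
  \<open>H t\<close>. The truncation at 1 is what allows the exponential difference to be bounded
  linearly, by 3 times \<open>min q 1\<close>.\<close>

lemma increment_step:
  fixes p q \<eta> :: real
  assumes "0 \<le> p" "0 \<le> q" "0 \<le> \<eta>" and *: "1 \<le> exp ((p - q) / 2) + \<eta> * (exp p - exp (- q))"
  shows "min q 1 * (1 - 12 * \<eta>) \<le> p"
proof (cases "p < min q 1")
  case True
  define m where "m = min q 1"
  have pm: "p < m" and m: "m \<le> q" "m \<le> 1" "0 < m"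
    using True assms by (auto simp: m_def)
  have a: "exp p - exp (- q) \<le> 3 * m"
  proof (cases "q \<le> 1")
    case True
    then have "m = q" by (simp add: m_def)
    have "exp p \<le> 1 + p + p\<^sup>2"
      using exp_bound[of p] assms(1) pm m by simp
    also have "p\<^sup>2 \<le> p" using assms(1) pm m by (simp add: power2_eq_square mult_left_le)
    finally have "exp p \<le> 1 + 2 * p" by simp
    moreover have "1 - q \<le> exp (- q)" using exp_ge_add_one_self[of "-q"] by simp
    ultimately show ?thesis using \<open>m = q\<close> pm by linarith
  next
    case False
    then have "m = 1" by (simp add: m_def)
    have "exp p \<le> exp 1" using pm m by simp
    also have "\<dots> \<le> 3" by (rule exp_le)
    finally show ?thesis using \<open>m = 1\<close> by (smt (verit) exp_gt_zero)
  qed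
  define x where "x = (m - p) / 2"
  have x: "0 \<le> x" "x \<le> 1/2" using pm m assms(1) by (auto simp: x_def)
  have "exp ((p - q) / 2) \<le> exp (- x)" using m by (simp add: x_def field_simps)
  also have "\<dots> \<le> 1 - x / 2"
  proof -
    have "1 + x \<le> exp x" by (rule exp_ge_add_one_self)
    then have "exp (- x) \<le> inverse (1 + x)"
      using x by (simp add: exp_minus le_imp_inverse_le)
    also have "\<dots> \<le> 1 - x / 2"
    proof -
      have "1 \<le> (1 - x / 2) * (1 + x)" using x mult_left_mono[of x "1/2" x] by (simp add: algebra_simps)
      then show ?thesis using x by (simp add: field_simps)
    qed
    finally show ?thesis .
  qed
  \<comment> \<open>The deficit \<open>m - p\<close> enters with slope 1/4 and the error is at most
    \<open>3 * m * \<eta>\<close>; the product of 4 and 3 is the 12 of the statement.\<close>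
  finally have "exp ((p - q) / 2) \<le> 1 - (m - p) / 4" by (simp add: x_def)
  moreover have "\<eta> * (exp p - exp (- q)) \<le> \<eta> * (3 * m)"
    using a assms(3) by (rule mult_left_mono)
  ultimately have "(m - p) / 4 \<le> \<eta> * (3 * m)" using * by linarith
  then show ?thesis unfolding m_def[symmetric] by (simp add: algebra_simps)
next
  case False
  have "min q 1 * (1 - 12 * \<eta>) \<le> min q 1 * 1"
    using assms by (intro mult_left_mono) auto
  then show ?thesis using False by linarith
qed

text \<open>Adding a positive constant makes the logarithm available even where the function vanishes.\<close>

lemma almost_log_convex_add:
  assumes "almost_log_convex C T H" "\<And>t. t \<in> {0..T} \<Longrightarrow> 0 \<le> H t" "0 \<le> e"
  shows "almost_log_convex C T (\<lambda>t. H t + e)"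
  unfolding almost_log_convex_def
proof (intro allI impI, elim conjE)
  fix t \<tau> :: real assume t: "0 < \<tau>" "2 * \<tau> \<le> 1" "0 \<le> t - \<tau>" "t + \<tau> \<le> T"
  let ?a = "H (t + \<tau>)" and ?b = "H (t - \<tau>)"
  have ab: "0 \<le> ?a" "0 \<le> ?b" using t by (auto intro!: assms)
  have "sqrt (?a * ?b) + e \<le> sqrt ((?a + e) * (?b + e))"
  proof (rule real_le_rsqrt)
    have "2 * sqrt (?a * ?b) \<le> ?a + ?b"
      using arith_geo_mean_sqrt[OF ab] by simp
    then have "e * (2 * sqrt (?a * ?b)) \<le> e * (?a + ?b)" using assms(3) by (rule mult_left_mono)
    then show "(sqrt (?a * ?b) + e)\<^sup>2 \<le> (?a + e) * (?b + e)"
      using ab by (simp add: power2_sum power2_eq_square algebra_simps)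
  qed
  moreover have "H t \<le> sqrt (?a * ?b) + C * loglip_modulus (2 * \<tau>) * (?a - ?b)"
    using assms(1) t by (simp add: almost_log_convex_def)
  ultimately show "H t + e \<le> sqrt ((?a + e) * (?b + e)) + C * loglip_modulus (2 * \<tau>) * (?a + e - (?b + e))"
    by simp
qed

lemma increment_chain:
  assumes alc: "almost_log_convex C T H" and C: "0 \<le> C"
    and pos: "\<And>t. t \<in> {0..T} \<Longrightarrow> 0 < H t"
    and mono: "\<And>s t. 0 \<le> s \<Longrightarrow> s \<le> t \<Longrightarrow> t \<le> T \<Longrightarrow> H s \<le> H t"
    and \<tau>: "0 < \<tau>" "2 * \<tau> \<le> 1" and \<eta>: "\<eta> = C * loglip_modulus (2 * \<tau>)" "12 * \<eta> \<le> 1"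
    and s: "0 \<le> s" "1 \<le> ln (H (s + \<tau>)) - ln (H s)"
  shows "s + (real i + 1) * \<tau> \<le> T \<Longrightarrow>
    (1 - 12 * \<eta>) ^ i \<le> ln (H (s + (real i + 1) * \<tau>)) - ln (H (s + real i * \<tau>))"
proof (induction i)
  case 0
  then show ?case using s by simp
next
  case (Suc i)
  define t where "t = s + (real i + 1) * \<tau>"
  have t: "0 \<le> t - \<tau>" "t + \<tau> \<le> T" "0 \<le> t" "t \<le> T"
    using Suc.prems \<tau> s by (auto simp: t_def algebra_simps)
  have eq: "s + (real (Suc i) + 1) * \<tau> = t + \<tau>" "s + real (Suc i) * \<tau> = t" "s + real i * \<tau> = t - \<tau>"
    "s + (real i + 1) * \<tau> = t"
    by (auto simp: t_def algebra_simps)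
  have e0: "0 \<le> \<eta>" using C \<tau> by (simp add: \<eta> loglip_modulus_nonneg)
  have IH: "(1 - 12 * \<eta>) ^ i \<le> ln (H t) - ln (H (t - \<tau>))"
    using Suc.IH t unfolding eq by simp
  define p where "p = ln (H (t + \<tau>)) - ln (H t)"
  define q where "q = ln (H t) - ln (H (t - \<tau>))"
  have P: "0 < H t" "0 < H (t + \<tau>)" "0 < H (t - \<tau>)" using t \<tau> by (auto intro!: pos)
  have ep: "H (t + \<tau>) = H t * exp p" and eq': "H (t - \<tau>) = H t * exp (- q)"
    using P by (simp_all add: p_def q_def exp_diff)
  have "0 \<le> p" using P t \<tau> mono[of t "t + \<tau>"] by (simp add: p_def)
  moreover have "0 \<le> q" using P t \<tau> mono[of "t - \<tau>" t] by (simp add: q_def)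
  moreover note e0
  moreover have "1 \<le> exp ((p - q) / 2) + \<eta> * (exp p - exp (- q))"
  proof -
    have "sqrt (H (t + \<tau>) * H (t - \<tau>)) = H t * exp ((p - q) / 2)"
    proof (rule real_sqrt_unique)
      show "(H t * exp ((p - q) / 2))\<^sup>2 = H (t + \<tau>) * H (t - \<tau>)"
        unfolding ep eq' by (simp add: power_mult_distrib power2_eq_square exp_double[symmetric] exp_add[symmetric] flip: exp_add)
    qed (use P in simp)
    moreover have "H t \<le> sqrt (H (t + \<tau>) * H (t - \<tau>)) + \<eta> * (H (t + \<tau>) - H (t - \<tau>))"
      using alc t \<tau> by (simp add: almost_log_convex_def \<eta>)
    ultimately have "H t * 1 \<le> H t * (exp ((p - q) / 2) + \<eta> * (exp p - exp (- q)))"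
      unfolding ep eq' by (simp add: algebra_simps)
    then show ?thesis using P(1) by simp
  qed
  ultimately have "min q 1 * (1 - 12 * \<eta>) \<le> p" by (rule increment_step)
  \<comment> \<open>The lower bound carried by the induction never exceeds 1, so the truncation in
    \<open>increment_step\<close> costs nothing.\<close>
  moreover have "(1 - 12 * \<eta>) ^ i \<le> min q 1"
    using IH e0 \<eta>(2) by (simp add: q_def power_le_one)
  then have "(1 - 12 * \<eta>) ^ i * (1 - 12 * \<eta>) \<le> min q 1 * (1 - 12 * \<eta>)"
    using \<eta>(2) by (intro mult_right_mono) auto
  ultimately show ?case unfolding eq p_def by (simp add: mult.commute)
qed

section \<open>Propagation of growth from fine to coarse scales\<close>

lemma power_one_minus_ge_exp:
  fixes x :: real assumes "0 \<le> x" "x \<le> 1/2"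
  shows "exp (- (2 * x * real i)) \<le> (1 - x) ^ i"
proof -
  have "exp (- 2 * x) \<le> 1 - x"
  proof -
    have "1 + 2 * x \<le> exp (2 * x)" by (rule exp_ge_add_one_self)
    then have "exp (- (2 * x)) \<le> inverse (1 + 2 * x)"
      using assms by (simp add: exp_minus le_imp_inverse_le)
    also have "\<dots> \<le> 1 - x"
    proof -
      have "1 \<le> (1 - x) * (1 + 2 * x)" using assms mult_left_mono[of x "1/2" x] by (simp add: algebra_simps)
      then show ?thesis using assms by (simp add: field_simps)
    qed
    finally show ?thesis by simp
  qed
  then have "exp (- 2 * x) ^ i \<le> (1 - x) ^ i" by (intro power_mono) auto
  then show ?thesis by (simp add: exp_of_nat_mult[symmetric] algebra_simps)
qed

text \<open>Starting at \<open>s\<close>, steps of length \<tau> = \<open>\<sigma> ^ 3\<close> keep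
  increments of at least \<open>2 * \<sigma>\<^sup>2\<close> over a distance \<open>2 * L\<close>. A
  window of length \<sigma> that starts before \<open>s + L\<close> ends within that distance,
  because \<open>\<sigma> \<le> L\<close>, and holds about \<open>1 / \<sigma>\<^sup>2\<close> such
  steps, enough to add up to 1.\<close>

lemma growth_stage:
  assumes alc: "almost_log_convex C T H" and C: "0 \<le> C"
    and pos: "\<And>t. t \<in> {0..T} \<Longrightarrow> 0 < H t"
    and mono: "\<And>s t. 0 \<le> s \<Longrightarrow> s \<le> t \<Longrightarrow> t \<le> T \<Longrightarrow> H s \<le> H t"
    and L: "0 < L" "192 * C * L \<le> 1"
    and \<sigma>: "0 < \<sigma>" "\<sigma> \<le> 1 / 12" "\<sigma> \<le> L" and \<eta>: "24 * (C * loglip_modulus (2 * \<sigma> ^ 3)) \<le> 1"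
    and s: "0 \<le> s" "1 \<le> ln (H (s + \<sigma> ^ 3)) - ln (H s)"
    and t: "s + \<sigma> ^ 3 \<le> t" "t \<le> s + L" "t + \<sigma> \<le> T"
  shows "1 \<le> ln (H (t + \<sigma>)) - ln (H t)"
proof -
  define \<tau> where "\<tau> = \<sigma> ^ 3"
  define x where "x = 12 * (C * loglip_modulus (2 * \<tau>))"
  have \<tau>0: "0 < \<tau>" using \<sigma> by (simp add: \<tau>_def)
  have s2: "\<sigma>\<^sup>2 \<le> 1/144" using power_mono[of \<sigma> "1/12" 2] \<sigma> by (simp add: power2_eq_square)
  have \<tau>s: "\<tau> = \<sigma> * \<sigma>\<^sup>2" by (simp add: \<tau>_def power3_eq_cube power2_eq_square)
  have "\<tau> \<le> \<sigma> * (1/144)" unfolding \<tau>s using s2 \<sigma> by (intro mult_left_mono) auto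
  then have \<tau>1: "144 * \<tau> \<le> \<sigma>" "2 * \<tau> \<le> 1" using \<sigma> by auto
  have x: "0 \<le> x" "x \<le> 1/2" using C \<tau>0 \<eta> by (auto simp: x_def \<tau>_def loglip_modulus_nonneg)
  \<comment> \<open>The number 192 makes the total loss at most \<open>(1 - ln \<tau>) / 2\<close>
    in the exponent, so the product is at least \<sigma> to the power 3/2 up to the factor
    \<open>exp (- 1 / 2)\<close>. This dominates \<open>2 * \<sigma>\<^sup>2\<close> once
    \<open>1 + 2 * ln 2 \<le> - ln \<sigma>\<close>, which is where the bound 1/12 on \<sigma> is
    used, by \<open>12 = 3 * 4\<close> and \<open>1 \<le> ln 3\<close>.\<close>
  have low: "2 * \<sigma>\<^sup>2 \<le> (1 - x) ^ i" if "(real i + 1) * \<tau> \<le> 2 * L" for i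
  proof -
    have ln2: "\<bar>ln (2 * \<tau>)\<bar> \<le> - ln \<tau>" 
    proof -
      have "ln (2 * \<tau>) \<le> 0" using \<tau>0 \<tau>1 by simp
      moreover have "ln (2 * \<tau>) = ln 2 + ln \<tau>" using \<tau>0 by (simp add: ln_mult)
      moreover have "0 < ln (2::real)" by simp
      ultimately show ?thesis by linarith
    qed
    have "2 * x * real i = (24 * C * 2 * (1 + \<bar>ln (2 * \<tau>)\<bar>)) * (real i * \<tau>)"
      by (simp add: x_def loglip_modulus_def algebra_simps)
    also have "\<dots> \<le> (24 * C * 2 * (1 + \<bar>ln (2 * \<tau>)\<bar>)) * (2 * L)"
      using that \<tau>0 C by (intro mult_left_mono) (auto simp: algebra_simps)
    also have "\<dots> = (192 * C * L) * ((1 + \<bar>ln (2 * \<tau>)\<bar>) / 2)" by (simp add: algebra_simps)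
    also have "\<dots> \<le> 1 * ((1 + \<bar>ln (2 * \<tau>)\<bar>) / 2)"
      using L by (intro mult_right_mono) auto
    also have "\<dots> \<le> (1 - ln \<tau>) / 2" using ln2 by simp
    also have "ln \<tau> = 3 * ln \<sigma>" using \<sigma> by (simp add: \<tau>_def ln_realpow)
    finally have a: "2 * x * real i \<le> (1 - 3 * ln \<sigma>) / 2" .
    have "ln \<sigma> \<le> ln (1/12)" using \<sigma> by simp
    also have "ln (1/12::real) = - (ln 3 + 2 * ln 2)"
      using ln_realpow[of 2 2] ln_mult[of 3 "4::real"] by (simp add: ln_div)
    finally have b: "ln 3 + 2 * ln 2 \<le> - ln \<sigma>" by linarith
    have c: "1 \<le> ln (3::real)" using exp_le by (simp add: ln_ge_iff)
    have "2 * \<sigma>\<^sup>2 = exp (ln 2 + 2 * ln \<sigma>)"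
      using \<sigma> exp_of_nat_mult[of 2 "ln \<sigma>"] by (simp add: exp_add)
    also have "\<dots> \<le> exp (- (2 * x * real i))" using a b c by simp
    also have "\<dots> \<le> (1 - x) ^ i" by (rule power_one_minus_ge_exp[OF x])
    finally show ?thesis .
  qed
  define l where "l = (\<lambda>t. ln (H t))"
  have lmono: "l a \<le> l b" if "0 \<le> a" "a \<le> b" "b \<le> T" for a b
    using mono[OF that] pos[of a] pos[of b] that by (simp add: l_def)
  have chain: "2 * \<sigma>\<^sup>2 \<le> l (s + (real i + 1) * \<tau>) - l (s + real i * \<tau>)"
    if "(real i + 1) * \<tau> \<le> 2 * L" "s + (real i + 1) * \<tau> \<le> T" for i
    using low[OF that(1)] increment_chain[OF alc C pos mono \<tau>0 \<tau>1(2) refl _ s(1) s(2)[folded \<tau>_def] that(2)] x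
    by (simp add: x_def l_def algebra_simps)
  \<comment> \<open>\<open>s + i0 * \<tau>\<close> is the first grid point not before
    \<open>t\<close>. Rounding up may overshoot by almost one step, so one step fewer than the floor
    of \<open>\<sigma> / \<tau>\<close> is counted to end by \<open>t + \<sigma>\<close>.\<close>
  define i0 where "i0 = nat \<lceil>(t - s) / \<tau>\<rceil>"
  define m where "m = nat (\<lfloor>\<sigma> / \<tau>\<rfloor> - 1)"
  have "s + \<tau> \<le> t" using t by (simp add: \<tau>_def)
  then have st: "0 \<le> (t - s) / \<tau>" using \<tau>0 by (intro divide_nonneg_pos) auto
  have i0: "(t - s) / \<tau> \<le> real i0" "real i0 < (t - s) / \<tau> + 1"
    using st unfolding i0_def by linarith+
  have fl: "144 \<le> \<sigma> / \<tau>" using \<tau>1 \<tau>0 by (simp add: field_simps)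
  have m: "real m \<le> \<sigma> / \<tau> - 1" "\<sigma> / \<tau> - 2 \<le> real m"
    using fl unfolding m_def by linarith+
  have lo: "t \<le> s + real i0 * \<tau>" using i0(1) \<tau>0 by (simp add: field_simps)
  have "real i0 * \<tau> \<le> t - s + \<tau>" using i0(2) \<tau>0 by (simp add: field_simps)
  moreover have "real m * \<tau> \<le> \<sigma> - \<tau>" using m(1) \<tau>0 by (simp add: field_simps)
  ultimately have hi: "s + (real i0 + real m) * \<tau> \<le> t + \<sigma>" by (simp add: algebra_simps)
  have sum: "real k * (2 * \<sigma>\<^sup>2) \<le> l (s + (real i0 + real k) * \<tau>) - l (s + real i0 * \<tau>)" if "k \<le> m" for k
    using that
  proof (induction k)
    case (Suc k)
    have "(real (i0 + k) + 1) * \<tau> \<le> (real i0 + real m) * \<tau>"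
      using Suc.prems \<tau>0 by (intro mult_right_mono) auto
    then have "(real (i0 + k) + 1) * \<tau> \<le> t - s + \<sigma>" using hi by simp
    then have "2 * \<sigma>\<^sup>2 \<le> l (s + (real (i0 + k) + 1) * \<tau>) - l (s + real (i0 + k) * \<tau>)"
      using t \<sigma> by (intro chain) auto
    with Suc show ?case by (simp add: algebra_simps)
  qed simp
  \<comment> \<open>Since \<open>\<sigma> / \<tau>\<close> is \<open>1 / \<sigma>\<^sup>2\<close>,
    the right-hand side equals \<open>2 - 4 * \<sigma>\<^sup>2\<close>.\<close>
  have "1 \<le> (\<sigma> / \<tau> - 2) * (2 * \<sigma>\<^sup>2)"
    using s2 \<sigma> by (simp add: \<tau>s algebra_simps power2_eq_square)
  also have "\<dots> \<le> real m * (2 * \<sigma>\<^sup>2)" using m(2) by (intro mult_right_mono) auto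
  also have "\<dots> \<le> l (s + (real i0 + real m) * \<tau>) - l (s + real i0 * \<tau>)" by (rule sum) simp
  finally have "1 \<le> l (s + (real i0 + real m) * \<tau>) - l (s + real i0 * \<tau>)" .
  moreover have "l (s + (real i0 + real m) * \<tau>) \<le> l (t + \<sigma>)"
    using hi t s \<tau>0 by (intro lmono) auto
  moreover have "l t \<le> l (s + real i0 * \<tau>)"
  proof (rule lmono)
    show "0 \<le> t" using s(1) \<tau>0 \<open>s + \<tau> \<le> t\<close> by linarith
    have "0 \<le> real m * \<tau>" using \<tau>0 by simp
    then show "s + real i0 * \<tau> \<le> T" using hi t(3) by (simp add: algebra_simps)
  qed (rule lo)
  ultimately show ?thesis by (simp add: l_def)
qed

text \<open>Each stage replaces the scale \<tau>^3 by \<tau> and carries the growth forward; with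
  \<open>j\<close> cubings available, unit growth at scale \<sigma> is guaranteed for a time
  \<open>j * L / 2\<close>. For \<open>j = 0\<close> the conditions on \<open>t\<close> are
  contradictory.\<close>

lemma growth_stages:
  assumes alc: "almost_log_convex C T H" and C: "0 \<le> C"
    and pos: "\<And>t. t \<in> {0..T} \<Longrightarrow> 0 < H t"
    and mono: "\<And>s t. 0 \<le> s \<Longrightarrow> s \<le> t \<Longrightarrow> t \<le> T \<Longrightarrow> H s \<le> H t"
    and L: "0 < L" "192 * C * L \<le> 1"
    and \<sigma>0: "\<sigma>0 \<le> 1 / 12" "2 * \<sigma>0 \<le> L"
    and \<eta>: "\<And>\<tau>. 0 < \<tau> \<Longrightarrow> \<tau> \<le> \<sigma>0 \<Longrightarrow> 24 * (C * loglip_modulus (2 * \<tau>)) \<le> 1"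
    and \<sigma>: "0 < \<sigma>" "\<sigma> \<le> \<sigma>0"
  shows "0 \<le> s \<Longrightarrow> 1 \<le> ln (H (s + \<sigma> ^ (3 ^ j))) - ln (H s) \<Longrightarrow>
    s + \<sigma> ^ (3 ^ j) \<le> t \<Longrightarrow> t \<le> s + real j * L / 2 \<Longrightarrow> t + \<sigma> \<le> T \<Longrightarrow>
    1 \<le> ln (H (t + \<sigma>)) - ln (H t)"
proof (induction j arbitrary: s)
  case 0
  then show ?case using \<sigma> by auto
next
  case (Suc j)
  define \<tau> where "\<tau> = \<sigma> ^ (3 ^ j)"
  have \<sigma>1: "\<sigma> < 1" using \<sigma> \<sigma>0 by linarith
  have \<tau>0: "0 < \<tau>" using \<sigma> by (simp add: \<tau>_def)
  have \<tau>\<sigma>: "\<tau> \<le> \<sigma>" using power_decreasing[of 1 "3 ^ j" \<sigma>] \<sigma> \<sigma>1 by (simp add: \<tau>_def)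
  have \<tau>3: "\<sigma> ^ (3 ^ Suc j) = \<tau> ^ 3" by (simp add: \<tau>_def power_mult[symmetric] mult.commute)
  have \<tau>3\<tau>: "\<tau> ^ 3 \<le> \<tau>" using power_decreasing[of 1 3 \<tau>] \<tau>0 \<tau>\<sigma> \<sigma>1 by simp
  have eta3: "24 * (C * loglip_modulus (2 * \<tau> ^ 3)) \<le> 1"
    using \<eta>[of "\<tau> ^ 3"] \<tau>0 \<tau>3\<tau> \<tau>\<sigma> \<sigma> by simp
  have stage: "1 \<le> ln (H (r + \<tau>)) - ln (H r)" if "s + \<tau> ^ 3 \<le> r" "r \<le> s + L" "r + \<tau> \<le> T" for r
    using growth_stage[OF alc C pos mono L \<tau>0 _ _ eta3 Suc.prems(1) Suc.prems(2)[unfolded \<tau>3] that]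
      \<tau>\<sigma> \<sigma> \<sigma>0 L by simp
  show ?case
  proof (cases "t \<le> s + L")
    case True
    have "t + \<tau> \<le> T" using Suc.prems \<tau>\<sigma> by simp
    then have "1 \<le> ln (H (t + \<tau>)) - ln (H t)" using Suc.prems(3) True by (intro stage) (auto simp only: \<tau>3)
    also have "ln (H (t + \<tau>)) \<le> ln (H (t + \<sigma>))"
    proof -
      have "0 \<le> t" using Suc.prems \<sigma> by (auto intro: order_trans[of 0 "s + \<sigma> ^ 3 ^ Suc j"])
      then have "H (t + \<tau>) \<le> H (t + \<sigma>)" "0 < H (t + \<tau>)" "0 < H (t + \<sigma>)"
        using \<tau>0 \<tau>\<sigma> \<sigma> Suc.prems by (auto intro!: mono pos)
      then show ?thesis by simp
    qed
    finally show ?thesis by simp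
  next
    case False
    \<comment> \<open>The next stage restarts at \<open>s + L / 2\<close>, not at
      \<open>s + L\<close>: its conclusion begins only \<tau> after its start, and the overlap of
      half a stage leaves no gap after \<open>s + L\<close>.\<close>
    have L2: "\<tau> \<le> L / 2" using \<tau>\<sigma> \<sigma> \<sigma>0 by linarith
    show ?thesis
    proof (rule Suc.IH)
      show "1 \<le> ln (H (s + L / 2 + \<sigma> ^ 3 ^ j)) - ln (H (s + L / 2))"
        unfolding \<tau>_def[symmetric]
        using L2 \<tau>3\<tau> False Suc.prems \<sigma> L by (intro stage) auto
      show "s + L / 2 + \<sigma> ^ 3 ^ j \<le> t" using L2 False by (simp add: \<tau>_def[symmetric])
      show "t \<le> s + L / 2 + real j * L / 2" using Suc.prems by (simp add: field_simps)
    qed (use Suc.prems L in auto)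
  qed
qed

text \<open>Pigeonhole: if every step of length \<tau> gained less than 1, fewer than
  \<open>T / \<tau> + 1\<close> could be gained altogether.\<close>

lemma exists_unit_increment:
  fixes l :: "real \<Rightarrow> real"
  assumes mono: "\<And>s t. 0 \<le> s \<Longrightarrow> s \<le> t \<Longrightarrow> t \<le> T \<Longrightarrow> l s \<le> l t"
    and \<tau>: "0 < \<tau>" "\<tau> \<le> t" "t \<le> T" and big: "T / \<tau> + 1 \<le> l t - l 0"
  shows "\<exists>s\<ge>0. s + \<tau> \<le> t \<and> 1 \<le> l (s + \<tau>) - l s"
proof (rule ccontr)
  assume "\<not> ?thesis"
  then have *: "l (s + \<tau>) - l s < 1" if "0 \<le> s" "s + \<tau> \<le> t" for s
    using that by force
  define k where "k = nat \<lfloor>t / \<tau>\<rfloor>"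
  have "0 \<le> t / \<tau>" using \<tau> by auto
  then have k: "real k \<le> t / \<tau>" "t / \<tau> < real k + 1" unfolding k_def by linarith+
  have k1: "real k * \<tau> \<le> t" "t \<le> real k * \<tau> + \<tau>" using k \<tau> by (auto simp: field_simps)
  have sum: "l (real i * \<tau>) - l 0 \<le> real i" if "i \<le> k" for i
    using that
  proof (induction i)
    case (Suc i)
    have "(real i + 1) * \<tau> \<le> real k * \<tau>" using Suc.prems \<tau> by (intro mult_right_mono) auto
    then have "real i * \<tau> + \<tau> \<le> t" using k1 by (simp add: algebra_simps)
    then have "l (real i * \<tau> + \<tau>) - l (real i * \<tau>) < 1" using \<tau> by (intro *) auto
    with Suc show ?case by (simp add: algebra_simps)
  qed simp
  \<comment> \<open>The last step is taken backwards from \<open>t\<close>, overlapping the grid, so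
    that it does not leave the interval.\<close>
  have "l t - l (t - \<tau>) < 1" using *[of "t - \<tau>"] \<tau> by simp
  moreover have "l (t - \<tau>) \<le> l (real k * \<tau>)" using k1 \<tau> by (intro mono) auto
  moreover have "l (real k * \<tau>) - l 0 \<le> real k" by (rule sum) simp
  ultimately have "l t - l 0 < real k + 1" by linarith
  moreover have "real k \<le> T / \<tau>" using k(1) \<tau> by (smt (verit) divide_right_mono)
  ultimately show False using big by simp
qed

text \<open>The two summands are the two alternatives of the dichotomy. If \<open>ln H\<close> has
  gained much before \<open>t\<close>, some step of length \<open>\<sigma> ^ (3 ^ J)\<close> gained
  1, and since \<open>2 * T \<le> real J * L\<close> the stages carry unit growth per \<sigma> from
  \<open>t\<close> all the way to \<open>T\<close>. Otherwise the gain itself bounds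
  \<open>H t\<close> by \<open>H 0\<close>.\<close>

lemma almost_log_convex_decay_pos:
  assumes alc: "almost_log_convex C T H" and C: "0 \<le> C"
    and pos: "\<And>t. t \<in> {0..T} \<Longrightarrow> 0 < H t"
    and mono: "\<And>s t. 0 \<le> s \<Longrightarrow> s \<le> t \<Longrightarrow> t \<le> T \<Longrightarrow> H s \<le> H t"
    and L: "0 < L" "192 * C * L \<le> 1" and J: "2 * T \<le> real J * L"
    and \<sigma>0: "\<sigma>0 \<le> 1 / 12" "2 * \<sigma>0 \<le> L"
    and \<eta>: "\<And>\<tau>. 0 < \<tau> \<Longrightarrow> \<tau> \<le> \<sigma>0 \<Longrightarrow> 24 * (C * loglip_modulus (2 * \<tau>)) \<le> 1"
    and \<sigma>: "0 < \<sigma>" "\<sigma> \<le> \<sigma>0" and t: "\<sigma> ^ (3 ^ J) \<le> t" "t \<le> T"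
  shows "H t \<le> H 0 * exp (T / \<sigma> ^ (3 ^ J) + 1) + H T * exp (2 - (T - t) / \<sigma>)"
proof -
  define \<tau> where "\<tau> = \<sigma> ^ (3 ^ J)"
  define l where "l = (\<lambda>t. ln (H t))"
  have Hl: "H r = exp (l r)" if "r \<in> {0..T}" for r using pos[OF that] by (simp add: l_def)
  have lmono: "l a \<le> l b" if "0 \<le> a" "a \<le> b" "b \<le> T" for a b
    using mono[OF that] pos[of a] pos[of b] that by (simp add: l_def)
  have \<tau>0: "0 < \<tau>" using \<sigma> by (simp add: \<tau>_def)
  have t0: "0 \<le> t" and T0: "0 \<le> T" using t \<tau>0 by (auto simp: \<tau>_def)
  show ?thesis
  proof (cases "T / \<tau> + 1 \<le> l t - l 0")
    case True
    then obtain s where s: "0 \<le> s" "s + \<tau> \<le> t" "1 \<le> l (s + \<tau>) - l s"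
      using exists_unit_increment[of T l \<tau> t] lmono \<tau>0 t by (auto simp: \<tau>_def)
    have inc: "1 \<le> l (r + \<sigma>) - l r" if "t \<le> r" "r + \<sigma> \<le> T" for r
      unfolding l_def
    proof (rule growth_stages[OF alc C pos mono L \<sigma>0 \<eta> \<sigma> s(1), of J])
      show "1 \<le> ln (H (s + \<sigma> ^ 3 ^ J)) - ln (H s)" using s(3) by (simp add: l_def \<tau>_def)
      show "s + \<sigma> ^ 3 ^ J \<le> r" using s(2) that by (simp add: \<tau>_def)
      show "r \<le> s + real J * L / 2" using J s that \<sigma> by simp
    qed (use that in auto)
    define m where "m = nat \<lfloor>(T - t) / \<sigma>\<rfloor>"
    have "0 \<le> (T - t) / \<sigma>" using t \<sigma> by auto
    then have m: "real m \<le> (T - t) / \<sigma>" "(T - t) / \<sigma> - 1 \<le> real m" unfolding m_def by linarith+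
    have mT: "t + real m * \<sigma> \<le> T" using m \<sigma> by (simp add: field_simps)
    have sum: "real i \<le> l (t + real i * \<sigma>) - l t" if "i \<le> m" for i
      using that
    proof (induction i)
      case (Suc i)
      have "(real i + 1) * \<sigma> \<le> real m * \<sigma>" using Suc.prems \<sigma> by (intro mult_right_mono) auto
      then have "t + real i * \<sigma> + \<sigma> \<le> T" using mT by (simp add: algebra_simps)
      then have "1 \<le> l (t + real i * \<sigma> + \<sigma>) - l (t + real i * \<sigma>)" using \<sigma> by (intro inc) auto
      with Suc show ?case by (simp add: algebra_simps)
    qed simp
    have "(T - t) / \<sigma> - 1 \<le> l (t + real m * \<sigma>) - l t" using m sum[of m] by simp
    also have "l (t + real m * \<sigma>) \<le> l T" using mT t0 \<sigma> by (intro lmono) auto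
    finally have "l t \<le> l T + (2 - (T - t) / \<sigma>)" by simp
    then have "H t \<le> H T * exp (2 - (T - t) / \<sigma>)"
      using t t0 T0 by (simp add: Hl exp_add[symmetric])
    moreover have "0 \<le> H 0" using pos[of 0] T0 by simp
    ultimately show ?thesis by (simp add: add_increasing)
  next
    case False
    then have "l t \<le> l 0 + (T / \<tau> + 1)" by simp
    then have "H t \<le> H 0 * exp (T / \<tau> + 1)" using t t0 T0 by (simp add: Hl exp_add[symmetric])
    moreover have "0 \<le> H T" using pos[of T] T0 by simp
    ultimately show ?thesis by (simp add: \<tau>_def add_increasing2)
  qed
qed

text \<open>\<open>J\<close> and \<open>\<sigma>0\<close> are obtained before \<open>H\<close> is
  given, so they depend on \<open>T\<close> and \<open>C\<close> only; this is the source of the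
  uniformity of the final constants. Zeros of \<open>H\<close> are handled by adding
  \<open>e > 0\<close> and letting it tend to 0.\<close>

lemma almost_log_convex_decay:
  assumes T: "0 < T" and C: "0 \<le> C"
  obtains J :: nat and \<sigma>0 :: real where "0 < \<sigma>0" "\<sigma>0 \<le> 1"
    "\<And>H \<sigma> t. almost_log_convex C T H \<Longrightarrow> (\<And>t. t \<in> {0..T} \<Longrightarrow> 0 \<le> H t) \<Longrightarrow>
      (\<And>s t. 0 \<le> s \<Longrightarrow> s \<le> t \<Longrightarrow> t \<le> T \<Longrightarrow> H s \<le> H t) \<Longrightarrow>
      0 < \<sigma> \<Longrightarrow> \<sigma> \<le> \<sigma>0 \<Longrightarrow> 0 \<le> t \<Longrightarrow> t \<le> T \<Longrightarrow>
      H t \<le> H 0 * exp (T / \<sigma> ^ (3 ^ J) + 1) + H T * exp (3 - (T - t) / \<sigma>)"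
proof -
  \<comment> \<open>With \<open>C + 1\<close> in place of \<open>C\<close> the length is defined
    also for \<open>C = 0\<close>.\<close>
  define L where "L = 1 / (192 * (C + 1))"
  have L: "0 < L" "192 * C * L \<le> 1" using C by (auto simp: L_def field_simps)
  define J where "J = nat \<lceil>2 * T / L\<rceil>"
  have "2 * T / L \<le> real J" unfolding J_def by linarith
  then have J: "2 * T \<le> real J * L" using L by (simp add: field_simps)
  have "((\<lambda>\<tau>. 24 * (C * (2 * \<tau> * (1 + \<bar>ln (2 * \<tau>)\<bar>)))) \<longlongrightarrow> 0) (at_right 0)"
    by real_asymp
  then have "\<forall>\<^sub>F \<tau> in at_right 0. 24 * (C * (2 * \<tau> * (1 + \<bar>ln (2 * \<tau>)\<bar>))) < 1"
    by (rule order_tendstoD) simp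
  then obtain b where b: "b > 0" "\<And>\<tau>. 0 < \<tau> \<Longrightarrow> \<tau> < b \<Longrightarrow> 24 * (C * (2 * \<tau> * (1 + \<bar>ln (2 * \<tau>)\<bar>))) < 1"
    unfolding eventually_at_right_field by auto
  define \<sigma>0 where "\<sigma>0 = min (min (1/12) (L / 2)) (min T (b / 2))"
  have \<sigma>0: "0 < \<sigma>0" "\<sigma>0 \<le> 1 / 12" "2 * \<sigma>0 \<le> L" "\<sigma>0 \<le> T" "\<sigma>0 < b"
    using L T b by (auto simp: \<sigma>0_def min_def)
  have \<eta>: "24 * (C * loglip_modulus (2 * \<tau>)) \<le> 1" if "0 < \<tau>" "\<tau> \<le> \<sigma>0" for \<tau>
    using b(2)[of \<tau>] that \<sigma>0 by (simp add: loglip_modulus_def)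
  show ?thesis
  proof (rule that[of \<sigma>0 J])
    fix H :: "real \<Rightarrow> real" and \<sigma> t
    assume H: "almost_log_convex C T H" "\<And>t. t \<in> {0..T} \<Longrightarrow> 0 \<le> H t"
      "\<And>s t. 0 \<le> s \<Longrightarrow> s \<le> t \<Longrightarrow> t \<le> T \<Longrightarrow> H s \<le> H t"
      and \<sigma>: "0 < \<sigma>" "\<sigma> \<le> \<sigma>0" and t: "0 \<le> t" "t \<le> T"
    define \<tau> where "\<tau> = \<sigma> ^ (3 ^ J)"
    have \<tau>0: "0 < \<tau>" using \<sigma> by (simp add: \<tau>_def)
    have \<tau>\<sigma>: "\<tau> \<le> \<sigma>" using power_decreasing[of 1 "3 ^ J" \<sigma>] \<sigma> \<sigma>0 by (simp add: \<tau>_def)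
    \<comment> \<open>The previous lemma needs \<tau> at most the time considered. Moving
      \<open>t\<close> forward to \<open>t'\<close> costs at most \<sigma>, that is one unit in the
      exponent: 3 instead of 2.\<close>
    define t' where "t' = max t \<tau>"
    have t': "\<tau> \<le> t'" "t \<le> t'" "t' \<le> T" "t' \<le> t + \<sigma>" using t \<tau>\<sigma> \<sigma> \<sigma>0 by (auto simp: t'_def)
    have "H t + e \<le> (H 0 + e) * exp (T / \<tau> + 1) + (H T + e) * exp (3 - (T - t) / \<sigma>)" if "e > 0" for e
    proof -
      have "H t + e \<le> H t' + e" using H(3)[of t t'] t t' by simp
      also have "\<dots> \<le> (H 0 + e) * exp (T / \<tau> + 1) + (H T + e) * exp (2 - (T - t') / \<sigma>)"
        unfolding \<tau>_def
      proof (rule almost_log_convex_decay_pos[OF almost_log_convex_add[OF H(1,2)] C _ _ L J \<sigma>0(2,3) \<eta> \<sigma>])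
        show "0 < H r + e" if "r \<in> {0..T}" for r using H(2)[OF that] \<open>e > 0\<close> by simp
        show "H r + e \<le> H r' + e" if "0 \<le> r" "r \<le> r'" "r' \<le> T" for r r' using H(3)[OF that] by simp
      qed (use that t' in \<open>auto simp: \<tau>_def\<close>)
      also have "2 - (T - t') / \<sigma> \<le> 3 - (T - t) / \<sigma>" 
      proof -
        have "(T - t) / \<sigma> - (T - t') / \<sigma> = (t' - t) / \<sigma>" by (simp add: diff_divide_distrib)
        also have "\<dots> \<le> 1" using t' \<sigma> by (simp add: field_simps)
        finally show ?thesis by simp
      qed
      finally show ?thesis using H(2)[of T] T \<open>e > 0\<close> by (simp add: mult_left_mono)
    qed
    then have "\<forall>\<^sub>F e in at_right 0. H t + e \<le> (H 0 + e) * exp (T / \<tau> + 1) + (H T + e) * exp (3 - (T - t) / \<sigma>)"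
      by (auto simp: eventually_at_right_field intro!: exI[of _ 1])
    moreover have "((\<lambda>e. H t + e) \<longlongrightarrow> H t + 0) (at_right 0)" by (intro tendsto_intros)
    moreover have "((\<lambda>e. (H 0 + e) * exp (T / \<tau> + 1) + (H T + e) * exp (3 - (T - t) / \<sigma>)) \<longlongrightarrow>
        (H 0 + 0) * exp (T / \<tau> + 1) + (H T + 0) * exp (3 - (T - t) / \<sigma>)) (at_right 0)"
      by (intro tendsto_intros)
    ultimately have "H t + 0 \<le> (H 0 + 0) * exp (T / \<tau> + 1) + (H T + 0) * exp (3 - (T - t) / \<sigma>)"
      by (intro tendsto_le[OF _ _ _ ]) auto
    then show "H t \<le> H 0 * exp (T / \<sigma> ^ (3 ^ J) + 1) + H T * exp (3 - (T - t) / \<sigma>)"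
      by (simp add: \<tau>_def)
  qed (use \<sigma>0 in auto)
qed

subsection \<open>The space of square integrable functions\<close>

text \<open>The real part of the Hermitian product. It is symmetric and real bilinear, and it splits
  into the pairings of real and imaginary parts, to which real test functions apply.\<close>

definition L2inner :: "(real^'n::finite \<Rightarrow> complex) \<Rightarrow> (real^'n \<Rightarrow> complex) \<Rightarrow> real" where
  "L2inner f g = (LINT x|lebesgue. f x \<bullet> g x)"

lemma L2_measurable: "f \<in> L2 \<Longrightarrow> f \<in> borel_measurable lebesgue"
  and L2_integrable_norm2: "f \<in> L2 \<Longrightarrow> integrable lebesgue (\<lambda>x. (norm (f x))\<^sup>2)"
  by (auto simp: L2_def)

lemma integrable_mult_of_squares:
  fixes f g :: "'a \<Rightarrow> 'b::{banach, second_countable_topology, real_inner}"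
  assumes [measurable]: "f \<in> borel_measurable M" "g \<in> borel_measurable M"
    and "integrable M (\<lambda>x. (norm (f x))\<^sup>2)" "integrable M (\<lambda>x. (norm (g x))\<^sup>2)"
  shows "integrable M (\<lambda>x. norm (f x) * norm (g x))"
proof (rule Bochner_Integration.integrable_bound[of _ "\<lambda>x. (norm (f x))\<^sup>2 + (norm (g x))\<^sup>2"])
  show "AE x in M. norm (norm (f x) * norm (g x)) \<le> norm ((norm (f x))\<^sup>2 + (norm (g x))\<^sup>2)"
  proof (rule AE_I2)
    fix x
    have "0 \<le> norm (f x) * norm (g x)" by simp
    then have "norm (f x) * norm (g x) \<le> (norm (f x))\<^sup>2 + (norm (g x))\<^sup>2"
      using sum_squares_bound[of "norm (f x)" "norm (g x)"] by linarith
    then show "norm (norm (f x) * norm (g x)) \<le> norm ((norm (f x))\<^sup>2 + (norm (g x))\<^sup>2)"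
      by simp
  qed
qed (use assms in auto)

lemma integrable_inner_of_squares:
  fixes f g :: "'a \<Rightarrow> 'b::{banach, second_countable_topology, real_inner}"
  assumes [measurable]: "f \<in> borel_measurable M" "g \<in> borel_measurable M"
    and "integrable M (\<lambda>x. (norm (f x))\<^sup>2)" "integrable M (\<lambda>x. (norm (g x))\<^sup>2)"
  shows "integrable M (\<lambda>x. f x \<bullet> g x)"
  by (rule Bochner_Integration.integrable_bound[OF integrable_mult_of_squares[OF assms]])
    (auto intro: Cauchy_Schwarz_ineq2)

lemma L2_integrable_inner: "f \<in> L2 \<Longrightarrow> g \<in> L2 \<Longrightarrow> integrable lebesgue (\<lambda>x. f x \<bullet> g x)"
  by (rule integrable_inner_of_squares) (auto simp: L2_def)

lemma L2_scaleR: "f \<in> L2 \<Longrightarrow> (\<lambda>x. c *\<^sub>R f x) \<in> L2"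
  by (auto simp: L2_def power_mult_distrib)

lemma L2_add:
  assumes "f \<in> L2" "g \<in> L2" shows "(\<lambda>x. f x + g x) \<in> L2"
proof -
  note [measurable] = L2_measurable[OF assms(1)] L2_measurable[OF assms(2)]
  have "integrable lebesgue (\<lambda>x. (norm (f x))\<^sup>2 + (norm (g x))\<^sup>2 + 2 * (f x \<bullet> g x))"
    using assms by (intro Bochner_Integration.integrable_add L2_integrable_norm2 integrable_mult_right L2_integrable_inner)
  then show ?thesis
    by (simp add: L2_def power2_norm_eq_inner inner_add inner_commute algebra_simps)
qed

lemma L2_minus: "f \<in> L2 \<Longrightarrow> (\<lambda>x. - f x) \<in> L2"
  using L2_scaleR[of f "-1"] by simp

lemma L2_diff: "f \<in> L2 \<Longrightarrow> g \<in> L2 \<Longrightarrow> (\<lambda>x. f x - g x) \<in> L2"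
  using L2_add[of f "\<lambda>x. - g x"] L2_minus[of g] by simp

lemma L2_sum: "(\<And>i. i \<in> I \<Longrightarrow> f i \<in> L2) \<Longrightarrow> (\<lambda>x. \<Sum>i\<in>I. f i x) \<in> L2"
proof (induction I rule: infinite_finite_induct)
  case (insert i I)
  then show ?case using L2_add[of "f i" "\<lambda>x. \<Sum>i\<in>I. f i x"] by simp
qed (auto simp: L2_def)

lemma L2inner_commute: "L2inner f g = L2inner g f"
  by (simp add: L2inner_def inner_commute)

lemma L2inner_add_left: "f \<in> L2 \<Longrightarrow> g \<in> L2 \<Longrightarrow> h \<in> L2 \<Longrightarrow> L2inner (\<lambda>x. f x + g x) h = L2inner f h + L2inner g h"
  by (simp add: L2inner_def inner_add_left L2_integrable_inner)

lemma L2inner_diff_left: "f \<in> L2 \<Longrightarrow> g \<in> L2 \<Longrightarrow> h \<in> L2 \<Longrightarrow> L2inner (\<lambda>x. f x - g x) h = L2inner f h - L2inner g h"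
  by (simp add: L2inner_def inner_diff_left L2_integrable_inner)

lemma L2inner_diff_right: "f \<in> L2 \<Longrightarrow> g \<in> L2 \<Longrightarrow> h \<in> L2 \<Longrightarrow> L2inner h (\<lambda>x. f x - g x) = L2inner h f - L2inner h g"
  by (simp add: L2inner_diff_left L2inner_commute[of h])

lemma L2inner_scaleR_left: "L2inner (\<lambda>x. c *\<^sub>R f x) g = c * L2inner f g"
  by (simp add: L2inner_def)

lemma L2inner_scaleR_right: "L2inner f (\<lambda>x. c *\<^sub>R g x) = c * L2inner f g"
  by (simp add: L2inner_def)

lemma L2norm_nonneg: "0 \<le> L2norm f"
  by (simp add: L2norm_def)

lemma L2norm_square: "(L2norm f)\<^sup>2 = L2inner f f"
  by (simp add: L2norm_def L2inner_def power2_norm_eq_inner)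

lemma L2inner_self_nonneg: "0 \<le> L2inner f f"
  using L2norm_square[of f] by (metis zero_le_power2)

lemma L2_Cauchy_Schwarz:
  assumes "f \<in> L2" "g \<in> L2"
  shows "\<bar>L2inner f g\<bar> \<le> L2norm f * L2norm g"
proof -
  have q: "0 \<le> L2inner f f - 2 * c * L2inner f g + c\<^sup>2 * L2inner g g" for c
  proof -
    have "0 \<le> L2inner (\<lambda>x. f x - c *\<^sub>R g x) (\<lambda>x. f x - c *\<^sub>R g x)" by (rule L2inner_self_nonneg)
    then show ?thesis using assms
      by (simp add: L2inner_diff_left L2inner_diff_right L2_diff L2_scaleR L2inner_scaleR_left L2inner_scaleR_right
          L2inner_commute[of g f] power2_eq_square algebra_simps)
  qed
  have "(L2inner f g)\<^sup>2 \<le> L2inner f f * L2inner g g"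
  proof (cases "L2inner g g = 0")
    case True
    have "L2inner f g = 0"
    proof (rule ccontr)
      assume "L2inner f g \<noteq> 0"
      \<comment> \<open>At this value of \<open>c\<close> the quadratic expression equals
        -1.\<close>
      then show False using q[of "(L2inner f f + 1) / (2 * L2inner f g)"] True by simp
    qed
    then show ?thesis using True by simp
  next
    case False
    then have "L2inner g g > 0" using L2inner_self_nonneg[of g] by simp
    then show ?thesis using q[of "L2inner f g / L2inner g g"]
      by (simp add: power2_eq_square field_simps)
  qed
  then have "(L2inner f g)\<^sup>2 \<le> (L2norm f * L2norm g)\<^sup>2"
    by (simp add: power_mult_distrib L2norm_square)
  then show ?thesis using L2norm_nonneg[of f] L2norm_nonneg[of g]
    by (metis abs_le_square_iff abs_of_nonneg mult_nonneg_nonneg)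
qed

section \<open>Time derivatives and continuity of pairings\<close>

lemma tendsto_L2inner:
  assumes F: "\<And>y. y \<in> S \<Longrightarrow> F y \<in> L2" and G: "\<And>y. y \<in> S \<Longrightarrow> G y \<in> L2" and f: "f \<in> L2" and g: "g \<in> L2"
    and S: "\<forall>\<^sub>F y in A. y \<in> S"
    and limF: "((\<lambda>y. L2norm (\<lambda>x. F y x - f x)) \<longlongrightarrow> 0) A"
    and limG: "((\<lambda>y. L2norm (\<lambda>x. G y x - g x)) \<longlongrightarrow> 0) A"
  shows "((\<lambda>y. L2inner (F y) (G y)) \<longlongrightarrow> L2inner f g) A"
proof (rule LIM_zero_cancel, rule Lim_null_comparison)
  let ?a = "\<lambda>y. L2norm (\<lambda>x. F y x - f x)" and ?b = "\<lambda>y. L2norm (\<lambda>x. G y x - g x)"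
  show "\<forall>\<^sub>F y in A. norm (L2inner (F y) (G y) - L2inner f g) \<le> ?a y * ?b y + ?a y * L2norm g + L2norm f * ?b y"
    using S
  proof eventually_elim
    case (elim y)
    note L = F[OF elim] G[OF elim] f g
    have "L2inner (F y) (G y) - L2inner f g =
        L2inner (\<lambda>x. F y x - f x) (\<lambda>x. G y x - g x) + L2inner (\<lambda>x. F y x - f x) g + L2inner f (\<lambda>x. G y x - g x)"
      using L by (simp add: L2inner_diff_left L2inner_diff_right L2_diff)
    moreover have "\<bar>L2inner (\<lambda>x. F y x - f x) (\<lambda>x. G y x - g x)\<bar> \<le> ?a y * ?b y"
      "\<bar>L2inner (\<lambda>x. F y x - f x) g\<bar> \<le> ?a y * L2norm g" "\<bar>L2inner f (\<lambda>x. G y x - g x)\<bar> \<le> L2norm f * ?b y"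
      using L by (auto intro!: L2_Cauchy_Schwarz L2_diff)
    ultimately show ?case by simp
  qed
  show "((\<lambda>y. ?a y * ?b y + ?a y * L2norm g + L2norm f * ?b y) \<longlongrightarrow> 0) A"
    using limF limG by (auto intro!: tendsto_eq_intros)
qed

lemma has_real_derivative_L2inner:
  fixes F G :: "real \<Rightarrow> real^'n::finite \<Rightarrow> complex"
  assumes S: "open S" "t \<in> S" and F: "\<And>y. y \<in> S \<Longrightarrow> F y \<in> L2" and G: "\<And>y. y \<in> S \<Longrightarrow> G y \<in> L2"
    and F': "F' \<in> L2" "((\<lambda>y. L2norm (\<lambda>x. (F y x - F t x) /\<^sub>R (y - t) - F' x)) \<longlongrightarrow> 0) (at t)"
    and G': "G' \<in> L2" "((\<lambda>y. L2norm (\<lambda>x. (G y x - G t x) /\<^sub>R (y - t) - G' x)) \<longlongrightarrow> 0) (at t)"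
    and G0: "((\<lambda>y. L2norm (\<lambda>x. G y x - G t x)) \<longlongrightarrow> 0) (at t)"
  shows "((\<lambda>y. L2inner (F y) (G y)) has_real_derivative L2inner F' (G t) + L2inner (F t) G') (at t)"
proof -
  have evS: "\<forall>\<^sub>F y in at t. y \<in> S" using S by (metis eventually_at_in_open' )
  have dF: "(\<lambda>x. (F y x - F t x) /\<^sub>R (y - t)) \<in> L2" "(\<lambda>x. (G y x - G t x) /\<^sub>R (y - t)) \<in> L2" if "y \<in> S" for y
    using F G S that by (auto intro!: L2_scaleR L2_diff)
  have "((\<lambda>y. L2inner (\<lambda>x. (F y x - F t x) /\<^sub>R (y - t)) (G y)) \<longlongrightarrow> L2inner F' (G t)) (at t)"
    by (rule tendsto_L2inner[where S=S]) (use dF F G F' S G0 evS in auto)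
  moreover have "((\<lambda>y. L2inner (F t) (\<lambda>x. (G y x - G t x) /\<^sub>R (y - t))) \<longlongrightarrow> L2inner (F t) G') (at t)"
    by (rule tendsto_L2inner[where S=S]) (use dF F G G' S G0 evS in \<open>auto simp: L2norm_def\<close>)
  ultimately have "((\<lambda>y. L2inner (\<lambda>x. (F y x - F t x) /\<^sub>R (y - t)) (G y) +
       L2inner (F t) (\<lambda>x. (G y x - G t x) /\<^sub>R (y - t))) \<longlongrightarrow> L2inner F' (G t) + L2inner (F t) G') (at t)"
    by (rule tendsto_add)
  moreover have "\<forall>\<^sub>F y in at t. L2inner (\<lambda>x. (F y x - F t x) /\<^sub>R (y - t)) (G y) +
       L2inner (F t) (\<lambda>x. (G y x - G t x) /\<^sub>R (y - t)) = (L2inner (F y) (G y) - L2inner (F t) (G t)) / (y - t)"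
    using evS
  proof eventually_elim
    case (elim y)
    show ?case unfolding L2inner_scaleR_left L2inner_scaleR_right using F G S elim
      by (simp add: L2inner_diff_left L2inner_diff_right divide_inverse algebra_simps)
  qed
  ultimately show ?thesis
    unfolding has_field_derivative_iff by (rule Lim_transform_eventually)
qed

lemma has_L2_deriv_at:
  assumes "has_L2_deriv {0..<T} u v" "0 < t" "t < T"
  shows "((\<lambda>s. L2norm (\<lambda>x. (u s x - u t x) /\<^sub>R (s - t) - v t x)) \<longlongrightarrow> 0) (at t)"
    and "u t \<in> L2" "v t \<in> L2"
proof -
  have "at t within {0..<T} = at t"
    by (rule at_within_open_subset[of _ "{0<..<T}"]) (use assms in auto)
  moreover have "((\<lambda>s. L2norm (\<lambda>x. (u s x - u t x) /\<^sub>R (s - t) - v t x)) \<longlongrightarrow> 0) (at t within {0..<T})"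
    using assms by (simp add: has_L2_deriv_def)
  ultimately show "((\<lambda>s. L2norm (\<lambda>x. (u s x - u t x) /\<^sub>R (s - t) - v t x)) \<longlongrightarrow> 0) (at t)"
    by simp
qed (use assms in \<open>auto simp: has_L2_deriv_def\<close>)

lemma L2norm_minus: "L2norm (\<lambda>x. - f x) = L2norm f"
  by (simp add: L2norm_def)

lemma C0_into_L2_at:
  assumes "u \<in> C0_into {0..T} L2 L2norm" "0 < t" "t < T"
  shows "((\<lambda>s. L2norm (\<lambda>x. u s x - u t x)) \<longlongrightarrow> 0) (at t)"
proof -
  have "at t within {0..T} = at t"
    by (rule at_within_open_subset[of _ "{0<..<T}"]) (use assms in auto)
  moreover have "((\<lambda>s. L2norm (\<lambda>x. u s x - u t x)) \<longlongrightarrow> 0) (at t within {0..T})"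
    using assms by (simp add: C0_into_def)
  ultimately show ?thesis by simp
qed

lemma has_derivative_L2norm_square:
  assumes u: "u \<in> C0_into {0..T} L2 L2norm" and v: "has_L2_deriv {0..<T} u v" and t: "0 < t" "t < T"
  shows "((\<lambda>s. L2inner (u s) (u s)) has_real_derivative 2 * L2inner (v t) (u t)) (at t)"
proof -
  have "((\<lambda>s. L2inner (u s) (u s)) has_real_derivative L2inner (v t) (u t) + L2inner (u t) (v t)) (at t)"
    by (rule has_real_derivative_L2inner[where S="{0<..<T}"])
      (use t has_L2_deriv_at[OF v] C0_into_L2_at[OF u] in auto)
  then show ?thesis by (simp add: L2inner_commute)
qed

text \<open>The reflection \<open>t - s\<close> reverses the time derivative of the second factor,
  hence the minus sign. The equation thus contributes a difference of two forms, in which only the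
  variation of the coefficients survives.\<close>

lemma has_derivative_L2inner_reflected:
  assumes u: "u \<in> C0_into {0..T} L2 L2norm" and v: "has_L2_deriv {0..<T} u v"
    and t: "0 < t - r" "t + r < T" "0 \<le> r"
  shows "((\<lambda>s. L2inner (u (t + s)) (u (t - s))) has_real_derivative
     L2inner (v (t + r)) (u (t - r)) - L2inner (u (t + r)) (v (t - r))) (at r)"
proof -
  have p: "0 < t + r" "t + r < T" "0 < t - r" "t - r < T" using t by auto
  have fp: "filterlim (\<lambda>s. t + s) (at (t + r)) (at r)"
    by (intro filterlim_atI tendsto_intros) (auto simp: eventually_at_filter)
  have fm: "filterlim (\<lambda>s. t - s) (at (t - r)) (at r)"
    by (intro filterlim_atI tendsto_intros) (auto simp: eventually_at_filter)
  have "((\<lambda>s. L2inner (u (t + s)) (u (t - s))) has_real_derivative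
     L2inner (v (t + r)) (u (t - r)) + L2inner (u (t + r)) (\<lambda>x. - v (t - r) x)) (at r)"
  proof (rule has_real_derivative_L2inner[where S="{- t<..<T - t} \<inter> {t - T<..<t}"])
    show "((\<lambda>y. L2norm (\<lambda>x. (u (t + y) x - u (t + r) x) /\<^sub>R (y - r) - v (t + r) x)) \<longlongrightarrow> 0) (at r)"
      using filterlim_compose[OF has_L2_deriv_at(1)[OF v p(1,2)] fp] by simp
    have "L2norm (\<lambda>x. (u (t - y) x - u (t - r) x) /\<^sub>R (y - r) - - v (t - r) x) =
      L2norm (\<lambda>x. (u (t - y) x - u (t - r) x) /\<^sub>R (t - y - (t - r)) - v (t - r) x)" for y
    proof -
      have "inverse (y - r) = - inverse (r - y)"
        by (metis inverse_minus_eq minus_diff_eq)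
      then have "(\<lambda>x. (u (t - y) x - u (t - r) x) /\<^sub>R (y - r) - - v (t - r) x) =
        (\<lambda>x. - ((u (t - y) x - u (t - r) x) /\<^sub>R (t - y - (t - r)) - v (t - r) x))"
        by auto
      then show ?thesis by (simp only: L2norm_minus)
    qed
    then show "((\<lambda>y. L2norm (\<lambda>x. (u (t - y) x - u (t - r) x) /\<^sub>R (y - r) - - v (t - r) x)) \<longlongrightarrow> 0) (at r)"
      using filterlim_compose[OF has_L2_deriv_at(1)[OF v p(3,4)] fm] by simp
    show "((\<lambda>y. L2norm (\<lambda>x. u (t - y) x - u (t - r) x)) \<longlongrightarrow> 0) (at r)"
      using filterlim_compose[OF C0_into_L2_at[OF u p(3,4)] fm] by simp
  qed (use p t has_L2_deriv_at(2,3)[OF v] in \<open>auto intro!: L2_minus\<close>)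
  then show ?thesis
    using L2inner_scaleR_right[of "u (t + r)" "-1" "v (t - r)"] by simp
qed

text \<open>Derivatives are available at interior times only; continuity up to 0 and
  \<open>T\<close> lets the monotonicity arguments reach the end points.\<close>

lemma continuous_on_L2inner_compose:
  fixes f g :: "real \<Rightarrow> real"
  assumes u: "u \<in> C0_into I L2 L2norm"
    and f: "continuous_on S f" "f ` S \<subseteq> I" and g: "continuous_on S g" "g ` S \<subseteq> I"
  shows "continuous_on S (\<lambda>s. L2inner (u (f s)) (u (g s)))"
  unfolding continuous_on_def
proof
  fix s assume s: "s \<in> S"
  have lim: "((\<lambda>r. L2norm (\<lambda>x. u (h r) x - u (h s) x)) \<longlongrightarrow> 0) (at s within S)"
    if h: "continuous_on S h" "h ` S \<subseteq> I" for h
  proof -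
    have "h s \<in> I" using h s by auto
    then have 0: "((\<lambda>r. L2norm (\<lambda>x. u r x - u (h s) x)) \<longlongrightarrow> 0) (at (h s) within I)"
      using u by (auto simp: C0_into_def)
    have "L2norm (\<lambda>x. u (h s) x - u (h s) x) = 0" by (simp add: L2norm_def)
    with 0 have "continuous (at (h s) within I) (\<lambda>r. L2norm (\<lambda>x. u r x - u (h s) x))"
      by (simp add: continuous_within)
    moreover have "continuous (at s within S) h" using h s by (simp add: continuous_on_eq_continuous_within)
    ultimately have "continuous (at s within S) ((\<lambda>r. L2norm (\<lambda>x. u r x - u (h s) x)) \<circ> h)"
      using h(2) by (intro continuous_within_compose) (auto intro: continuous_within_subset)
    then show ?thesis by (simp add: continuous_within o_def L2norm_def)
  qed
  show "((\<lambda>s. L2inner (u (f s)) (u (g s))) \<longlongrightarrow> L2inner (u (f s)) (u (g s))) (at s within S)"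
    by (rule tendsto_L2inner[where S=S])
      (use u f g s lim[OF f] lim[OF g] in \<open>auto simp: C0_into_def eventually_at_filter image_subset_iff\<close>)
qed

subsection \<open>Smooth bump functions\<close>

text \<open>A polynomial factor in \<open>1 / t\<close> makes the family closed under
  differentiation, so smoothness of the usual flat function follows by one induction over all
  \<open>p\<close>.\<close>

definition bump_fun :: "real poly \<Rightarrow> real \<Rightarrow> real" where
  "bump_fun p t = (if 0 < t then poly p (1 / t) * exp (- (1 / t)) else 0)"

text \<open>With \<open>y = 1 / t\<close>, the derivative of \<open>p(y) * exp (- y)\<close> in
  \<open>t\<close> is \<open>y^2 * (p(y) - p'(y)) * exp (- y)\<close>.\<close>

definition bump_step :: "real poly \<Rightarrow> real poly" where
  "bump_step p = [:0, 0, 1:] * (p - Polynomial.pderiv p)"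

lemma poly_times_exp_minus_tendsto_0:
  "((\<lambda>y. poly p y * exp (- y)) \<longlongrightarrow> (0::real)) at_top"
proof -
  have "((\<lambda>y. \<Sum>i\<le>degree p. coeff p i * (y ^ i / exp y)) \<longlongrightarrow> (\<Sum>i\<le>degree p. coeff p i * 0)) at_top"
    by (intro tendsto_intros tendsto_power_div_exp_0)
  then show ?thesis
    by (simp add: poly_altdef exp_minus sum_distrib_right divide_inverse mult.assoc)
qed

lemma DERIV_bump_fun: "(bump_fun p has_real_derivative bump_fun (bump_step p) t) (at t)"
proof -
  consider "t > 0" | "t < 0" | "t = 0" by linarith
  then show ?thesis
  proof cases
    case 1
    have "((\<lambda>t. poly p (1 / t) * exp (- (1 / t))) has_real_derivative bump_fun (bump_step p) t) (at t)"
      using 1 by (auto intro!: derivative_eq_intros DERIV_chain'[OF _ poly_DERIV]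
          simp: bump_fun_def bump_step_def field_simps power2_eq_square)
    then show ?thesis
      by (rule DERIV_cong_ev[THEN iffD1, rotated -1])
        (use 1 in \<open>auto simp: bump_fun_def intro!: eventually_mono[OF eventually_nhds_in_open[of "{0<..}"]]\<close>)
  next
    case 2
    have "((\<lambda>t. 0) has_real_derivative bump_fun (bump_step p) t) (at t)"
      using 2 by (simp add: bump_fun_def)
    then show ?thesis
      by (rule DERIV_cong_ev[THEN iffD1, rotated -1])
        (use 2 in \<open>auto simp: bump_fun_def intro!: eventually_mono[OF eventually_nhds_in_open[of "{..<0}"]]\<close>)
  next
    case 3
    have "((\<lambda>h. bump_fun p h / h) \<longlongrightarrow> 0) (at 0)"
      unfolding filterlim_at_split
    proof
      show "((\<lambda>h. bump_fun p h / h) \<longlongrightarrow> 0) (at_left 0)"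
        by (rule tendsto_eventually) (auto simp: bump_fun_def eventually_at_filter)
      \<comment> \<open>The division by \<open>h\<close> is multiplication by
        \<open>inverse h\<close>, so the difference quotient at 0 is again a polynomial times a
        decaying exponential.\<close>
      have "((\<lambda>h. poly (pCons 0 p) (inverse h) * exp (- inverse h)) \<longlongrightarrow> 0) (at_right 0)"
        by (rule filterlim_compose[OF poly_times_exp_minus_tendsto_0 filterlim_inverse_at_top_right])
      then show "((\<lambda>h. bump_fun p h / h) \<longlongrightarrow> 0) (at_right 0)"
        by (rule Lim_transform_eventually)
          (auto simp: bump_fun_def eventually_at_filter divide_inverse algebra_simps)
    qed
    then show ?thesis unfolding 3 has_field_derivative_iff by (simp add: bump_fun_def)
  qed
qed

section \<open>Radial bumps in several variables are test functions\<close>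

lemma Ck_Suc_imp: "Ck (Suc m) f \<Longrightarrow> Ck m f"
proof (induction m arbitrary: f)
  case 0
  then show ?case
    by (auto intro!: differentiable_imp_continuous_on differentiable_at_imp_differentiable_on)
next
  case (Suc m)
  then show ?case by (metis Ck.simps(2))
qed

lemma pderiv_at_eqI: "(f has_derivative f') (at x) \<Longrightarrow> pderiv_at k f x = f' (axis k 1)"
  unfolding pderiv_at_def by (simp add: frechet_derivative_at[symmetric])

lemma Ck_const: "Ck m (\<lambda>x. c)"
proof (induction m arbitrary: c)
  case (Suc m)
  have "pderiv_at k (\<lambda>x. c) = (\<lambda>x. 0)" for k :: 'a
    by (rule ext, rule pderiv_at_eqI) (rule has_derivative_const)
  with Suc show ?case by simp
qed simp

lemma Ck_add: "Ck m f \<Longrightarrow> Ck m g \<Longrightarrow> Ck m (\<lambda>x. f x + g x)"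
proof (induction m arbitrary: f g)
  case 0
  then show ?case by (auto intro: continuous_on_add)
next
  case (Suc m)
  have "pderiv_at k (\<lambda>x. f x + g x) = (\<lambda>x. pderiv_at k f x + pderiv_at k g x)" for k
  proof
    fix x
    have "(f has_derivative frechet_derivative f (at x)) (at x)" "(g has_derivative frechet_derivative g (at x)) (at x)"
      using Suc.prems by (simp_all add: frechet_derivative_works[symmetric])
    from pderiv_at_eqI[OF has_derivative_add[OF this]]
    show "pderiv_at k (\<lambda>x. f x + g x) x = pderiv_at k f x + pderiv_at k g x" by (simp add: pderiv_at_def)
  qed
  with Suc show ?case by (auto intro!: differentiable_add)
qed

lemma Ck_mult: "Ck m f \<Longrightarrow> Ck m g \<Longrightarrow> Ck m (\<lambda>x. f x * g x)"
proof (induction m arbitrary: f g)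
  case 0
  then show ?case by (auto intro: continuous_on_mult)
next
  case (Suc m)
  have pderiv_mult: "pderiv_at k (\<lambda>x. f x * g x) = (\<lambda>x. f x * pderiv_at k g x + pderiv_at k f x * g x)" for k
  proof
    fix x
    have "(f has_derivative frechet_derivative f (at x)) (at x)" "(g has_derivative frechet_derivative g (at x)) (at x)"
      using Suc.prems by (simp_all add: frechet_derivative_works[symmetric])
    from pderiv_at_eqI[OF has_derivative_mult[OF this]]
    show "pderiv_at k (\<lambda>x. f x * g x) x = f x * pderiv_at k g x + pderiv_at k f x * g x" by (simp add: pderiv_at_def)
  qed
  have fg: "Ck m f" "Ck m g" using Suc.prems Ck_Suc_imp by blast+
  have pd: "Ck m (pderiv_at k f)" "Ck m (pderiv_at k g)" for k
    using Suc.prems by simp_all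
  have "Ck m (\<lambda>x. f x * pderiv_at k g x + pderiv_at k f x * g x)" for k
    by (intro Ck_add Suc.IH fg pd)
  moreover have "\<forall>x. (\<lambda>x. f x * g x) differentiable at x"
    using Suc.prems by (auto intro: differentiable_mult)
  ultimately show ?case by (simp add: pderiv_mult)
qed

definition bump :: "real \<Rightarrow> real poly \<Rightarrow> real^'n::finite \<Rightarrow> real" where
  "bump r p z = bump_fun p (r\<^sup>2 - z \<bullet> z)"

text \<open>The \<open>k\<close>-th partial derivative of \<open>bump r 1\<close>. As a kernel in
  its own right it is odd, while the bump is even; this fixes the signs in the integration by
  parts.\<close>

definition bump_pderiv :: "real \<Rightarrow> 'n::finite \<Rightarrow> real^'n \<Rightarrow> real" where
  "bump_pderiv r k z = bump r (bump_step 1) z * (- 2 * z $ k)"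

lemma has_derivative_bump:
  "((\<lambda>x. bump r p (x - c)) has_derivative (\<lambda>h. bump r (bump_step p) (x - c) * (- 2 * ((x - c) \<bullet> h)))) (at x)"
proof -
  have "((\<lambda>x. r\<^sup>2 - (x - c) \<bullet> (x - c)) has_derivative (\<lambda>h. - 2 * ((x - c) \<bullet> h))) (at x)"
    by (auto intro!: derivative_eq_intros simp: inner_commute)
  from has_derivative_compose[OF this DERIV_bump_fun[of p, unfolded has_field_derivative_def]]
  show ?thesis by (simp add: bump_def)
qed

lemma pderiv_at_bump:
  "pderiv_at k (\<lambda>x. bump r p (x - c)) = (\<lambda>x. bump r (bump_step p) (x - c) * (- 2 * (x - c) $ k))"
  by (rule ext, subst pderiv_at_eqI[OF has_derivative_bump]) (simp add: inner_axis)

lemma Ck_coordinate: "Ck m (\<lambda>x::real^'n::finite. x $ k)"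
proof (cases m)
  case 0
  then show ?thesis by (simp add: continuous_on_component)
next
  case (Suc l)
  have d: "((\<lambda>x::real^'n. x $ k) has_derivative (\<lambda>h. h $ k)) (at x)" for x
    by (rule bounded_linear.has_derivative[OF bounded_linear_vec_nth]) (rule has_derivative_ident)
  have "pderiv_at j (\<lambda>x::real^'n. x $ k) = (\<lambda>x. axis j 1 $ k)" for j
    by (rule ext, rule pderiv_at_eqI[OF d])
  with Suc show ?thesis using d by (auto simp: Ck_const differentiable_def)
qed

lemma Ck_bump: "Ck m (\<lambda>x. bump r p (x - c))"
proof (induction m arbitrary: p)
  case 0
  have "(\<lambda>x. bump r p (x - c)) differentiable (at x)" for x
    using has_derivative_bump unfolding differentiable_def by blast
  then show ?case
    by (auto intro!: differentiable_imp_continuous_on differentiable_at_imp_differentiable_on)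
next
  case (Suc m)
  have "Ck m (\<lambda>x. bump r (bump_step p) (x - c) * (- 2 * (x - c) $ k))" for k
    using Ck_add[OF Ck_coordinate[of m k] Ck_const[of m "- c $ k"]]
    by (intro Ck_mult Suc Ck_const) simp
  moreover have "(\<lambda>x. bump r p (x - c)) differentiable (at x)" for x
    using has_derivative_bump unfolding differentiable_def by blast
  ultimately show ?case by (simp add: pderiv_at_bump)
qed

lemma bump_outside: "0 \<le> r \<Longrightarrow> r \<le> norm z \<Longrightarrow> bump r p z = 0"
  using power_mono[of r "norm z" 2] by (simp add: bump_def bump_fun_def power2_norm_eq_inner)

lemma bump_pderiv_outside: "0 \<le> r \<Longrightarrow> r \<le> norm z \<Longrightarrow> bump_pderiv r k z = 0"
  by (simp add: bump_pderiv_def bump_outside)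

lemma bump_test_function:
  assumes "0 \<le> r" shows "(\<lambda>x. bump r p (x - c)) \<in> test_functions"
proof -
  have "{x. bump r p (x - c) \<noteq> 0} \<subseteq> cball c r"
    using bump_outside[OF assms, of _ p] by (force simp: dist_norm norm_minus_commute)
  then have "closure {x. bump r p (x - c) \<noteq> 0} \<subseteq> cball c r"
    by (rule closure_minimal) simp
  then have "compact (closure {x. bump r p (x - c) \<noteq> 0})"
    by (meson closed_closure compact_cball compact_eq_bounded_closed bounded_subset)
  then show ?thesis by (simp add: test_functions_def Ck_bump)
qed

lemma continuous_on_bump: "continuous_on UNIV (bump r p)"
  using Ck_bump[of 0 r p 0] by simp

lemma continuous_on_bump_pderiv: "continuous_on UNIV (bump_pderiv r k)"
  unfolding bump_pderiv_def[abs_def] by (intro continuous_intros continuous_on_bump)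

lemma bump_nonneg: "0 \<le> bump r 1 z"
  by (simp add: bump_def bump_fun_def)

lemma bump_minus: "bump r p (- z) = bump r p z"
  by (simp add: bump_def)

lemma bump_pderiv_minus: "bump_pderiv r k (- z) = - bump_pderiv r k z"
  by (simp add: bump_pderiv_def bump_minus)

lemma bump_swap: "bump r p (x - y) = bump r p (y - x)"
  using bump_minus[of r p "x - y"] by simp

lemma bump_pderiv_swap: "bump_pderiv r k (x - y) = - bump_pderiv r k (y - x)"
  using bump_pderiv_minus[of r k "y - x"] by simp

subsection \<open>Translation and mollification\<close>

lemma integrable_translation:
  fixes f :: "'a::euclidean_space \<Rightarrow> 'b::{banach, second_countable_topology}"
  assumes "integrable lborel f"
  shows "integrable lborel (\<lambda>x. f (x + z))" and "(LINT x|lborel. f (x + z)) = (LINT x|lborel. f x)"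
proof -
  have [measurable]: "f \<in> borel_measurable borel" using borel_measurable_integrable[OF assms] by simp
  have "integrable (distr lborel borel ((+) z)) f" using assms by (simp add: lborel_distr_plus)
  then show "integrable lborel (\<lambda>x. f (x + z))"
    by (subst (asm) integrable_distr_eq) (auto simp: add.commute)
  have "(LINT x|distr lborel borel ((+) z). f x) = (LINT x|lborel. f (x + z))"
    by (subst integral_distr) (auto simp: add.commute)
  then show "(LINT x|lborel. f (x + z)) = (LINT x|lborel. f x)" by (simp add: lborel_distr_plus)
qed

lemma nn_integral_translation:
  fixes f :: "'a::euclidean_space \<Rightarrow> ennreal"
  assumes [measurable]: "f \<in> borel_measurable borel"
  shows "(\<integral>\<^sup>+x. f (x + z) \<partial>lborel) = (\<integral>\<^sup>+x. f x \<partial>lborel)"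
proof -
  have "(\<integral>\<^sup>+x. f x \<partial>distr lborel borel ((+) z)) = (\<integral>\<^sup>+x. f (x + z) \<partial>lborel)"
    by (subst nn_integral_distr) (auto simp: add.commute)
  then show ?thesis by (simp add: lborel_distr_plus)
qed

text \<open>The modulus of continuity of translations in the space of integrable functions.\<close>

definition translation_modulus :: "('a::euclidean_space \<Rightarrow> real) \<Rightarrow> 'a \<Rightarrow> real" where
  "translation_modulus f z = (LINT x|lborel. \<bar>f (x + z) - f x\<bar>)"

lemma integrable_translation_diff:
  "integrable lborel f \<Longrightarrow> integrable lborel (\<lambda>x. \<bar>f (x + z) - f x\<bar> :: real)"
  using integrable_translation(1)[of f z] by auto

lemma translation_modulus_le:
  assumes f: "integrable lborel f" and g: "integrable lborel g"
  shows "translation_modulus f z \<le> translation_modulus g z + 2 * (LINT x|lborel. \<bar>f x - g x\<bar>)"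
proof -
  have d: "integrable lborel (\<lambda>x. \<bar>f x - g x\<bar>)" using f g by auto
  have "translation_modulus f z \<le>
    (LINT x|lborel. \<bar>g (x + z) - g x\<bar> + \<bar>f (x + z) - g (x + z)\<bar> + \<bar>f x - g x\<bar>)"
    unfolding translation_modulus_def
    using integrable_translation_diff[OF f] integrable_translation_diff[OF g] d integrable_translation(1)[OF d]
    by (intro integral_mono) auto
  also have "\<dots> = translation_modulus g z + 2 * (LINT x|lborel. \<bar>f x - g x\<bar>)"
    using integrable_translation_diff[OF g] d integrable_translation[OF d, of z]
    by (simp add: translation_modulus_def)
  finally show ?thesis .
qed

lemma translation_modulus_nonneg: "0 \<le> translation_modulus f z"
  by (simp add: translation_modulus_def)

text \<open>Continuity of translations survives limits in the integral norm, since the moduli of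
  \<open>f\<close> and \<open>g\<close> differ by at most twice their distance.\<close>

lemma translation_modulus_approx:
  assumes f: "integrable lborel f"
    and approx: "\<And>e. e > 0 \<Longrightarrow> \<exists>g. integrable lborel g \<and> (LINT x|lborel. \<bar>f x - g x\<bar>) < e \<and>
        ((translation_modulus g \<longlongrightarrow> 0) (at 0))"
  shows "(translation_modulus f \<longlongrightarrow> 0) (at 0)"
proof (rule tendstoI)
  fix e :: real assume "e > 0"
  then obtain g where g: "integrable lborel g" "(LINT x|lborel. \<bar>f x - g x\<bar>) < e / 4"
    "(translation_modulus g \<longlongrightarrow> 0) (at 0)"
    using approx[of "e / 4"] by auto
  have "\<forall>\<^sub>F z in at 0. translation_modulus g z < e / 2"
    using order_tendstoD(2)[OF g(3), of "e / 2"] \<open>e > 0\<close> by simp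
  then show "\<forall>\<^sub>F z in at 0. dist (translation_modulus f z) 0 < e"
  proof eventually_elim
    case (elim z)
    then show ?case using translation_modulus_le[OF f g(1), of z] g(2) translation_modulus_nonneg[of f z]
      by simp
  qed
qed

lemma translation_modulus_open:
  fixes U :: "'a::euclidean_space set"
  assumes U: "open U" "emeasure lborel U < \<infinity>"
  shows "(translation_modulus (\<lambda>x. indicator U x * c) \<longlongrightarrow> 0) (at 0)"
proof -
  let ?i = "\<lambda>x. indicator U x :: real"
  have [measurable]: "U \<in> sets borel" using U by auto
  have int: "integrable lborel ?i" using U by auto
  have int2: "integrable lborel (\<lambda>x. ?i (x + z) * ?i x)" for z
    by (rule Bochner_Integration.integrable_bound[OF int]) (auto split: split_indicator)
  \<comment> \<open>For values 0 and 1 the absolute difference is the sum minus twice the product.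
    Only the product depends on \<open>z\<close> after integration, and it converges pointwise
    because \<open>U\<close> is open.\<close>
  have eq: "translation_modulus (\<lambda>x. ?i x * c) z = 2 * \<bar>c\<bar> * ((LINT x|lborel. ?i x) - (LINT x|lborel. ?i (x + z) * ?i x))" for z
  proof -
    have "translation_modulus (\<lambda>x. ?i x * c) z = (LINT x|lborel. \<bar>c\<bar> * (?i (x + z) + ?i x - 2 * (?i (x + z) * ?i x)))"
      unfolding translation_modulus_def by (intro Bochner_Integration.integral_cong) (auto split: split_indicator)
    also have "\<dots> = \<bar>c\<bar> * ((LINT x|lborel. ?i (x + z)) + (LINT x|lborel. ?i x) - 2 * (LINT x|lborel. ?i (x + z) * ?i x))"
      using int2[of z] int integrable_translation(1)[OF int, of z] by simp
    finally show ?thesis using integrable_translation(2)[OF int, of z] by simp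
  qed
  have "((\<lambda>z. LINT x|lborel. ?i (x + z) * ?i x) \<longlongrightarrow> (LINT x|lborel. ?i x)) (at 0)"
    unfolding tendsto_at_iff_sequentially o_def
  proof (intro allI impI)
    fix Z :: "nat \<Rightarrow> 'a" assume Z: "\<forall>i. Z i \<in> UNIV - {0}" "Z \<longlonglongrightarrow> 0"
    show "(\<lambda>i. LINT x|lborel. ?i (x + Z i) * ?i x) \<longlonglongrightarrow> (LINT x|lborel. ?i x)"
    proof (rule integral_dominated_convergence[where w="?i"])
      show "AE x in lborel. (\<lambda>i. ?i (x + Z i) * ?i x) \<longlonglongrightarrow> ?i x"
      proof (rule AE_I2)
        fix x
        show "(\<lambda>i. ?i (x + Z i) * ?i x) \<longlonglongrightarrow> ?i x"
        proof (cases "x \<in> U")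
          case True
          have "(\<lambda>i. x + Z i) \<longlonglongrightarrow> x + 0" using Z(2) by (intro tendsto_intros)
          then have "\<forall>\<^sub>F i in sequentially. x + Z i \<in> U"
            using topological_tendstoD[OF _ U(1)] True by simp
          then have "\<forall>\<^sub>F i in sequentially. ?i (x + Z i) * ?i x = ?i x"
            by eventually_elim (simp add: True)
          then show ?thesis by (rule tendsto_eventually)
        qed simp
      qed
    qed (use int in \<open>auto split: split_indicator\<close>)
  qed
  then have "((\<lambda>z. 2 * \<bar>c\<bar> * ((LINT x|lborel. ?i x) - (LINT x|lborel. ?i (x + z) * ?i x))) \<longlongrightarrow>
     2 * \<bar>c\<bar> * ((LINT x|lborel. ?i x) - (LINT x|lborel. ?i x))) (at 0)"
    by (intro tendsto_intros)
  moreover have "translation_modulus (\<lambda>x. ?i x * c) = (\<lambda>z. 2 * \<bar>c\<bar> * ((LINT x|lborel. ?i x) - (LINT x|lborel. ?i (x + z) * ?i x)))"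
    by (rule ext) (rule eq)
  ultimately show ?thesis by simp
qed

text \<open>Indicators of Borel sets of finite measure are approximated by open sets through outer
  regularity; sums and dominated limits then reach every integrable function.\<close>

lemma translation_modulus_tendsto_0:
  fixes f :: "'a::euclidean_space \<Rightarrow> real"
  assumes "integrable lborel f"
  shows "(translation_modulus f \<longlongrightarrow> 0) (at 0)"
  using assms
proof (induction rule: integrable_induct)
  case (base A c)
  have A[measurable]: "A \<in> sets borel" using base by simp
  have intA: "integrable lborel (\<lambda>x. indicator A x *\<^sub>R c)" using base by simp
  show ?case
  proof (rule translation_modulus_approx[OF intA])
    fix e :: real assume "e > 0"
    define d where "d = e / (\<bar>c\<bar> + 1)"
    have "d > 0" using \<open>e > 0\<close> by (simp add: d_def)
    have "A \<in> sets lebesgue" using A by simp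
    then obtain U where U: "open U" "A \<subseteq> U" "(U - A) \<in> lmeasurable" "emeasure lebesgue (U - A) < ennreal d"
      using sets_lebesgue_outer_open[OF _ \<open>d > 0\<close>] by metis
    have [measurable]: "U \<in> sets borel" using U by auto
    have em: "emeasure lborel (U - A) < ennreal d" using U(4) by (simp add: emeasure_completion)
    have "emeasure lborel U \<le> emeasure lborel A + emeasure lborel (U - A)"
      using emeasure_subadditive[of A lborel "U - A"] U(2) by (simp add: Un_absorb1)
    also have "\<dots> < \<infinity>" using base em by (auto simp: less_top[symmetric] top_unique)
    finally have finU: "emeasure lborel U < \<infinity>" .
    have "(LINT x|lborel. \<bar>indicator A x *\<^sub>R c - indicator U x * c\<bar>) = (LINT x|lborel. \<bar>c\<bar> * indicator (U - A) x)"
      using U(2) by (intro Bochner_Integration.integral_cong) (auto split: split_indicator)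
    also have "\<dots> = \<bar>c\<bar> * measure lborel (U - A)" by simp
    also have "\<dots> \<le> \<bar>c\<bar> * d"
      using em \<open>d > 0\<close> by (intro mult_left_mono) (auto simp: measure_def enn2real_leI less_imp_le)
    also have "\<dots> < e" using \<open>e > 0\<close> by (simp add: d_def field_simps)
    finally show "\<exists>g. integrable lborel g \<and> (LINT x|lborel. \<bar>indicator A x *\<^sub>R c - g x\<bar>) < e \<and>
        (translation_modulus g \<longlongrightarrow> 0) (at 0)"
      using finU translation_modulus_open[OF U(1) finU, of c]
      by (intro exI[of _ "\<lambda>x. indicator U x * c"]) auto
  qed
next
  case (add f g)
  have le: "translation_modulus (\<lambda>x. f x + g x) z \<le> translation_modulus f z + translation_modulus g z" for z
  proof -
    note i = integrable_translation_diff[OF add(1), of z] integrable_translation_diff[OF add(2), of z]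
    have "translation_modulus (\<lambda>x. f x + g x) z \<le> (LINT x|lborel. \<bar>f (x + z) - f x\<bar> + \<bar>g (x + z) - g x\<bar>)"
      unfolding translation_modulus_def
      using i integrable_translation_diff[OF Bochner_Integration.integrable_add[OF add(1,2)], of z]
      by (intro integral_mono) auto
    then show ?thesis using i by (simp add: translation_modulus_def)
  qed
  show ?case
    by (rule tendsto_sandwich[OF _ _ tendsto_const, of _ _ _ "\<lambda>z. translation_modulus f z + translation_modulus g z"])
      (use le add in \<open>auto simp: translation_modulus_nonneg intro!: tendsto_add_zero\<close>)
next
  case (lim f s)
  show ?case
  proof (rule translation_modulus_approx[OF lim.hyps(4)])
    fix e :: real assume "e > 0"
    have [measurable]: "f \<in> borel_measurable lborel" "\<And>i. s i \<in> borel_measurable lborel"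
      using lim.hyps(1,4) by auto
    have "(\<lambda>i. LINT x|lborel. \<bar>f x - s i x\<bar>) \<longlonglongrightarrow> integral\<^sup>L lborel (\<lambda>x::'a. 0::real)"
    proof (rule integral_dominated_convergence[where w="\<lambda>x. 3 * \<bar>f x\<bar>"])
      show "AE x in lborel. (\<lambda>i. \<bar>f x - s i x\<bar>) \<longlonglongrightarrow> 0"
      proof (rule AE_I2, rule tendsto_rabs_zero)
        fix x :: 'a
        have "(\<lambda>i. f x - s i x) \<longlonglongrightarrow> f x - f x"
          by (intro tendsto_intros lim.hyps(2)) simp
        then show "(\<lambda>i. f x - s i x) \<longlonglongrightarrow> 0" by simp
      qed
      show "AE x in lborel. norm \<bar>f x - s i x\<bar> \<le> 3 * \<bar>f x\<bar>" for i
      proof (rule AE_I2)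
        fix x
        show "norm \<bar>f x - s i x\<bar> \<le> 3 * \<bar>f x\<bar>" using lim.hyps(3)[of x i] by simp
      qed
    qed (use lim in auto)
    then have "\<forall>\<^sub>F i in sequentially. (LINT x|lborel. \<bar>f x - s i x\<bar>) < e"
      using order_tendstoD(2)[of _ 0] \<open>e > 0\<close> by simp
    then obtain i where "(LINT x|lborel. \<bar>f x - s i x\<bar>) < e" by (auto simp: eventually_sequentially)
    then show "\<exists>g. integrable lborel g \<and> (LINT x|lborel. \<bar>f x - g x\<bar>) < e \<and> (translation_modulus g \<longlongrightarrow> 0) (at 0)"
      using lim by blast
  qed
qed

lemma translation_modulus_small:
  fixes f :: "'a::euclidean_space \<Rightarrow> real"
  assumes "integrable lborel f" "e > 0"
  shows "\<exists>d>0. \<forall>z. norm z < d \<longrightarrow> translation_modulus f z \<le> e"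
proof -
  have "\<forall>\<^sub>F z in at 0. translation_modulus f z < e"
    using order_tendstoD(2)[OF translation_modulus_tendsto_0[OF assms(1)] assms(2)] .
  then obtain d where d: "d > 0" "\<And>z. z \<noteq> 0 \<Longrightarrow> norm z < d \<Longrightarrow> translation_modulus f z < e"
    by (auto simp: eventually_at)
  have "translation_modulus f z \<le> e" if "norm z < d" for z
    using d(2)[of z] that assms(2) by (cases "z = 0") (auto simp: translation_modulus_def)
  with d(1) show ?thesis by blast
qed

section \<open>Double integrals against convolution kernels\<close>

lemma integrable_kernel_fst:
  fixes k g :: "'a::euclidean_space \<Rightarrow> real"
  assumes k: "integrable lborel k" and g: "integrable lborel g"
  shows "integrable (lborel \<Otimes>\<^sub>M lborel) (\<lambda>(x, y). k (y - x) * g x)"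
    and "(LINT (x, y)|(lborel \<Otimes>\<^sub>M lborel). k (y - x) * g x) = (LINT z|lborel. k z) * (LINT x|lborel. g x)"
proof -
  have [measurable]: "k \<in> borel_measurable borel" "g \<in> borel_measurable borel" using assms by auto
  have tk: "integrable lborel (\<lambda>y. k (y - x))" "(LINT y|lborel. k (y - x)) = (LINT z|lborel. k z)"
    "(LINT y|lborel. \<bar>k (y - x)\<bar>) = (LINT z|lborel. \<bar>k z\<bar>)" for x
    using integrable_translation[OF k, of "- x"] integrable_translation[OF integrable_abs[OF k], of "- x"] by auto
  show int: "integrable (lborel \<Otimes>\<^sub>M lborel) (\<lambda>(x, y). k (y - x) * g x)"
  proof (rule lborel_pair.Fubini_integrable)
    show "integrable lborel (\<lambda>x. LINT y|lborel. norm (case (x, y) of (x, y) \<Rightarrow> k (y - x) * g x))"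
      using g by (simp add: abs_mult tk)
    show "AE x in lborel. integrable lborel (\<lambda>y. case (x, y) of (x, y) \<Rightarrow> k (y - x) * g x)"
      using tk(1) by simp
  qed measurable
  show "(LINT (x, y)|(lborel \<Otimes>\<^sub>M lborel). k (y - x) * g x) = (LINT z|lborel. k z) * (LINT x|lborel. g x)"
    using lborel_pair.integral_fst'[OF int] by (simp add: tk)
qed

lemma integrable_kernel_snd:
  fixes k g :: "'a::euclidean_space \<Rightarrow> real"
  assumes k: "integrable lborel k" and g: "integrable lborel g" and even: "\<And>z. k (- z) = k z"
  shows "integrable (lborel \<Otimes>\<^sub>M lborel) (\<lambda>(x, y). k (y - x) * g y)"
proof -
  have "k (x - y) = k (y - x)" for x y using even[of "y - x"] by simp
  then show ?thesis using lborel_pair.integrable_product_swap[OF integrable_kernel_fst(1)[OF k g]] by simp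
qed

text \<open>The bound of a product by a sum of squares reduces this to kernels acting on one
  variable. Evenness is asked of the absolute value only, so the odd kernel
  \<open>bump_pderiv\<close> is covered as well.\<close>

lemma integrable_kernel_product:
  fixes k v w :: "'a::euclidean_space \<Rightarrow> real"
  assumes [measurable]: "v \<in> borel_measurable borel" "w \<in> borel_measurable borel"
    and sq: "integrable lborel (\<lambda>x. (v x)\<^sup>2)" "integrable lborel (\<lambda>x. (w x)\<^sup>2)"
    and k: "integrable lborel k" and even: "\<And>z. \<bar>k (- z)\<bar> = \<bar>k z\<bar>"
  shows "integrable (lborel \<Otimes>\<^sub>M lborel) (\<lambda>(x, y). v x * k (y - x) * w y)"
proof (rule Bochner_Integration.integrable_bound)
  have [measurable]: "k \<in> borel_measurable borel" using k by auto
  show "(\<lambda>(x, y). v x * k (y - x) * w y) \<in> borel_measurable (lborel \<Otimes>\<^sub>M lborel)" by measurable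
  show "integrable (lborel \<Otimes>\<^sub>M lborel) (\<lambda>p. (case p of (x, y) \<Rightarrow> \<bar>k (y - x)\<bar> * (v x)\<^sup>2) + (case p of (x, y) \<Rightarrow> \<bar>k (y - x)\<bar> * (w y)\<^sup>2))"
    using integrable_kernel_fst(1)[OF integrable_abs[OF k] sq(1)] integrable_kernel_snd[OF integrable_abs[OF k] sq(2) even]
    by (rule Bochner_Integration.integrable_add)
  show "AE p in lborel \<Otimes>\<^sub>M lborel. norm (case p of (x, y) \<Rightarrow> v x * k (y - x) * w y)
     \<le> norm ((case p of (x, y) \<Rightarrow> \<bar>k (y - x)\<bar> * (v x)\<^sup>2) + (case p of (x, y) \<Rightarrow> \<bar>k (y - x)\<bar> * (w y)\<^sup>2))"
  proof (rule AE_I2, clarify)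
    fix x y
    have "2 * (\<bar>v x\<bar> * \<bar>w y\<bar>) \<le> (v x)\<^sup>2 + (w y)\<^sup>2"
      using sum_squares_bound[of "\<bar>v x\<bar>" "\<bar>w y\<bar>"] by (simp add: mult.assoc)
    then have "\<bar>v x\<bar> * \<bar>w y\<bar> \<le> (v x)\<^sup>2 + (w y)\<^sup>2"
      using mult_nonneg_nonneg[of "\<bar>v x\<bar>" "\<bar>w y\<bar>"] by linarith
    then have "\<bar>k (y - x)\<bar> * (\<bar>v x\<bar> * \<bar>w y\<bar>) \<le> \<bar>k (y - x)\<bar> * ((v x)\<^sup>2 + (w y)\<^sup>2)"
      by (rule mult_left_mono) simp
    then show "norm (v x * k (y - x) * w y) \<le> norm (\<bar>k (y - x)\<bar> * (v x)\<^sup>2 + \<bar>k (y - x)\<bar> * (w y)\<^sup>2)"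
      by (simp add: abs_mult algebra_simps)
  qed
qed

text \<open>Substituting \<open>y = z + x\<close> and integrating first in \<open>x\<close> turns
  the double integral into the integral of \<open>k z * translation_modulus f z\<close>, where only
  \<open>norm z < r\<close> contributes.\<close>

lemma mollification_bound:
  fixes k f :: "'a::euclidean_space \<Rightarrow> real"
  assumes k: "integrable lborel k" "\<And>z. 0 \<le> k z" "\<And>z. k (- z) = k z" "\<And>z. r \<le> norm z \<Longrightarrow> k z = 0"
    and f: "integrable lborel f" and e: "0 \<le> e" "\<And>z. norm z < r \<Longrightarrow> translation_modulus f z \<le> e"
  shows "integrable (lborel \<Otimes>\<^sub>M lborel) (\<lambda>(x, y). k (y - x) * \<bar>f y - f x\<bar>)"
    and "(LINT (x, y)|(lborel \<Otimes>\<^sub>M lborel). k (y - x) * \<bar>f y - f x\<bar>) \<le> e * (LINT z|lborel. k z)"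
proof -
  have [measurable]: "k \<in> borel_measurable borel" "f \<in> borel_measurable borel" using assms by auto
  show int: "integrable (lborel \<Otimes>\<^sub>M lborel) (\<lambda>(x, y). k (y - x) * \<bar>f y - f x\<bar>)"
  proof (rule Bochner_Integration.integrable_bound)
    show "integrable (lborel \<Otimes>\<^sub>M lborel) (\<lambda>p. (case p of (x, y) \<Rightarrow> k (y - x) * \<bar>f x\<bar>) + (case p of (x, y) \<Rightarrow> k (y - x) * \<bar>f y\<bar>))"
      using integrable_kernel_fst(1)[OF k(1) integrable_abs[OF f]] integrable_kernel_snd[OF k(1) integrable_abs[OF f] k(3)]
      by (rule Bochner_Integration.integrable_add)
    show "AE p in lborel \<Otimes>\<^sub>M lborel. norm (case p of (x, y) \<Rightarrow> k (y - x) * \<bar>f y - f x\<bar>)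
      \<le> norm ((case p of (x, y) \<Rightarrow> k (y - x) * \<bar>f x\<bar>) + (case p of (x, y) \<Rightarrow> k (y - x) * \<bar>f y\<bar>))"
    proof (rule AE_I2, clarify)
      fix x y
      have "k (y - x) * \<bar>f y - f x\<bar> \<le> k (y - x) * (\<bar>f x\<bar> + \<bar>f y\<bar>)"
        using k(2) by (intro mult_left_mono) auto
      then show "norm (k (y - x) * \<bar>f y - f x\<bar>) \<le> norm (k (y - x) * \<bar>f x\<bar> + k (y - x) * \<bar>f y\<bar>)"
        using k(2) by (simp add: abs_mult algebra_simps)
    qed
  qed measurable
  have "ennreal (LINT (x, y)|(lborel \<Otimes>\<^sub>M lborel). k (y - x) * \<bar>f y - f x\<bar>) =
      (\<integral>\<^sup>+p. ennreal (case p of (x, y) \<Rightarrow> k (y - x) * \<bar>f y - f x\<bar>) \<partial>(lborel \<Otimes>\<^sub>M lborel))"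
    by (rule nn_integral_eq_integral[symmetric, OF int]) (use k(2) in auto)
  also have "\<dots> = (\<integral>\<^sup>+x. \<integral>\<^sup>+y. ennreal (k (y - x) * \<bar>f y - f x\<bar>) \<partial>lborel \<partial>lborel)"
    by (subst lborel.nn_integral_fst[symmetric]) auto
  also have "\<dots> = (\<integral>\<^sup>+x. \<integral>\<^sup>+z. ennreal (k z * \<bar>f (z + x) - f x\<bar>) \<partial>lborel \<partial>lborel)"
  proof (rule nn_integral_cong)
    fix x
    show "(\<integral>\<^sup>+y. ennreal (k (y - x) * \<bar>f y - f x\<bar>) \<partial>lborel) = (\<integral>\<^sup>+z. ennreal (k z * \<bar>f (z + x) - f x\<bar>) \<partial>lborel)"
      using nn_integral_translation[of "\<lambda>y. ennreal (k (y - x) * \<bar>f y - f x\<bar>)" x] by simp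
  qed
  also have "\<dots> = (\<integral>\<^sup>+z. \<integral>\<^sup>+x. ennreal (k z * \<bar>f (z + x) - f x\<bar>) \<partial>lborel \<partial>lborel)"
    by (rule lborel_pair.Fubini') measurable
  also have "\<dots> \<le> (\<integral>\<^sup>+z. ennreal (e * k z) \<partial>lborel)"
  proof (rule nn_integral_mono)
    fix z
    have "(\<integral>\<^sup>+x. ennreal (k z * \<bar>f (z + x) - f x\<bar>) \<partial>lborel) = ennreal (LINT x|lborel. k z * \<bar>f (z + x) - f x\<bar>)"
      using integrable_translation_diff[OF f, of z] k(2) by (intro nn_integral_eq_integral) (auto simp: add.commute)
    also have "(LINT x|lborel. k z * \<bar>f (z + x) - f x\<bar>) = k z * translation_modulus f z"
      by (simp add: translation_modulus_def add.commute)
    also have "\<dots> \<le> e * k z"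
    proof (cases "norm z < r")
      case True
      from mult_right_mono[OF e(2)[OF True] k(2)] show ?thesis by (simp only: mult.commute)
    next
      case False
      then have "k z = 0" by (intro k(4)) simp
      then show ?thesis by simp
    qed
    finally show "(\<integral>\<^sup>+x. ennreal (k z * \<bar>f (z + x) - f x\<bar>) \<partial>lborel) \<le> ennreal (e * k z)"
      by (simp add: ennreal_leI)
  qed
  also have "\<dots> = ennreal (e * (LINT z|lborel. k z))"
    using k e by (subst nn_integral_eq_integral) auto
  finally show "(LINT (x, y)|(lborel \<Otimes>\<^sub>M lborel). k (y - x) * \<bar>f y - f x\<bar>) \<le> e * (LINT z|lborel. k z)"
    using k e by (subst (asm) ennreal_le_iff) auto
qed

lemma integrable_compactly_supported:
  fixes k :: "'a::euclidean_space \<Rightarrow> real"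
  assumes "continuous_on UNIV k" "\<And>z. r \<le> norm z \<Longrightarrow> k z = 0"
  shows "integrable lborel k"
proof -
  have "integrable lborel (\<lambda>z. indicator (cball 0 r) z *\<^sub>R k z)"
    by (rule borel_integrable_compact) (auto intro: continuous_on_subset[OF assms(1)])
  also have "(\<lambda>z. indicator (cball 0 r) z *\<^sub>R k z) = k"
    using assms(2) by (auto split: split_indicator)
  finally show ?thesis .
qed

lemma integrable_bump: "0 \<le> r \<Longrightarrow> integrable lborel (bump r p)"
  using continuous_on_bump bump_outside by (rule integrable_compactly_supported)

lemma integrable_bump_pderiv: "0 \<le> r \<Longrightarrow> integrable lborel (bump_pderiv r k)"
  using continuous_on_bump_pderiv bump_pderiv_outside by (rule integrable_compactly_supported)

lemma borel_measurable_bump [measurable]: "bump r p \<in> borel_measurable borel"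
  by (rule borel_measurable_continuous_onI[OF continuous_on_bump])

lemma borel_measurable_bump_pderiv [measurable]: "bump_pderiv r k \<in> borel_measurable borel"
  by (rule borel_measurable_continuous_onI[OF continuous_on_bump_pderiv])

lemma integral_bump_pos:
  assumes "0 < r" shows "0 < (LINT z|lborel. bump r 1 (z::real^'n::finite))"
proof -
  \<comment> \<open>The value of the bump where \<open>norm z = r / 2\<close>, hence a lower bound
    on the ball of half the radius.\<close>
  define c where "c = exp (- (1 / (3 / 4 * r\<^sup>2)))"
  have "c > 0" by (simp add: c_def)
  have le: "indicator (ball 0 (r / 2)) z * c \<le> bump r 1 z" for z :: "real^'n"
  proof (cases "z \<in> ball 0 (r / 2)")
    case True
    then have "(norm z)\<^sup>2 \<le> (r / 2)\<^sup>2" by (intro power_mono) auto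
    then have z: "3 / 4 * r\<^sup>2 \<le> r\<^sup>2 - z \<bullet> z" by (simp add: power2_norm_eq_inner power_divide)
    have pos: "0 < 3 / 4 * r\<^sup>2" using assms by simp
    moreover have zpos: "0 < r\<^sup>2 - z \<bullet> z" using z pos by linarith
    ultimately have "1 / (r\<^sup>2 - z \<bullet> z) \<le> 1 / (3 / 4 * r\<^sup>2)"
      using z by (intro divide_left_mono mult_pos_pos) simp_all
    moreover note zpos
    ultimately show ?thesis using True by (simp add: bump_def bump_fun_def c_def)
  qed (simp add: bump_nonneg)
  have "0 < measure lborel (ball (0::real^'n) (r / 2)) * c"
    using content_ball_pos[of "r / 2" "0::real^'n"] assms \<open>c > 0\<close> by simp
  also have "\<dots> = (LINT z|lborel. indicator (ball (0::real^'n) (r / 2)) z * c)"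
    by (subst integral_mult_left_zero) simp
  also have "\<dots> \<le> (LINT z|lborel. bump r 1 (z::real^'n))"
  proof (rule integral_mono)
    show "integrable lborel (\<lambda>z. indicator (ball (0::real^'n) (r / 2)) z * c)"
      by (intro integrable_mult_left integrable_real_indicator emeasure_bounded_finite) auto
  qed (use assms le in \<open>auto intro: integrable_bump\<close>)
  finally show ?thesis .
qed

text \<open>Reduces continuity of translations for square integrable functions to that for integrable ones.\<close>

lemma square_positive_part_diff:
  fixes a b :: real
  shows "(a - b)\<^sup>2 \<le> 2 * \<bar>(max a 0)\<^sup>2 - (max b 0)\<^sup>2\<bar> + 2 * \<bar>(max (- a) 0)\<^sup>2 - (max (- b) 0)\<^sup>2\<bar>"
proof -
  have sq: "(p - q)\<^sup>2 \<le> \<bar>p\<^sup>2 - q\<^sup>2\<bar>" if "0 \<le> p" "0 \<le> q" for p q :: real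
  proof -
    have "(p - q)\<^sup>2 = \<bar>p - q\<bar> * \<bar>p - q\<bar>" by (simp add: power2_eq_square)
    also have "\<dots> \<le> \<bar>p - q\<bar> * (p + q)" using that by (intro mult_left_mono) auto
    also have "\<dots> = \<bar>(p - q) * (p + q)\<bar>" using that by (simp add: abs_mult)
    finally show ?thesis by (simp add: power2_eq_square algebra_simps)
  qed
  let ?p = "max a 0" and ?q = "max b 0" and ?p' = "max (- a) 0" and ?q' = "max (- b) 0"
  have "a - b = (?p - ?q) - (?p' - ?q')" by (auto simp: max_def)
  moreover have "(c - d)\<^sup>2 \<le> 2 * c\<^sup>2 + 2 * d\<^sup>2" for c d :: real
    using zero_le_power2[of "c + d"] by (simp add: power2_eq_square algebra_simps)
  ultimately have "(a - b)\<^sup>2 \<le> 2 * (?p - ?q)\<^sup>2 + 2 * (?p' - ?q')\<^sup>2"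
    by metis
  also have "\<dots> \<le> 2 * \<bar>?p\<^sup>2 - ?q\<^sup>2\<bar> + 2 * \<bar>?p'\<^sup>2 - ?q'\<^sup>2\<bar>"
    by (intro add_mono mult_left_mono sq) auto
  finally show ?thesis .
qed

text \<open>The function \<open>w\<close> is only square integrable, while the translation estimate
  is for integrable functions. The squares \<open>p\<close> and \<open>q\<close> of its positive and
  negative parts are integrable, and by \<open>square_positive_part_diff\<close> their differences
  control \<open>(w y - w x)\<^sup>2\<close>.\<close>

lemma mollified_product_tendsto:
  fixes v w :: "real^'n::finite \<Rightarrow> real"
  assumes [measurable]: "v \<in> borel_measurable borel" "w \<in> borel_measurable borel"
    and sq: "integrable lborel (\<lambda>x. (v x)\<^sup>2)" "integrable lborel (\<lambda>x. (w x)\<^sup>2)"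
  shows "((\<lambda>r. (LINT (x, y)|(lborel \<Otimes>\<^sub>M lborel). v x * bump r 1 (y - x) * w y) / (LINT z|lborel. bump r 1 (z::real^'n)))
    \<longlongrightarrow> (LINT x|lborel. v x * w x)) (at_right 0)"
proof (rule tendstoI)
  fix e :: real assume e: "e > 0"
  define p where "p = (\<lambda>x. (max (w x) 0)\<^sup>2)"
  define q where "q = (\<lambda>x. (max (- w x) 0)\<^sup>2)"
  define V where "V = (LINT x|lborel. (v x)\<^sup>2)"
  have V: "0 \<le> V" by (simp add: V_def)
  \<comment> \<open>The weight in Young's inequality for \<open>v x * (w y - w x)\<close>: the part
    with \<open>(v x)\<^sup>2\<close> has to stay below \<open>e / 4\<close>.\<close>
  define \<theta> where "\<theta> = e / (4 * (V + 1))"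
  have \<theta>: "\<theta> > 0" using e V by (simp add: \<theta>_def)
  have \<theta>V: "\<theta> * V \<le> e / 4" using e V by (simp add: \<theta>_def field_simps)
  have p: "integrable lborel p"
    by (rule Bochner_Integration.integrable_bound[OF sq(2)]) (auto simp: p_def max_def)
  have q: "integrable lborel q"
    by (rule Bochner_Integration.integrable_bound[OF sq(2)]) (auto simp: q_def max_def)
  \<comment> \<open>The parts with \<open>p\<close> and \<open>q\<close> contribute
    \<open>4 * d / \<theta>\<close> together, which is the other \<open>e / 4\<close>.\<close>
  define d where "d = e * \<theta> / 16"
  have d: "d > 0" using e \<theta> by (simp add: d_def)
  obtain r1 where r1: "r1 > 0" "\<And>z. norm z < r1 \<Longrightarrow> translation_modulus p z \<le> d"
    using translation_modulus_small[OF p d] by blast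
  obtain r2 where r2: "r2 > 0" "\<And>z. norm z < r2 \<Longrightarrow> translation_modulus q z \<le> d"
    using translation_modulus_small[OF q d] by blast
  have "dist ((LINT (x, y)|(lborel \<Otimes>\<^sub>M lborel). v x * bump r 1 (y - x) * w y) / (LINT z|lborel. bump r 1 (z::real^'n)))
     (LINT x|lborel. v x * w x) < e" if r: "0 < r" "r < min r1 r2" for r
  proof -
    let ?k = "bump r 1 :: real^'n \<Rightarrow> real" and ?P = "lborel \<Otimes>\<^sub>M lborel :: ((real^'n) \<times> (real^'n)) measure"
    define I where "I = (LINT z|lborel. ?k z)"
    have I: "I > 0" using integral_bump_pos[OF r(1)] by (simp add: I_def)
    have k: "integrable lborel ?k" "\<And>z. 0 \<le> ?k z" "\<And>z. ?k (- z) = ?k z" "\<And>z. r \<le> norm z \<Longrightarrow> ?k z = 0"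
      using r by (auto intro: integrable_bump bump_nonneg bump_minus bump_outside)
    have vw: "integrable lborel (\<lambda>x. v x * w x)"
      using integrable_inner_of_squares[of v lborel w] sq by simp
    note D1 = integrable_kernel_product[OF assms k(1)]
    note D2 = integrable_kernel_fst[OF k(1) vw]
    note D3 = integrable_kernel_fst[OF k(1) sq(1)]
    have mp: "integrable ?P (\<lambda>(x, y). ?k (y - x) * \<bar>p y - p x\<bar>)"
      "(LINT (x, y)|?P. ?k (y - x) * \<bar>p y - p x\<bar>) \<le> d * I"
      using mollification_bound[where r=r, OF k p, of d] r1(2) r d by (auto simp: I_def)
    have mq: "integrable ?P (\<lambda>(x, y). ?k (y - x) * \<bar>q y - q x\<bar>)"
      "(LINT (x, y)|?P. ?k (y - x) * \<bar>q y - q x\<bar>) \<le> d * I"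
      using mollification_bound[where r=r, OF k q, of d] r2(2) r d by (auto simp: I_def)
    have D1': "integrable ?P (\<lambda>(x, y). v x * ?k (y - x) * w y)" using D1 k(3) by simp
    have "\<bar>(LINT (x, y)|?P. v x * ?k (y - x) * w y) - I * (LINT x|lborel. v x * w x)\<bar> =
       \<bar>LINT a|?P. (case a of (x, y) \<Rightarrow> v x * ?k (y - x) * w y) - (case a of (x, y) \<Rightarrow> ?k (y - x) * (v x * w x))\<bar>"
      by (subst Bochner_Integration.integral_diff[OF D1' D2(1)]) (simp only: D2(2) I_def)
    also have "\<dots> \<le> (LINT a|?P. \<theta> * (case a of (x, y) \<Rightarrow> ?k (y - x) * (v x)\<^sup>2) +
        (2 / \<theta> * (case a of (x, y) \<Rightarrow> ?k (y - x) * \<bar>p y - p x\<bar>) + 2 / \<theta> * (case a of (x, y) \<Rightarrow> ?k (y - x) * \<bar>q y - q x\<bar>)))"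
    proof (rule order_trans[OF integral_abs_bound], rule integral_mono)
      fix a :: "(real^'n) \<times> (real^'n)"
      obtain x y where a: "a = (x, y)" by force
      have "2 * (sqrt \<theta> * \<bar>v x\<bar>) * (\<bar>w y - w x\<bar> / sqrt \<theta>) \<le> (sqrt \<theta> * \<bar>v x\<bar>)\<^sup>2 + (\<bar>w y - w x\<bar> / sqrt \<theta>)\<^sup>2"
        by (rule sum_squares_bound)
      then have "2 * (\<bar>v x\<bar> * \<bar>w y - w x\<bar>) \<le> \<theta> * (v x)\<^sup>2 + (w y - w x)\<^sup>2 / \<theta>"
        using \<theta> by (simp add: power_mult_distrib power_divide)
      moreover have "(w y - w x)\<^sup>2 / \<theta> \<le> (2 * \<bar>p y - p x\<bar> + 2 * \<bar>q y - q x\<bar>) / \<theta>"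
        using square_positive_part_diff[of "w y" "w x"] \<theta> by (intro divide_right_mono) (auto simp: p_def q_def)
      moreover have "0 \<le> \<bar>v x\<bar> * \<bar>w y - w x\<bar>" by simp
      ultimately have "\<bar>v x\<bar> * \<bar>w y - w x\<bar> \<le> \<theta> * (v x)\<^sup>2 + (2 * \<bar>p y - p x\<bar> + 2 * \<bar>q y - q x\<bar>) / \<theta>"
        by linarith
      then have "\<bar>v x\<bar> * \<bar>w y - w x\<bar> \<le> \<theta> * (v x)\<^sup>2 + (2 / \<theta> * \<bar>p y - p x\<bar> + 2 / \<theta> * \<bar>q y - q x\<bar>)"
        by (simp add: add_divide_distrib)
      then have "?k (y - x) * (\<bar>v x\<bar> * \<bar>w y - w x\<bar>) \<le> ?k (y - x) * (\<theta> * (v x)\<^sup>2 + (2 / \<theta> * \<bar>p y - p x\<bar> + 2 / \<theta> * \<bar>q y - q x\<bar>))"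
        by (rule mult_left_mono) (rule k(2))
      moreover have "\<bar>v x * ?k (y - x) * w y - ?k (y - x) * (v x * w x)\<bar> = ?k (y - x) * (\<bar>v x\<bar> * \<bar>w y - w x\<bar>)"
      proof -
        have "v x * ?k (y - x) * w y - ?k (y - x) * (v x * w x) = ?k (y - x) * (v x * (w y - w x))"
          by (simp add: algebra_simps)
        then show ?thesis using k(2)[of "y - x"] by (simp add: abs_mult)
      qed
      ultimately show "\<bar>(case a of (x, y) \<Rightarrow> v x * ?k (y - x) * w y) - (case a of (x, y) \<Rightarrow> ?k (y - x) * (v x * w x))\<bar> \<le>
        \<theta> * (case a of (x, y) \<Rightarrow> ?k (y - x) * (v x)\<^sup>2) +
        (2 / \<theta> * (case a of (x, y) \<Rightarrow> ?k (y - x) * \<bar>p y - p x\<bar>) + 2 / \<theta> * (case a of (x, y) \<Rightarrow> ?k (y - x) * \<bar>q y - q x\<bar>))"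
        by (simp add: a algebra_simps)
    qed (intro integrable_abs Bochner_Integration.integrable_diff Bochner_Integration.integrable_add
        integrable_mult_right D1' D2(1) D3(1) mp(1) mq(1))+
    also have "\<dots> = \<theta> * (V * I) + (2 / \<theta> * (LINT (x, y)|?P. ?k (y - x) * \<bar>p y - p x\<bar>) +
        2 / \<theta> * (LINT (x, y)|?P. ?k (y - x) * \<bar>q y - q x\<bar>))"
      using D3 mp(1) mq(1) by (simp add: V_def I_def)
    also have "\<dots> \<le> \<theta> * (V * I) + (2 / \<theta> * (d * I) + 2 / \<theta> * (d * I))"
      using mp(2) mq(2) \<theta> by (intro add_mono mult_left_mono order_refl) auto
    also have "\<dots> = (\<theta> * V + e / 4) * I" using \<theta> by (simp add: d_def field_simps)
    also have "\<dots> \<le> (e / 2) * I" using \<theta>V I by (intro mult_right_mono) auto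
    finally have "\<bar>(LINT (x, y)|?P. v x * ?k (y - x) * w y) - I * (LINT x|lborel. v x * w x)\<bar> \<le> e / 2 * I" .
    then have "\<bar>(LINT (x, y)|?P. v x * ?k (y - x) * w y) - I * (LINT x|lborel. v x * w x)\<bar> / I \<le> e / 2"
      using I by (simp add: field_simps)
    moreover have "\<bar>(LINT (x, y)|?P. v x * ?k (y - x) * w y) - I * (LINT x|lborel. v x * w x)\<bar> / I =
      \<bar>(LINT (x, y)|?P. v x * ?k (y - x) * w y) / I - (LINT x|lborel. v x * w x)\<bar>"
    proof -
      have "\<bar>A - I * B\<bar> / I = \<bar>A / I - B\<bar>" for A B
      proof -
        have "\<bar>A - I * B\<bar> / I = \<bar>(A - I * B) / I\<bar>" using I by (simp add: abs_divide)
        also have "(A - I * B) / I = A / I - B" using I by (simp add: field_simps)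
        finally show ?thesis .
      qed
      then show ?thesis .
    qed
    ultimately show ?thesis using e unfolding I_def[symmetric] by (simp add: dist_real_def)
  qed
  then show "\<forall>\<^sub>F r in at_right 0. dist ((LINT (x, y)|(lborel \<Otimes>\<^sub>M lborel). v x * bump r 1 (y - x) * w y) / (LINT z|lborel. bump r 1 (z::real^'n)))
     (LINT x|lborel. v x * w x) < e"
    using r1(1) r2(1) by (auto simp: eventually_at_right_field intro!: exI[of _ "min r1 r2"])
qed

text \<open>On \<open>S\<close> the vanishing average lets \<open>f x\<close> be replaced by
  \<open>f x - f y\<close> under the kernel, and the average of these differences is small by
  \<open>mollification_bound\<close>. Restricting to \<open>S\<close> makes the lemma applicable to
  a cut-off function, whose averages vanish only away from the edge of the cut-off.\<close>

lemma AE_zero_of_mollified_zero: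
  fixes f :: "real^'n::finite \<Rightarrow> real"
  assumes f: "integrable lborel f"
    and S[measurable]: "S \<in> sets borel"
    and zero: "\<And>x r. x \<in> S \<Longrightarrow> 0 < r \<Longrightarrow> r \<le> 1 \<Longrightarrow> (LINT y|lborel. bump r 1 (y - x) * f y) = 0"
  shows "AE x in lborel. x \<in> S \<longrightarrow> f x = 0"
proof -
  have [measurable]: "f \<in> borel_measurable borel" using f by auto
  have intS: "integrable lborel (\<lambda>x. indicator S x * \<bar>f x\<bar>)"
    by (rule Bochner_Integration.integrable_bound[OF f]) (auto split: split_indicator)
  have "(LINT x|lborel. indicator S x * \<bar>f x\<bar>) \<le> e" if e: "e > 0" for e
  proof -
    obtain d where d: "d > 0" "\<And>z. norm z < d \<Longrightarrow> translation_modulus f z \<le> e"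
      using translation_modulus_small[OF f e] by blast
    define r where "r = min d 1"
    have r: "0 < r" "r \<le> 1" "r \<le> d" using d by (auto simp: r_def)
    let ?k = "bump r 1 :: real^'n \<Rightarrow> real"
    define I where "I = (LINT z|lborel. ?k z)"
    have I: "I > 0" using integral_bump_pos[OF r(1)] by (simp add: I_def)
    have k: "integrable lborel ?k" "\<And>z. 0 \<le> ?k z" "\<And>z. ?k (- z) = ?k z" "\<And>z. r \<le> norm z \<Longrightarrow> ?k z = 0"
      using r by (auto intro: integrable_bump bump_nonneg bump_minus bump_outside)
    note m = mollification_bound[where r=r, OF k f less_imp_le[OF e]]
    have m1: "integrable (lborel \<Otimes>\<^sub>M lborel) (\<lambda>(x, y). ?k (y - x) * \<bar>f y - f x\<bar>)"
      and m2: "(LINT (x, y)|(lborel \<Otimes>\<^sub>M lborel). ?k (y - x) * \<bar>f y - f x\<bar>) \<le> e * I"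
      using m d(2) r by (auto simp: I_def)
    have "(LINT x|lborel. indicator S x * \<bar>f x\<bar>) * I = (LINT x|lborel. indicator S x * \<bar>f x\<bar> * I)" by simp
    also have "\<dots> \<le> (LINT x|lborel. LINT y|lborel. ?k (y - x) * \<bar>f y - f x\<bar>)"
    proof (rule integral_mono_AE)
      show "integrable lborel (\<lambda>x. LINT y|lborel. ?k (y - x) * \<bar>f y - f x\<bar>)"
        using lborel_pair.integrable_fst'[OF m1] by simp
      have "AE x in lborel. integrable lborel (\<lambda>y. ?k (y - x) * f y)"
        using lborel_pair.AE_integrable_fst'[OF integrable_kernel_snd[OF k(1) f k(3)]] by simp
      moreover have "AE x in lborel. integrable lborel (\<lambda>y. ?k (y - x) * \<bar>f y - f x\<bar>)"
        using lborel_pair.AE_integrable_fst'[OF m1] by simp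
      ultimately show "AE x in lborel. indicator S x * \<bar>f x\<bar> * I \<le> (LINT y|lborel. ?k (y - x) * \<bar>f y - f x\<bar>)"
      proof eventually_elim
        case (elim x)
        have kx: "integrable lborel (\<lambda>y. ?k (y - x))" "(LINT y|lborel. ?k (y - x)) = I"
          using integrable_translation[OF k(1), of "- x"] by (simp_all add: I_def)
        show ?case
        proof (cases "x \<in> S")
          case True
          have fI: "f x * I = - (LINT y|lborel. ?k (y - x) * f y - ?k (y - x) * f x)"
            using kx elim(1) zero[OF True r(1,2)] by simp
          have "\<bar>f x\<bar> * I = \<bar>f x * I\<bar>" using I by (simp add: abs_mult)
          also have "\<dots> = \<bar>LINT y|lborel. ?k (y - x) * f y - ?k (y - x) * f x\<bar>"
            unfolding fI by (rule abs_minus_cancel)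
          also have "\<dots> \<le> (LINT y|lborel. \<bar>?k (y - x) * f y - ?k (y - x) * f x\<bar>)"
            by (rule integral_abs_bound)
          also have "\<dots> = (LINT y|lborel. ?k (y - x) * \<bar>f y - f x\<bar>)"
            using k(2) by (simp add: abs_mult flip: right_diff_distrib)
          finally show ?thesis using True by simp
        next
          case False
          then show ?thesis using k(2) by simp
        qed
      qed
    qed (use intS in auto)
    also have "\<dots> = (LINT (x, y)|(lborel \<Otimes>\<^sub>M lborel). ?k (y - x) * \<bar>f y - f x\<bar>)"
      using lborel_pair.integral_fst'[OF m1] by simp
    also note m2
    finally show ?thesis using I by simp
  qed
  then have "(LINT x|lborel. indicator S x * \<bar>f x\<bar>) \<le> 0" by (rule field_le_epsilon) auto
  moreover have "0 \<le> (LINT x|lborel. indicator S x * \<bar>f x\<bar>)" by simp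
  ultimately have "(LINT x|lborel. indicator S x * \<bar>f x\<bar>) = 0" by linarith
  then have "AE x in lborel. indicator S x * \<bar>f x\<bar> = 0"
    using integral_nonneg_eq_0_iff_AE[OF intS] by simp
  then show ?thesis by eventually_elim (auto split: split_indicator_asm)
qed

subsection \<open>Weak derivatives\<close>

lemma borel_measurable_lebesgueI: "f \<in> borel_measurable borel \<Longrightarrow> f \<in> borel_measurable lebesgue"
  by (rule measurable_completion) simp

text \<open>The Fubini arguments take place on products of \<open>lborel\<close>, whereas the
  function spaces are defined with \<open>lebesgue\<close>; Borel representatives connect the
  two.\<close>

lemma borel_representative:
  fixes f :: "'a::euclidean_space \<Rightarrow> real"
  assumes "f \<in> borel_measurable lebesgue"
  shows "\<exists>f'. f' \<in> borel_measurable borel \<and> (AE x in lebesgue. f x = f' x)"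
proof -
  obtain f' where "f' \<in> borel_measurable lborel" "AE x in lborel. f x = f' x"
    using completion_ex_borel_measurable_real[OF assms] by blast
  then show ?thesis using AE_completion by (intro exI[of _ f']) auto
qed

lemma integral_borel_representative:
  fixes f :: "'a::euclidean_space \<Rightarrow> real"
  assumes "f \<in> borel_measurable lebesgue" "f' \<in> borel_measurable borel" "AE x in lebesgue. f x = f' x"
  shows "integrable lborel f' \<longleftrightarrow> integrable lebesgue f"
    and "integral\<^sup>L lborel f' = integral\<^sup>L lebesgue f"
proof -
  note m = borel_measurable_lebesgueI[OF assms(2)]
  have "integrable lebesgue f' \<longleftrightarrow> integrable lebesgue f"
    using assms m by (intro integrable_cong_AE) auto
  then show "integrable lborel f' \<longleftrightarrow> integrable lebesgue f"
    using assms(2) by (simp add: integrable_completion)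
  have "integral\<^sup>L lebesgue f' = integral\<^sup>L lebesgue f"
    using assms m by (intro integral_cong_AE) auto
  then show "integral\<^sup>L lborel f' = integral\<^sup>L lebesgue f"
    using assms(2) by (simp add: integral_completion)
qed

text \<open>The fundamental lemma of the calculus of variations, with translated bumps as the only
  test functions.\<close>

lemma AE_zero_of_bump_integrals:
  fixes g :: "real^'n::finite \<Rightarrow> real"
  assumes loc: "\<And>R. integrable lebesgue (\<lambda>x. indicator (cball 0 R) x * g x)"
    and zero: "\<And>x r. 0 < r \<Longrightarrow> r \<le> 1 \<Longrightarrow> (LINT y|lebesgue. bump r 1 (y - x) * g y) = 0"
  shows "AE x in lebesgue. g x = 0"
proof -
  have "AE x in lebesgue. x \<in> cball 0 (real N) \<longrightarrow> g x = 0" for N :: nat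
  proof -
    \<comment> \<open>One unit larger than the ball containing \<open>x\<close>: bumps of radius at
      most 1 around \<open>x\<close> do not see the cut-off.\<close>
    let ?B = "cball 0 (real N + 1) :: (real^'n) set"
    define f where "f = (\<lambda>x. indicator ?B x * g x)"
    have f: "integrable lebesgue f" using loc by (simp add: f_def)
    have fm: "f \<in> borel_measurable lebesgue" using f by auto
    obtain f' where f': "f' \<in> borel_measurable borel" "AE x in lebesgue. f x = f' x"
      using borel_representative[OF fm] by blast
    have "AE x in lborel. x \<in> cball 0 (real N) \<longrightarrow> f' x = 0"
    proof (rule AE_zero_of_mollified_zero)
      show "integrable lborel f'" using integral_borel_representative(1)[OF fm f'] f by simp
      fix x :: "real^'n" and r :: real assume x: "x \<in> cball 0 (real N)" and r: "0 < r" "r \<le> (1::real)"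
      have bm: "(\<lambda>y. bump r 1 (y - x)) \<in> borel_measurable borel" by measurable
      have "(LINT y|lborel. bump r 1 (y - x) * f' y) = (LINT y|lebesgue. bump r 1 (y - x) * f y)"
      proof (rule integral_borel_representative(2))
        show "(\<lambda>y. bump r 1 (y - x) * f y) \<in> borel_measurable lebesgue"
          using borel_measurable_lebesgueI[OF bm] fm by (rule borel_measurable_times)
        show "(\<lambda>y. bump r 1 (y - x) * f' y) \<in> borel_measurable borel" using f'(1) by measurable
        show "AE y in lebesgue. bump r 1 (y - x) * f y = bump r 1 (y - x) * f' y"
          using f'(2) by eventually_elim simp
      qed
      also have "\<dots> = (LINT y|lebesgue. bump r 1 (y - x) * g y)"
      proof (rule Bochner_Integration.integral_cong[OF refl])
        fix y
        show "bump r 1 (y - x) * f y = bump r 1 (y - x) * g y"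
        proof (cases "y \<in> ?B")
          case False
          then have "r \<le> norm (y - x)" using x r norm_triangle_ineq2[of y x] by simp
          then show ?thesis using r by (simp add: bump_outside)
        qed (simp add: f_def)
      qed
      also have "\<dots> = 0" by (rule zero[OF r])
      finally show "(LINT y|lborel. bump r 1 (y - x) * f' y) = 0" .
    qed simp
    then have "AE x in lebesgue. x \<in> cball 0 (real N) \<longrightarrow> f' x = 0" by (rule AE_completion)
    with f'(2) show ?thesis by eventually_elim (auto simp: f_def split: split_indicator_asm)
  qed
  then have "AE x in lebesgue. \<forall>N::nat. x \<in> cball 0 (real N) \<longrightarrow> g x = 0"
    by (intro AE_all_countable[THEN iffD2] allI)
  then show ?thesis
  proof eventually_elim
    case (elim x)
    obtain N :: nat where "norm x \<le> real N" using real_arch_simple by blast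
    then show ?case using elim by auto
  qed
qed

lemma locally_integrable_scaleR_bounded:
  fixes f :: "real^'n::finite \<Rightarrow> 'b::euclidean_space"
  assumes f: "locally_integrable f" and k: "continuous_on UNIV k" "\<And>y. y \<notin> cball x r \<Longrightarrow> k y = (0::real)"
  shows "integrable lebesgue (\<lambda>y. k y *\<^sub>R f y)"
proof -
  let ?F = "\<lambda>y. indicator (cball x r) y *\<^sub>R f y"
  have F: "integrable lebesgue ?F" using f by (auto simp: locally_integrable_def set_integrable_def)
  have "compact (k ` cball x r)"
    by (intro compact_continuous_image continuous_on_subset[OF k(1)]) auto
  then obtain B where B: "\<And>y. y \<in> cball x r \<Longrightarrow> \<bar>k y\<bar> \<le> B"
    by (meson bounded_real compact_imp_bounded image_eqI)
  have km: "k \<in> borel_measurable lebesgue"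
    by (intro borel_measurable_lebesgueI borel_measurable_continuous_onI k)
  have "integrable lebesgue (\<lambda>y. k y *\<^sub>R ?F y)"
  proof (rule Bochner_Integration.integrable_bound)
    show "integrable lebesgue (\<lambda>y. B *\<^sub>R ?F y)" using F by (rule integrable_scaleR_right)
    show "(\<lambda>y. k y *\<^sub>R ?F y) \<in> borel_measurable lebesgue"
      using km borel_measurable_integrable[OF F] by (rule borel_measurable_scaleR)
    show "AE y in lebesgue. norm (k y *\<^sub>R ?F y) \<le> norm (B *\<^sub>R ?F y)"
    proof (rule AE_I2)
      fix y
      show "norm (k y *\<^sub>R ?F y) \<le> norm (B *\<^sub>R ?F y)"
        using B[of y] by (cases "y \<in> cball x r") (auto intro!: mult_right_mono)
    qed
  qed
  also have "(\<lambda>y. k y *\<^sub>R ?F y) = (\<lambda>y. k y *\<^sub>R f y)" using k(2) by (auto split: split_indicator)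
  finally show ?thesis .
qed

lemma locally_integrable_bump:
  assumes "locally_integrable f" "0 \<le> r"
  shows "integrable lebesgue (\<lambda>y. bump r p (y - x) *\<^sub>R f y)"
proof (rule locally_integrable_scaleR_bounded[OF assms(1)])
  show "continuous_on UNIV (\<lambda>y. bump r p (y - x))" using Ck_bump[of 0] by simp
  show "bump r p (y - x) = 0" if "y \<notin> cball x r" for y
    using that assms(2) by (intro bump_outside) (auto simp: dist_norm norm_minus_commute)
qed

lemma locally_integrable_bump_pderiv:
  assumes "locally_integrable f" "0 \<le> r"
  shows "integrable lebesgue (\<lambda>y. bump_pderiv r k (y - x) *\<^sub>R f y)"
proof (rule locally_integrable_scaleR_bounded[OF assms(1)])
  show "continuous_on UNIV (\<lambda>y. bump_pderiv r k (y - x))"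
    by (rule continuous_on_compose2[OF continuous_on_bump_pderiv]) (auto intro: continuous_intros)
  show "bump_pderiv r k (y - x) = 0" if "y \<notin> cball x r" for y
    using that assms(2) by (intro bump_pderiv_outside) (auto simp: dist_norm norm_minus_commute)
qed

lemma dist_of_bump: "dist_of f (\<lambda>y. bump r p (y - x)) = (LINT y|lebesgue. bump r p (y - x) *\<^sub>R f y)"
  by (simp add: dist_of_def)

lemma dist_deriv_bump:
  "dist_deriv j (dist_of f) (\<lambda>y. bump r 1 (y - x)) = - (LINT y|lebesgue. bump_pderiv r j (y - x) *\<^sub>R f y)"
  by (simp add: dist_deriv_def dist_of_def pderiv_at_bump bump_pderiv_def)

lemma has_weak_pderiv_bump:
  assumes "has_weak_pderiv j f g" "0 \<le> r"
  shows "(LINT y|lebesgue. bump_pderiv r j (y - x) *\<^sub>R f y) = - (LINT y|lebesgue. bump r 1 (y - x) *\<^sub>R g y)"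
proof -
  have "dist_deriv j (dist_of f) (\<lambda>y. bump r 1 (y - x)) = dist_of g (\<lambda>y. bump r 1 (y - x))"
    using assms bump_test_function[OF assms(2), of 1 x] by (simp add: has_weak_pderiv_def)
  from arg_cong[OF this, of uminus] show ?thesis
    unfolding dist_deriv_bump dist_of_bump by (simp only: minus_minus)
qed

lemma has_weak_pderiv_unique:
  fixes f g h :: "real^'n::finite \<Rightarrow> complex"
  assumes g: "has_weak_pderiv j f g" and h: "has_weak_pderiv j f h"
  shows "AE x in lebesgue. g x = h x"
proof -
  have lg: "locally_integrable g" and lh: "locally_integrable h"
    using g h by (auto simp: has_weak_pderiv_def)
  have int: "integrable lebesgue (\<lambda>y. bump r 1 (y - x) *\<^sub>R (g y - h y))"
    and zero: "(LINT y|lebesgue. bump r 1 (y - x) *\<^sub>R (g y - h y)) = 0" if r: "0 < r" for r x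
  proof -
    note i = locally_integrable_bump[OF lg less_imp_le[OF r], of 1 x] locally_integrable_bump[OF lh less_imp_le[OF r], of 1 x]
    show "integrable lebesgue (\<lambda>y. bump r 1 (y - x) *\<^sub>R (g y - h y))"
      using i by (simp add: scaleR_diff_right)
    show "(LINT y|lebesgue. bump r 1 (y - x) *\<^sub>R (g y - h y)) = 0"
      using i has_weak_pderiv_bump[OF g, of r x] has_weak_pderiv_bump[OF h, of r x] r
      by (simp add: scaleR_diff_right)
  qed
  have loc: "integrable lebesgue (\<lambda>x. indicator (cball 0 R) x *\<^sub>R (g x - h x))" for R
    using lg lh by (auto simp: locally_integrable_def set_integrable_def scaleR_diff_right)
  have "AE x in lebesgue. Re (g x - h x) = 0"
  proof (rule AE_zero_of_bump_integrals)
    show "integrable lebesgue (\<lambda>x. indicator (cball 0 R) x * Re (g x - h x))" for R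
      using integrable_Re[OF loc[of R]] by simp
    show "(LINT y|lebesgue. bump r 1 (y - x) * Re (g y - h y)) = 0" if "0 < r" "r \<le> 1" for x r
      using integral_Re[OF int[OF that(1), of x]] zero[OF that(1), of x] by simp
  qed
  moreover have "AE x in lebesgue. Im (g x - h x) = 0"
  proof (rule AE_zero_of_bump_integrals)
    show "integrable lebesgue (\<lambda>x. indicator (cball 0 R) x * Im (g x - h x))" for R
      using integrable_Im[OF loc[of R]] by simp
    show "(LINT y|lebesgue. bump r 1 (y - x) * Im (g y - h y)) = 0" if "0 < r" "r \<le> 1" for x r
      using integral_Im[OF int[OF that(1), of x]] zero[OF that(1), of x] by simp
  qed
  ultimately show ?thesis by eventually_elim (simp add: complex_eq_iff)
qed

lemma L2_cong_AE:
  assumes "f \<in> L2" "AE x in lebesgue. f x = g x"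
  shows "g \<in> L2"
proof -
  have [measurable]: "f \<in> borel_measurable lebesgue" "g \<in> borel_measurable lebesgue"
    using L2_measurable[OF assms(1)] borel_measurable_AE[OF _ assms(2)] by auto
  have "integrable lebesgue (\<lambda>x. (norm (f x))\<^sup>2) \<longleftrightarrow> integrable lebesgue (\<lambda>x. (norm (g x))\<^sup>2)"
    by (intro integrable_cong_AE) (use assms(2) in \<open>auto elim: eventually_mono\<close>)
  then show ?thesis using assms(1) by (simp add: L2_def)
qed

text \<open>Membership in \<open>H1\<close> provides some weak derivative in \<open>L2\<close>,
  while \<open>weak_pderiv\<close> is an arbitrary choice; uniqueness almost everywhere transfers
  square integrability to it.\<close>

lemma H1_weak_pderiv:
  assumes "f \<in> H1"
  shows "f \<in> L2" "has_weak_pderiv k f (weak_pderiv k f)" "weak_pderiv k f \<in> L2"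
proof -
  show "f \<in> L2" using assms by (simp add: H1_def)
  obtain g where g: "g \<in> L2" "has_weak_pderiv k f g" using assms by (auto simp: H1_def)
  show w: "has_weak_pderiv k f (weak_pderiv k f)"
    unfolding weak_pderiv_def by (rule someI[of _ g]) (rule g(2))
  show "weak_pderiv k f \<in> L2"
    by (rule L2_cong_AE[OF g(1) has_weak_pderiv_unique[OF g(2) w]])
qed

lemma L2_locally_integrable:
  fixes f :: "real^'n::finite \<Rightarrow> complex"
  assumes "f \<in> L2" shows "locally_integrable f"
  unfolding locally_integrable_def set_integrable_def
proof (intro allI impI)
  fix C :: "(real^'n) set" assume C: "compact C"
  have Cm: "C \<in> sets lebesgue" using C by (simp add: lmeasurable_compact fmeasurableD)
  have iC: "integrable lebesgue (\<lambda>x. indicator C x :: real)"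
    using lmeasurable_compact[OF C] by (intro integrable_real_indicator) (auto simp: fmeasurable_def)
  note fm = L2_measurable[OF assms]
  show "integrable lebesgue (\<lambda>x. indicator C x *\<^sub>R f x)"
  proof (rule Bochner_Integration.integrable_bound)
    show "integrable lebesgue (\<lambda>x. indicator C x + (norm (f x))\<^sup>2)"
      using iC L2_integrable_norm2[OF assms] by (rule Bochner_Integration.integrable_add)
    show "(\<lambda>x. indicator C x *\<^sub>R f x) \<in> borel_measurable lebesgue"
      using Cm fm by measurable
    show "AE x in lebesgue. norm (indicator C x *\<^sub>R f x) \<le> norm (indicator C x + (norm (f x))\<^sup>2)"
    proof (rule AE_I2)
      fix x
      have "norm (f x) \<le> 1 + (norm (f x))\<^sup>2"
      proof -
        have "2 * norm (f x) \<le> (norm (f x))\<^sup>2 + 1"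
          using zero_le_power2[of "norm (f x) - 1"] by (simp add: power2_diff)
        then show ?thesis using norm_ge_zero[of "f x"] by linarith
      qed
      then show "norm (indicator C x *\<^sub>R f x) \<le> norm (indicator C x + (norm (f x))\<^sup>2)"
        by (auto split: split_indicator)
    qed
  qed
qed

text \<open>The assumption \<open>div\<close> says that \<open>v\<close> is minus the divergence of
  \<open>g\<close>, tested on bumps only. Mollifying the pairing of \<open>v\<close> and
  \<open>w\<close> by the kernel gives the identity exactly for each radius, by Fubini; dividing by
  the mass of the kernel and letting the radius tend to 0 removes the mollification.\<close>

lemma weak_integration_by_parts_borel:
  fixes v w :: "real^'n::finite \<Rightarrow> real" and g W :: "'n \<Rightarrow> real^'n \<Rightarrow> real"
  assumes m[measurable]: "v \<in> borel_measurable borel" "w \<in> borel_measurable borel"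
      "\<And>j. g j \<in> borel_measurable borel" "\<And>j. W j \<in> borel_measurable borel"
    and sq: "integrable lborel (\<lambda>x. (v x)\<^sup>2)" "integrable lborel (\<lambda>x. (w x)\<^sup>2)"
      "\<And>j. integrable lborel (\<lambda>x. (g j x)\<^sup>2)" "\<And>j. integrable lborel (\<lambda>x. (W j x)\<^sup>2)"
    and div: "\<And>r y. 0 < r \<Longrightarrow> (LINT x|lborel. bump r 1 (x - y) * v x) =
        (\<Sum>j\<in>UNIV. LINT x|lborel. bump_pderiv r j (x - y) * g j x)"
    and wk: "\<And>r x j. 0 < r \<Longrightarrow> (LINT y|lborel. bump_pderiv r j (y - x) * w y) =
        - (LINT y|lborel. bump r 1 (y - x) * W j y)"
  shows "(LINT x|lborel. v x * w x) = (\<Sum>j\<in>UNIV. LINT x|lborel. g j x * W j x)"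
proof -
  define D where "D = (\<lambda>r p q. LINT (x, y)|(lborel \<Otimes>\<^sub>M lborel). p x * bump r 1 (y - (x::real^'n)) * q y)"
  define I where "I = (\<lambda>r. LINT z|lborel. bump r 1 (z::real^'n))"
  have eq: "D r v w = (\<Sum>j\<in>UNIV. D r (g j) (W j))" if r: "0 < r" for r
  proof -
    note r0 = less_imp_le[OF r]
    have i1: "integrable (lborel \<Otimes>\<^sub>M lborel) (\<lambda>(x, y). v x * bump r 1 (y - x) * w y)"
      by (rule integrable_kernel_product) (use sq r0 in \<open>auto intro: integrable_bump simp: bump_minus\<close>)
    have i2: "integrable (lborel \<Otimes>\<^sub>M lborel) (\<lambda>(x, y). g j x * bump_pderiv r j (y - x) * w y)" for j
      by (rule integrable_kernel_product) (use sq r0 in \<open>auto intro: integrable_bump_pderiv simp: bump_pderiv_minus\<close>)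
    have i3: "integrable (lborel \<Otimes>\<^sub>M lborel) (\<lambda>(x, y). g j x * bump r 1 (y - x) * W j y)" for j
      by (rule integrable_kernel_product) (use sq r0 in \<open>auto intro: integrable_bump simp: bump_minus\<close>)
    have "D r v w = (LINT y|lborel. LINT x|lborel. v x * bump r 1 (y - x) * w y)"
      unfolding D_def by (rule lborel_pair.integral_snd[symmetric]) (rule i1)
    also have "\<dots> = (LINT y|lborel. (\<Sum>j\<in>UNIV. - (LINT x|lborel. g j x * bump_pderiv r j (y - x) * w y)))"
    proof (rule Bochner_Integration.integral_cong[OF refl])
      fix y
      have "(LINT x|lborel. v x * bump r 1 (y - x) * w y) = (LINT x|lborel. bump r 1 (x - y) * v x) * w y"
        by (simp add: bump_swap[of r 1 y] mult.commute)
      also have "\<dots> = (\<Sum>j\<in>UNIV. (LINT x|lborel. bump_pderiv r j (x - y) * g j x) * w y)"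
        by (simp add: div[OF r] sum_distrib_right)
      \<comment> \<open>The sign comes from the odd kernel, as \<open>div\<close> has
        \<open>x - y\<close> and the double integral has \<open>y - x\<close>. It is cancelled below
        by the sign in the weak derivative of \<open>w\<close>.\<close>
      also have "\<dots> = (\<Sum>j\<in>UNIV. - (LINT x|lborel. g j x * bump_pderiv r j (y - x) * w y))"
        by (intro sum.cong refl) (simp add: bump_pderiv_swap[of r _ y] mult.commute)
      finally show "(LINT x|lborel. v x * bump r 1 (y - x) * w y) =
        (\<Sum>j\<in>UNIV. - (LINT x|lborel. g j x * bump_pderiv r j (y - x) * w y))" .
    qed
    also have "\<dots> = (\<Sum>j\<in>UNIV. - (LINT y|lborel. LINT x|lborel. g j x * bump_pderiv r j (y - x) * w y))"
      using lborel_pair.integrable_snd[OF i2] by (subst Bochner_Integration.integral_sum) auto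
    also have "\<dots> = (\<Sum>j\<in>UNIV. D r (g j) (W j))"
    proof (rule sum.cong[OF refl])
      fix j
      have "(LINT y|lborel. LINT x|lborel. g j x * bump_pderiv r j (y - x) * w y) =
          (LINT x|lborel. LINT y|lborel. g j x * bump_pderiv r j (y - x) * w y)"
        using lborel_pair.integral_snd[OF i2] lborel_pair.integral_fst[OF i2] by simp
      also have "\<dots> = (LINT x|lborel. - (LINT y|lborel. g j x * bump r 1 (y - x) * W j y))"
      proof (rule Bochner_Integration.integral_cong[OF refl])
        fix x
        show "(LINT y|lborel. g j x * bump_pderiv r j (y - x) * w y) = - (LINT y|lborel. g j x * bump r 1 (y - x) * W j y)"
          using wk[OF r, of j x] by (simp add: mult.assoc)
      qed
      also have "\<dots> = - D r (g j) (W j)"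
        unfolding D_def using lborel_pair.integral_fst[OF i3] by simp
      finally show "- (LINT y|lborel. LINT x|lborel. g j x * bump_pderiv r j (y - x) * w y) = D r (g j) (W j)"
        by simp
    qed
    finally show ?thesis .
  qed
  have lim: "((\<lambda>r. D r v w / I r) \<longlongrightarrow> (LINT x|lborel. v x * w x)) (at_right 0)"
    unfolding D_def I_def by (rule mollified_product_tendsto) (use m sq in auto)
  have "((\<lambda>r. \<Sum>j\<in>UNIV. D r (g j) (W j) / I r) \<longlongrightarrow> (\<Sum>j\<in>UNIV. LINT x|lborel. g j x * W j x)) (at_right 0)"
    unfolding D_def I_def by (intro tendsto_sum mollified_product_tendsto) (use m sq in auto)
  moreover have "\<forall>\<^sub>F r in at_right 0. (\<Sum>j\<in>UNIV. D r (g j) (W j) / I r) = D r v w / I r"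
    unfolding eventually_at_filter by (intro always_eventually) (simp add: eq sum_divide_distrib)
  ultimately have "((\<lambda>r. D r v w / I r) \<longlongrightarrow> (\<Sum>j\<in>UNIV. LINT x|lborel. g j x * W j x)) (at_right 0)"
    by (rule Lim_transform_eventually)
  then show ?thesis using tendsto_unique[OF _ lim] by simp
qed

lemma weak_integration_by_parts_real:
  fixes v w :: "real^'n::finite \<Rightarrow> real" and g W :: "'n \<Rightarrow> real^'n \<Rightarrow> real"
  assumes m: "v \<in> borel_measurable lebesgue" "w \<in> borel_measurable lebesgue"
      "\<And>j. g j \<in> borel_measurable lebesgue" "\<And>j. W j \<in> borel_measurable lebesgue"
    and sq: "integrable lebesgue (\<lambda>x. (v x)\<^sup>2)" "integrable lebesgue (\<lambda>x. (w x)\<^sup>2)"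
      "\<And>j. integrable lebesgue (\<lambda>x. (g j x)\<^sup>2)" "\<And>j. integrable lebesgue (\<lambda>x. (W j x)\<^sup>2)"
    and div: "\<And>r y. 0 < r \<Longrightarrow> (LINT x|lebesgue. bump r 1 (x - y) * v x) =
        (\<Sum>j\<in>UNIV. LINT x|lebesgue. bump_pderiv r j (x - y) * g j x)"
    and wk: "\<And>r x j. 0 < r \<Longrightarrow> (LINT y|lebesgue. bump_pderiv r j (y - x) * w y) =
        - (LINT y|lebesgue. bump r 1 (y - x) * W j y)"
  shows "(LINT x|lebesgue. v x * w x) = (\<Sum>j\<in>UNIV. LINT x|lebesgue. g j x * W j x)"
proof -
  \<comment> \<open>One fixed representative per function, so that assumptions and conclusion are
    transferred consistently.\<close>
  define R where "R = (\<lambda>f::real^'n \<Rightarrow> real. SOME f'. f' \<in> borel_measurable borel \<and> (AE x in lebesgue. f x = f' x))"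
  have R: "R f \<in> borel_measurable borel" "AE x in lebesgue. f x = R f x" if "f \<in> borel_measurable lebesgue" for f
    using someI_ex[OF borel_representative[OF that]] by (auto simp: R_def)
  have Rsq: "integrable lborel (\<lambda>x. (R f x)\<^sup>2)" if "f \<in> borel_measurable lebesgue" "integrable lebesgue (\<lambda>x. (f x)\<^sup>2)" for f
    using R[OF that(1)] that
    by (subst integral_borel_representative(1)[of "\<lambda>x. (f x)\<^sup>2"]) (auto elim: eventually_mono)
  have Rmul: "(LINT x|lborel. R f x * R h x) = (LINT x|lebesgue. f x * h x)"
    if f: "f \<in> borel_measurable lebesgue" and h: "h \<in> borel_measurable lebesgue" for f h
  proof (rule integral_borel_representative(2))
    show "AE x in lebesgue. f x * h x = R f x * R h x"
      using R(2)[OF f] R(2)[OF h] by eventually_elim simp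
  qed (use f h R(1) in auto)
  have Rk: "(LINT x|lborel. k (x - y) * R f x) = (LINT x|lebesgue. k (x - y) * f x)"
    if f: "f \<in> borel_measurable lebesgue" and k[measurable]: "k \<in> borel_measurable borel" for f k and y :: "real^'n"
  proof (rule integral_borel_representative(2))
    have "(\<lambda>x. k (x - y)) \<in> borel_measurable borel" by measurable
    then show "(\<lambda>x. k (x - y) * f x) \<in> borel_measurable lebesgue"
      by (rule borel_measurable_times[OF borel_measurable_lebesgueI f])
    note [measurable] = R(1)[OF f]
    show "(\<lambda>x. k (x - y) * R f x) \<in> borel_measurable borel" by measurable
    show "AE x in lebesgue. k (x - y) * f x = k (x - y) * R f x"
      using R(2)[OF f] by eventually_elim simp
  qed
  have "(LINT x|lborel. R v x * R w x) = (\<Sum>j\<in>UNIV. LINT x|lborel. R (g j) x * R (W j) x)"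
    by (rule weak_integration_by_parts_borel)
      (use m sq div wk in \<open>simp_all add: R(1) Rsq Rk\<close>)
  then show ?thesis using m by (simp add: Rmul)
qed

lemma L2_parts:
  assumes "f \<in> L2"
  shows "(\<lambda>x. Re (f x)) \<in> borel_measurable lebesgue" "(\<lambda>x. Im (f x)) \<in> borel_measurable lebesgue"
    and "integrable lebesgue (\<lambda>x. (Re (f x))\<^sup>2)" "integrable lebesgue (\<lambda>x. (Im (f x))\<^sup>2)"
proof -
  note [measurable] = L2_measurable[OF assms]
  show "(\<lambda>x. Re (f x)) \<in> borel_measurable lebesgue" "(\<lambda>x. Im (f x)) \<in> borel_measurable lebesgue" by measurable
  show "integrable lebesgue (\<lambda>x. (Re (f x))\<^sup>2)" "integrable lebesgue (\<lambda>x. (Im (f x))\<^sup>2)"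
    by (rule Bochner_Integration.integrable_bound[OF L2_integrable_norm2[OF assms]]; measurable?; simp add: cmod_power2)+
qed

lemma L2inner_parts:
  assumes "f \<in> L2" "g \<in> L2"
  shows "L2inner f g = (LINT x|lebesgue. Re (f x) * Re (g x)) + (LINT x|lebesgue. Im (f x) * Im (g x))"
proof -
  have "integrable lebesgue (\<lambda>x. Re (f x) * Re (g x))" "integrable lebesgue (\<lambda>x. Im (f x) * Im (g x))"
    using integrable_inner_of_squares[of "\<lambda>x. Re (f x)" lebesgue "\<lambda>x. Re (g x)"]
      integrable_inner_of_squares[of "\<lambda>x. Im (f x)" lebesgue "\<lambda>x. Im (g x)"] L2_parts[OF assms(1)] L2_parts[OF assms(2)]
    by auto
  then show ?thesis by (simp add: L2inner_def inner_complex_def)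
qed

lemma L2inner_weak_divergence:
  fixes v w :: "real^'n::finite \<Rightarrow> complex" and G W :: "'n \<Rightarrow> real^'n \<Rightarrow> complex"
  assumes v: "v \<in> L2" and G: "\<And>j. G j \<in> L2" and w: "w \<in> L2" and W: "\<And>j. W j \<in> L2"
    and d: "\<And>r y. 0 < r \<Longrightarrow> (LINT x|lebesgue. bump r 1 (x - y) *\<^sub>R v x) =
        (\<Sum>j\<in>UNIV. LINT x|lebesgue. bump_pderiv r j (x - y) *\<^sub>R G j x)"
    and wk: "\<And>j. has_weak_pderiv j w (W j)"
  shows "L2inner v w = (\<Sum>j\<in>UNIV. L2inner (G j) (W j))"
proof -
  have i: "integrable lebesgue (\<lambda>x. bump r 1 (x - y) *\<^sub>R f x)" "integrable lebesgue (\<lambda>x. bump_pderiv r j (x - y) *\<^sub>R f x)"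
    if "0 < r" "f \<in> L2" for r y f and j :: 'n
    using locally_integrable_bump[OF L2_locally_integrable[OF that(2)] less_imp_le[OF that(1)]]
      locally_integrable_bump_pderiv[OF L2_locally_integrable[OF that(2)] less_imp_le[OF that(1)]] by blast+
  have wk': "(LINT y|lebesgue. bump_pderiv r j (y - x) *\<^sub>R w y) = - (LINT y|lebesgue. bump r 1 (y - x) *\<^sub>R W j y)"
    if "0 < r" for r x j
    using has_weak_pderiv_bump[OF wk] that by simp
  have "(LINT x|lebesgue. Re (v x) * Re (w x)) = (\<Sum>j\<in>UNIV. LINT x|lebesgue. Re (G j x) * Re (W j x))"
  proof (rule weak_integration_by_parts_real)
    fix r :: real and y assume r: "0 < r"
    show "(LINT x|lebesgue. bump r 1 (x - y) * Re (v x)) = (\<Sum>j\<in>UNIV. LINT x|lebesgue. bump_pderiv r j (x - y) * Re (G j x))"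
      using arg_cong[OF d[OF r, of y], of Re] integral_Re[OF i(1)[OF r v, where y=y]] integral_Re[OF i(2)[OF r G, where y=y]]
      by simp
    show "(LINT x|lebesgue. bump_pderiv r j (x - y) * Re (w x)) = - (LINT x|lebesgue. bump r 1 (x - y) * Re (W j x))" for j
      using arg_cong[OF wk'[OF r, where j=j and x=y], of Re] integral_Re[OF i(2)[OF r w, where y=y and j=j]] integral_Re[OF i(1)[OF r W[of j], where y=y]]
      by simp
  qed (intro L2_parts v w G W)+
  moreover have "(LINT x|lebesgue. Im (v x) * Im (w x)) = (\<Sum>j\<in>UNIV. LINT x|lebesgue. Im (G j x) * Im (W j x))"
  proof (rule weak_integration_by_parts_real)
    fix r :: real and y assume r: "0 < r"
    show "(LINT x|lebesgue. bump r 1 (x - y) * Im (v x)) = (\<Sum>j\<in>UNIV. LINT x|lebesgue. bump_pderiv r j (x - y) * Im (G j x))"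
      using arg_cong[OF d[OF r, of y], of Im] integral_Im[OF i(1)[OF r v, where y=y]] integral_Im[OF i(2)[OF r G, where y=y]]
      by simp
    show "(LINT x|lebesgue. bump_pderiv r j (x - y) * Im (w x)) = - (LINT x|lebesgue. bump r 1 (x - y) * Im (W j x))" for j
      using arg_cong[OF wk'[OF r, where j=j and x=y], of Im] integral_Im[OF i(2)[OF r w, where y=y and j=j]] integral_Im[OF i(1)[OF r W[of j], where y=y]]
      by simp
  qed (intro L2_parts v w G W)+
  ultimately show ?thesis using v w G W by (simp add: L2inner_parts sum.distrib)
qed

subsection \<open>The energy of a solution\<close>

text \<open>From \<open>ln (s / r) \<le> s / r - 1\<close>: replacing \<open>ln r\<close> by
  \<open>ln s\<close> costs at most \<open>s - r\<close>, which the linear part of the modulus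
  regains.\<close>

lemma loglip_modulus_mono:
  assumes "0 < r" "r \<le> s" "s \<le> 1" shows "loglip_modulus r \<le> loglip_modulus s"
proof -
  have ln: "ln r \<le> 0" "ln s \<le> 0" using assms by auto
  have "ln (s / r) \<le> s / r - 1" using assms by (intro ln_le_minus_one) auto
  then have "r * ln (s / r) \<le> r * (s / r - 1)" using assms by (intro mult_left_mono) auto
  then have "r * (ln s - ln r) \<le> s - r" using assms by (simp add: ln_div algebra_simps)
  moreover have "r * (- ln s) \<le> s * (- ln s)" using assms ln by (intro mult_right_mono) auto
  ultimately show ?thesis using ln by (simp add: loglip_modulus_def abs_of_nonpos algebra_simps)
qed

lemma L2_mult_bounded:
  fixes f :: "real^'n::finite \<Rightarrow> complex"
  assumes f: "f \<in> L2" and b: "b \<in> borel_measurable lebesgue" "AE x in lebesgue. \<bar>b x\<bar> \<le> c"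
  shows "(\<lambda>x. b x *\<^sub>R f x) \<in> L2" and "L2norm (\<lambda>x. b x *\<^sub>R f x) \<le> \<bar>c\<bar> * L2norm f"
proof -
  have m: "(\<lambda>x. b x *\<^sub>R f x) \<in> borel_measurable lebesgue"
    by (intro borel_measurable_scaleR b L2_measurable f)
  have le: "AE x in lebesgue. (norm (b x *\<^sub>R f x))\<^sup>2 \<le> c\<^sup>2 * (norm (f x))\<^sup>2"
    using b(2)
  proof eventually_elim
    case (elim x)
    then have "\<bar>b x\<bar>\<^sup>2 \<le> c\<^sup>2" by (intro power_mono) auto
    then show ?case by (simp add: power_mult_distrib mult_right_mono)
  qed
  have cf: "integrable lebesgue (\<lambda>x. c\<^sup>2 * (norm (f x))\<^sup>2)"
    using L2_integrable_norm2[OF f] by simp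
  have int: "integrable lebesgue (\<lambda>x. (norm (b x *\<^sub>R f x))\<^sup>2)"
  proof (rule Bochner_Integration.integrable_bound[OF cf])
    show "(\<lambda>x. (norm (b x *\<^sub>R f x))\<^sup>2) \<in> borel_measurable lebesgue"
      by (rule borel_measurable_power[OF measurable_compose[OF m borel_measurable_norm]])
    show "AE x in lebesgue. norm ((norm (b x *\<^sub>R f x))\<^sup>2) \<le> norm (c\<^sup>2 * (norm (f x))\<^sup>2)"
      using le by eventually_elim simp
  qed
  then show "(\<lambda>x. b x *\<^sub>R f x) \<in> L2" using m by (simp add: L2_def)
  have "(LINT x|lebesgue. (norm (b x *\<^sub>R f x))\<^sup>2) \<le> (LINT x|lebesgue. c\<^sup>2 * (norm (f x))\<^sup>2)"
    by (rule integral_mono_AE[OF int cf le])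
  then have "L2norm (\<lambda>x. b x *\<^sub>R f x) \<le> sqrt (c\<^sup>2 * (LINT x|lebesgue. (norm (f x))\<^sup>2))"
    unfolding L2norm_def by simp
  then show "L2norm (\<lambda>x. b x *\<^sub>R f x) \<le> \<bar>c\<bar> * L2norm f"
    by (simp add: L2norm_def real_sqrt_mult)
qed

lemma L2inner_sum_left:
  assumes "\<And>i. i \<in> I \<Longrightarrow> f i \<in> L2" "g \<in> L2"
  shows "L2inner (\<lambda>x. \<Sum>i\<in>I. f i x) g = (\<Sum>i\<in>I. L2inner (f i) g)"
  using assms(1)
proof (induction I rule: infinite_finite_induct)
  case (insert i I)
  then show ?case using L2inner_add_left[of "f i" "\<lambda>x. \<Sum>i\<in>I. f i x" g] L2_sum[of I f] assms(2) by simp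
qed (simp_all add: L2inner_def)

text \<open>The time derivative \<open>v\<close> is a parameter, so that energy and form identities
  can refer to one fixed choice.\<close>

locale backward_solution =
  fixes T \<kappa> A A_LL :: real and a :: "'n::finite \<Rightarrow> 'n \<Rightarrow> real \<Rightarrow> real^'n \<Rightarrow> real"
    and u v :: "real \<Rightarrow> real^'n \<Rightarrow> complex"
  assumes T: "0 < T" and \<kappa>: "0 < \<kappa>" and adm: "admissible_coeffs T \<kappa> A A_LL a"
    and u: "u \<in> solution_space T" and v: "has_L2_deriv {0..<T} u v"
    and eq: "\<And>t \<phi>. t \<in> {0..<T} \<Longrightarrow> \<phi> \<in> test_functions \<Longrightarrow>
        dist_of (v t) \<phi> + (\<Sum>j\<in>UNIV. \<Sum>k\<in>UNIV.
           dist_deriv j (dist_of (\<lambda>x. a j k t x *\<^sub>R weak_pderiv k (u t) x)) \<phi>) = 0"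
begin

lemma symmetric: "t \<in> {0..T} \<Longrightarrow> a j k t x = a k j t x"
  using adm by (auto simp: admissible_coeffs_def)

lemma elliptic:
  assumes "t \<in> {0..T}"
  shows "\<kappa> * (\<Sum>k\<in>UNIV. (\<xi> k)\<^sup>2) \<le> (\<Sum>j\<in>UNIV. \<Sum>k\<in>UNIV. a j k t x * \<xi> j * \<xi> k)"
    and "(\<Sum>j\<in>UNIV. \<Sum>k\<in>UNIV. a j k t x * \<xi> j * \<xi> k) \<le> inverse \<kappa> * (\<Sum>k\<in>UNIV. (\<xi> k)\<^sup>2)"
proof -
  have n: "(norm (\<chi> k. \<xi> k))\<^sup>2 = (\<Sum>k\<in>UNIV. (\<xi> k)\<^sup>2)"
    by (simp add: norm_vec_def L2_set_def sum_nonneg)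
  have "\<kappa> * (norm (\<chi> k. \<xi> k))\<^sup>2 \<le> (\<Sum>j\<in>UNIV. \<Sum>k\<in>UNIV. a j k t x * (\<chi> k. \<xi> k) $ j * (\<chi> k. \<xi> k) $ k)"
    "(\<Sum>j\<in>UNIV. \<Sum>k\<in>UNIV. a j k t x * (\<chi> k. \<xi> k) $ j * (\<chi> k. \<xi> k) $ k) \<le> inverse \<kappa> * (norm (\<chi> k. \<xi> k))\<^sup>2"
    using adm assms unfolding admissible_coeffs_def by blast+
  then show "\<kappa> * (\<Sum>k\<in>UNIV. (\<xi> k)\<^sup>2) \<le> (\<Sum>j\<in>UNIV. \<Sum>k\<in>UNIV. a j k t x * \<xi> j * \<xi> k)"
    "(\<Sum>j\<in>UNIV. \<Sum>k\<in>UNIV. a j k t x * \<xi> j * \<xi> k) \<le> inverse \<kappa> * (\<Sum>k\<in>UNIV. (\<xi> k)\<^sup>2)"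
    unfolding n by simp_all
qed

lemma elliptic_complex:
  fixes p :: "'n \<Rightarrow> complex"
  assumes "t \<in> {0..T}"
  shows "\<kappa> * (\<Sum>k\<in>UNIV. (norm (p k))\<^sup>2) \<le> (\<Sum>j\<in>UNIV. \<Sum>k\<in>UNIV. a j k t x * (p k \<bullet> p j))"
    and "(\<Sum>j\<in>UNIV. \<Sum>k\<in>UNIV. a j k t x * (p k \<bullet> p j)) \<le> inverse \<kappa> * (\<Sum>k\<in>UNIV. (norm (p k))\<^sup>2)"
proof -
  have 1: "(\<Sum>j\<in>UNIV. \<Sum>k\<in>UNIV. a j k t x * (p k \<bullet> p j)) =
     (\<Sum>j\<in>UNIV. \<Sum>k\<in>UNIV. a j k t x * Re (p j) * Re (p k)) + (\<Sum>j\<in>UNIV. \<Sum>k\<in>UNIV. a j k t x * Im (p j) * Im (p k))"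
    by (simp add: inner_complex_def sum.distrib[symmetric] algebra_simps)
  have 2: "(\<Sum>k\<in>UNIV. (norm (p k))\<^sup>2) = (\<Sum>k\<in>UNIV. (Re (p k))\<^sup>2) + (\<Sum>k\<in>UNIV. (Im (p k))\<^sup>2)"
    by (simp add: cmod_power2 sum.distrib)
  show "\<kappa> * (\<Sum>k\<in>UNIV. (norm (p k))\<^sup>2) \<le> (\<Sum>j\<in>UNIV. \<Sum>k\<in>UNIV. a j k t x * (p k \<bullet> p j))"
    "(\<Sum>j\<in>UNIV. \<Sum>k\<in>UNIV. a j k t x * (p k \<bullet> p j)) \<le> inverse \<kappa> * (\<Sum>k\<in>UNIV. (norm (p k))\<^sup>2)"
    unfolding 1 2 distrib_left by (intro add_mono elliptic assms)+
qed

lemma coeff_measurable: "t \<in> {0..T} \<Longrightarrow> a j k t \<in> borel_measurable lebesgue"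
proof -
  assume "t \<in> {0..T}"
  then obtain L where "L-lipschitz_on UNIV (a j k t)" using adm unfolding admissible_coeffs_def by blast
  then have "continuous_on UNIV (a j k t)" by (rule lipschitz_on_continuous_on)
  then show ?thesis by (intro borel_measurable_lebesgueI borel_measurable_continuous_onI)
qed

lemma coeff_bounded:
  assumes "t \<in> {0..T}" shows "AE x in lebesgue. \<bar>a j k t x\<bar> \<le> A"
proof -
  have "Linf_norm (a j k t) \<le> Lip_const T a"
    unfolding Lip_const_def by (rule Sup_upper) (use assms in blast)
  then have le: "Linf_norm (a j k t) \<le> ereal A" using adm by (simp add: admissible_coeffs_def)
  show ?thesis
    using esssup_AE[of "\<lambda>x. ereal \<bar>a j k t x\<bar>" lebesgue]
  proof eventually_elim
    case (elim x)
    then have "ereal \<bar>a j k t x\<bar> \<le> ereal A" using le unfolding Linf_norm_def by (rule order_trans)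
    then show ?case by simp
  qed
qed

lemma coeff_loglip:
  assumes "t \<in> {0..T}" "s \<in> {0..T}" "0 < \<bar>t - s\<bar>" "\<bar>t - s\<bar> \<le> 1"
  shows "\<bar>a j k t x - a j k s x\<bar> \<le> A_LL * loglip_modulus \<bar>t - s\<bar>"
proof -
  have "ereal (\<bar>a j k t x - a j k s x\<bar> / (\<bar>t - s\<bar> * (1 + \<bar>ln \<bar>t - s\<bar>\<bar>))) \<le> LogLip_const T a"
    unfolding LogLip_const_def by (rule Sup_upper) (use assms in blast)
  then have "\<bar>a j k t x - a j k s x\<bar> / (\<bar>t - s\<bar> * (1 + \<bar>ln \<bar>t - s\<bar>\<bar>)) \<le> A_LL"
    using adm by (simp add: admissible_coeffs_def)
  moreover have "0 < \<bar>t - s\<bar> * (1 + \<bar>ln \<bar>t - s\<bar>\<bar>)" using assms(3) by (intro mult_pos_pos) linarith+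
  ultimately show ?thesis by (simp add: loglip_modulus_def divide_le_eq)
qed

abbreviation "gr t k \<equiv> weak_pderiv k (u t)"

lemma u_L2: "t \<in> {0..T} \<Longrightarrow> u t \<in> L2"
  using u by (auto simp: solution_space_def C0_into_def)

lemma u_C0: "u \<in> C0_into {0..T} L2 L2norm"
  using u by (simp add: solution_space_def)

lemma u_H1: "t \<in> {0..<T} \<Longrightarrow> u t \<in> H1"
  using u by (auto simp: solution_space_def C0_into_def)

lemma v_L2: "t \<in> {0..<T} \<Longrightarrow> v t \<in> L2"
  using v by (simp add: has_L2_deriv_def)

lemma gr_L2: "t \<in> {0..<T} \<Longrightarrow> gr t k \<in> L2"
  by (rule H1_weak_pderiv(3)[OF u_H1])

lemma coeff_gr_L2: "t \<in> {0..<T} \<Longrightarrow> (\<lambda>x. a j k t x *\<^sub>R gr t k x) \<in> L2"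
  by (rule L2_mult_bounded(1)[OF gr_L2 coeff_measurable coeff_bounded]) auto

text \<open>The passage from test functions to \<open>H1\<close>: the right-hand side is the form
  \<open>B\<^sub>t(u(t), w)\<close>. The equation is used only on bumps, with the coefficients times
  the gradient of \<open>u t\<close> as the vector field.\<close>

lemma energy_identity:
  assumes t: "t \<in> {0..<T}" and w: "w \<in> H1"
  shows "L2inner (v t) w = (\<Sum>j\<in>UNIV. \<Sum>k\<in>UNIV. L2inner (\<lambda>x. a j k t x *\<^sub>R gr t k x) (weak_pderiv j w))"
proof -
  let ?G = "\<lambda>j x. \<Sum>k\<in>UNIV. a j k t x *\<^sub>R gr t k x"
  have "L2inner (v t) w = (\<Sum>j\<in>UNIV. L2inner (?G j) (weak_pderiv j w))"
  proof (rule L2inner_weak_divergence)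
    fix r :: real and y assume r: "0 < r"
    have "(LINT x|lebesgue. bump r 1 (x - y) *\<^sub>R v t x) =
        (\<Sum>j\<in>UNIV. \<Sum>k\<in>UNIV. LINT x|lebesgue. bump_pderiv r j (x - y) *\<^sub>R (a j k t x *\<^sub>R gr t k x))"
      using eq[OF t bump_test_function[of r 1 y]] r by (simp add: dist_of_bump dist_deriv_bump sum_negf)
    also have "\<dots> = (\<Sum>j\<in>UNIV. LINT x|lebesgue. bump_pderiv r j (x - y) *\<^sub>R ?G j x)"
    proof (rule sum.cong[OF refl])
      fix j
      have "integrable lebesgue (\<lambda>x. bump_pderiv r j (x - y) *\<^sub>R (a j k t x *\<^sub>R gr t k x))" for k
        by (rule locally_integrable_bump_pderiv[OF L2_locally_integrable[OF coeff_gr_L2[OF t]] less_imp_le[OF r]])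
      then show "(\<Sum>k\<in>UNIV. LINT x|lebesgue. bump_pderiv r j (x - y) *\<^sub>R (a j k t x *\<^sub>R gr t k x)) =
          (LINT x|lebesgue. bump_pderiv r j (x - y) *\<^sub>R ?G j x)"
        unfolding scaleR_sum_right by (subst Bochner_Integration.integral_sum) auto
    qed
    finally show "(LINT x|lebesgue. bump r 1 (x - y) *\<^sub>R v t x) =
        (\<Sum>j\<in>UNIV. LINT x|lebesgue. bump_pderiv r j (x - y) *\<^sub>R ?G j x)" .
  qed (use v_L2[OF t] H1_weak_pderiv[OF w] in \<open>auto intro: L2_sum coeff_gr_L2[OF t]\<close>)
  then show ?thesis
    using L2inner_sum_left[of UNIV "\<lambda>k x. a _ k t x *\<^sub>R gr t k x"] coeff_gr_L2[OF t] H1_weak_pderiv(3)[OF w] by simp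
qed

definition energy :: "real \<Rightarrow> real" where
  "energy t = L2inner (v t) (u t)"

definition gradsq :: "real \<Rightarrow> real" where
  "gradsq t = (\<Sum>k\<in>UNIV. (L2norm (gr t k))\<^sup>2)"

lemma energy_bounds:
  assumes t: "t \<in> {0..<T}"
  shows "\<kappa> * gradsq t \<le> energy t" and "energy t \<le> inverse \<kappa> * gradsq t"
proof -
  have t': "t \<in> {0..T}" using t by simp
  have i: "integrable lebesgue (\<lambda>x. a j k t x * (gr t k x \<bullet> gr t j x))" for j k
    using L2_integrable_inner[OF coeff_gr_L2[OF t] gr_L2[OF t]] by simp
  have e: "energy t = (LINT x|lebesgue. (\<Sum>j\<in>UNIV. \<Sum>k\<in>UNIV. a j k t x * (gr t k x \<bullet> gr t j x)))"
    unfolding energy_def energy_identity[OF t u_H1[OF t]] using i by (simp add: L2inner_def)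
  have ie: "integrable lebesgue (\<lambda>x. \<Sum>j\<in>UNIV. \<Sum>k\<in>UNIV. a j k t x * (gr t k x \<bullet> gr t j x))"
    using i by auto
  have ig: "integrable lebesgue (\<lambda>x. c * (\<Sum>k\<in>UNIV. (norm (gr t k x))\<^sup>2))" for c
    using L2_integrable_norm2[OF gr_L2[OF t]] by auto
  have g: "(LINT x|lebesgue. c * (\<Sum>k\<in>UNIV. (norm (gr t k x))\<^sup>2)) = c * gradsq t" for c
    using L2_integrable_norm2[OF gr_L2[OF t]] by (simp add: gradsq_def L2norm_def)
  show "\<kappa> * gradsq t \<le> energy t" "energy t \<le> inverse \<kappa> * gradsq t"
    unfolding g[symmetric] e by (intro integral_mono ig ie elliptic_complex t')+
qed

lemma energy_nonneg: "t \<in> {0..<T} \<Longrightarrow> 0 \<le> energy t"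
  using energy_bounds(1)[of t] \<kappa> by (smt (verit) gradsq_def mult_nonneg_nonneg sum_nonneg zero_le_power2)

text \<open>Both terms are forms in the same pair \<open>u t\<close>, \<open>u s\<close>, so their
  difference contains only coefficient differences. The 2 comes from the product bound for two
  gradients, the dimension from the double sum, and \<kappa> from bounding gradients by the
  energy.\<close>

lemma skew_bound:
  assumes t: "t \<in> {0..<T}" and s: "s \<in> {0..<T}" and ts: "0 < \<bar>t - s\<bar>" "\<bar>t - s\<bar> \<le> 1"
  shows "\<bar>L2inner (v t) (u s) - L2inner (u t) (v s)\<bar> \<le>
    A_LL * loglip_modulus \<bar>t - s\<bar> * (real CARD('n) / (2 * \<kappa>)) * (energy t + energy s)"
proof -
  define c where "c = A_LL * loglip_modulus \<bar>t - s\<bar>"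
  have t': "t \<in> {0..T}" and s': "s \<in> {0..T}" using t s by auto
  have le: "\<bar>a j k t x - a j k s x\<bar> \<le> c" for j k x
    using coeff_loglip[OF t' s' ts] by (simp add: c_def)
  have c: "0 \<le> c" using le[of undefined undefined undefined] by linarith
  let ?d = "\<lambda>j k x. (a j k t x - a j k s x) *\<^sub>R gr t k x"
  have dm: "(\<lambda>x. a j k t x - a j k s x) \<in> borel_measurable lebesgue" for j k
    by (intro borel_measurable_diff coeff_measurable t' s')
  have cAE: "AE x in lebesgue. \<bar>a j k t x - a j k s x\<bar> \<le> c" for j k using le by simp
  have "L2inner (u t) (v s) = L2inner (v s) (u t)" by (rule L2inner_commute)
  also have "\<dots> = (\<Sum>j\<in>UNIV. \<Sum>k\<in>UNIV. L2inner (\<lambda>x. a j k s x *\<^sub>R gr s k x) (gr t j))"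
    by (rule energy_identity[OF s u_H1[OF t]])
  \<comment> \<open>Exchanging the indices and using the symmetry of the coefficients moves the
    gradients of \<open>u t\<close> to the left factor, as in the other form.\<close>
  also have "\<dots> = (\<Sum>k\<in>UNIV. \<Sum>j\<in>UNIV. L2inner (\<lambda>x. a j k s x *\<^sub>R gr s k x) (gr t j))"
    by (rule sum.swap)
  also have "\<dots> = (\<Sum>k\<in>UNIV. \<Sum>j\<in>UNIV. L2inner (\<lambda>x. a k j s x *\<^sub>R gr t j x) (gr s k))"
    by (intro sum.cong refl) (simp add: L2inner_def symmetric[OF s'] inner_commute)
  finally have us: "L2inner (u t) (v s) = (\<Sum>j\<in>UNIV. \<Sum>k\<in>UNIV. L2inner (\<lambda>x. a j k s x *\<^sub>R gr t k x) (gr s j))" .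
  have as: "(\<lambda>x. a j k s x *\<^sub>R gr t k x) \<in> L2" for j k
    by (rule L2_mult_bounded(1)[OF gr_L2[OF t] coeff_measurable[OF s'] coeff_bounded[OF s']])
  have "L2inner (v t) (u s) - L2inner (u t) (v s) = (\<Sum>j\<in>UNIV. \<Sum>k\<in>UNIV. L2inner (?d j k) (gr s j))"
    unfolding us energy_identity[OF t u_H1[OF s]]
    using L2inner_diff_left[OF coeff_gr_L2[OF t] as gr_L2[OF s]]
    by (simp add: sum_subtractf scaleR_diff_left)
  also have "\<bar>\<dots>\<bar> \<le> (\<Sum>j\<in>UNIV. \<Sum>k\<in>UNIV. \<bar>L2inner (?d j k) (gr s j)\<bar>)"
    by (rule order_trans[OF sum_abs]) (intro sum_mono sum_abs)
  also have "\<dots> \<le> (\<Sum>j\<in>UNIV. \<Sum>k\<in>UNIV. c / 2 * ((L2norm (gr t k))\<^sup>2 + (L2norm (gr s j))\<^sup>2))"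
  proof (intro sum_mono)
    fix j k
    have "\<bar>L2inner (?d j k) (gr s j)\<bar> \<le> L2norm (?d j k) * L2norm (gr s j)"
      by (rule L2_Cauchy_Schwarz[OF L2_mult_bounded(1)[OF gr_L2[OF t] dm cAE] gr_L2[OF s]])
    also have "\<dots> \<le> (\<bar>c\<bar> * L2norm (gr t k)) * L2norm (gr s j)"
      by (intro mult_right_mono L2_mult_bounded(2)[OF gr_L2[OF t] dm cAE] L2norm_nonneg)
    also have "\<dots> = c / 2 * (2 * L2norm (gr t k) * L2norm (gr s j))" using c by simp
    also have "\<dots> \<le> c / 2 * ((L2norm (gr t k))\<^sup>2 + (L2norm (gr s j))\<^sup>2)"
      using c by (intro mult_left_mono sum_squares_bound) auto
    finally show "\<bar>L2inner (?d j k) (gr s j)\<bar> \<le> c / 2 * ((L2norm (gr t k))\<^sup>2 + (L2norm (gr s j))\<^sup>2)" .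
  qed
  also have "\<dots> = c / 2 * (real CARD('n) * (gradsq t + gradsq s))"
  proof -
    have "(\<Sum>j\<in>UNIV. \<Sum>k\<in>UNIV. (L2norm (gr t k))\<^sup>2 + (L2norm (gr s j))\<^sup>2) = real CARD('n) * (gradsq t + gradsq s)"
      by (simp add: gradsq_def sum.distrib distrib_left sum_distrib_left)
    then show ?thesis by (simp only: sum_distrib_left[symmetric])
  qed
  also have "\<dots> \<le> c / 2 * (real CARD('n) * ((energy t + energy s) / \<kappa>))"
  proof -
    have "\<kappa> * (gradsq t + gradsq s) \<le> energy t + energy s"
      using energy_bounds(1)[OF t] energy_bounds(1)[OF s] by (simp add: distrib_left)
    then have "gradsq t + gradsq s \<le> (energy t + energy s) / \<kappa>" using \<kappa> by (simp add: field_simps)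
    then show ?thesis using c by (intro mult_left_mono) auto
  qed
  finally show ?thesis by (simp add: c_def)
qed

section \<open>The mass and its almost logarithmic convexity\<close>

definition mass :: "real \<Rightarrow> real" where
  "mass t = L2inner (u t) (u t)"

lemma mass_nonneg: "0 \<le> mass t"
  by (simp add: mass_def L2inner_self_nonneg)

lemma has_derivative_mass: "0 < t \<Longrightarrow> t < T \<Longrightarrow> (mass has_real_derivative 2 * energy t) (at t)"
  unfolding mass_def[abs_def] energy_def by (rule has_derivative_L2norm_square[OF u_C0 v])

lemma continuous_on_mass: "continuous_on {0..T} mass"
  unfolding mass_def[abs_def] by (rule continuous_on_L2inner_compose[OF u_C0]) (auto intro: continuous_intros)

lemma mass_mono:
  assumes "0 \<le> s" "s \<le> t" "t \<le> T" shows "mass s \<le> mass t"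
proof (rule DERIV_nonneg_imp_increasing_open[OF assms(2)])
  show "\<exists>y. (mass has_real_derivative y) (at x) \<and> 0 \<le> y" if "s < x" "x < t" for x
    using has_derivative_mass[of x] energy_nonneg[of x] that assms by (intro exI[of _ "2 * energy x"]) auto
  show "continuous_on {s..t} mass" by (rule continuous_on_subset[OF continuous_on_mass]) (use assms in auto)
qed

lemma mass_increment_le:
  assumes "0 \<le> s" "s \<le> t" "t \<le> T" and B: "\<And>r. 0 < r \<Longrightarrow> r < T \<Longrightarrow> gradsq r \<le> B"
  shows "mass t - mass s \<le> 2 * inverse \<kappa> * B * (t - s)"
proof -
  let ?f = "\<lambda>r. 2 * inverse \<kappa> * B * r - mass r"
  have "?f s \<le> ?f t"
  proof (rule DERIV_nonneg_imp_increasing_open[OF assms(2), of ?f])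
    fix x assume x: "s < x" "x < t"
    then have x': "0 < x" "x < T" using assms by auto
    have "energy x \<le> inverse \<kappa> * B"
    proof (rule order_trans)
      show "energy x \<le> inverse \<kappa> * gradsq x" using x' by (intro energy_bounds(2)) simp
      show "inverse \<kappa> * gradsq x \<le> inverse \<kappa> * B" using \<kappa> by (intro mult_left_mono B[OF x']) simp
    qed
    moreover have "(?f has_real_derivative 2 * inverse \<kappa> * B * 1 - 2 * energy x) (at x)"
      by (intro DERIV_diff DERIV_cmult DERIV_ident has_derivative_mass x')
    ultimately show "\<exists>y. (?f has_real_derivative y) (at x) \<and> 0 \<le> y"
      by (intro exI[of _ "2 * inverse \<kappa> * B * 1 - 2 * energy x"]) simp
  next
    show "continuous_on {s..t} ?f"
      by (intro continuous_intros continuous_on_subset[OF continuous_on_mass]) (use assms in auto)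
  qed
  then show ?thesis by (simp add: algebra_simps)
qed

text \<open>The coefficients at times \<open>t + r\<close> and \<open>t - r\<close> differ by at most the Log-Lipschitz modulus, so
  \<open>r \<mapsto> \<langle>u(t + r), u(t - r)\<rangle>\<close> is constant up to an error controlled by the increments of the mass.\<close>

lemma almost_log_convex_mass: "almost_log_convex (A_LL * real CARD('n) / (4 * \<kappa>)) T mass"
  unfolding almost_log_convex_def
proof (intro allI impI, elim conjE)
  fix t \<tau> :: real assume \<tau>: "0 < \<tau>" "2 * \<tau> \<le> 1" "0 \<le> t - \<tau>" "t + \<tau> \<le> T"
  \<comment> \<open>The derivative of the mass is twice the energy, and so the constant
    \<open>2 * \<kappa>\<close> in the denominator of \<open>skew_bound\<close> becomes
    \<open>4 * \<kappa>\<close>.\<close>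
  define M where "M = A_LL * real CARD('n) / (4 * \<kappa>) * loglip_modulus (2 * \<tau>)"
  \<comment> \<open>The sign follows by comparing the coefficients at the times 0 and
    \<open>min T 1\<close>, whose distance is positive and at most 1.\<close>
  have A_LL: "0 \<le> A_LL"
  proof -
    have "0 < min T 1" using T by simp
    then have "0 \<le> A_LL * loglip_modulus (min T 1)"
      using coeff_loglip[of "min T 1" 0 undefined undefined undefined] T by auto
    moreover have "0 < loglip_modulus (min T 1)"
      using \<open>0 < min T 1\<close> unfolding loglip_modulus_def by (intro mult_pos_pos) linarith+
    ultimately show ?thesis by (simp add: zero_le_mult_iff)
  qed
  let ?g = "\<lambda>r. L2inner (u (t + r)) (u (t - r))"
  let ?F = "\<lambda>r. ?g r + M * (mass (t + r) - mass (t - r))"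
  have "?F 0 \<le> ?F \<tau>"
  proof (rule DERIV_nonneg_imp_increasing_open[of 0 \<tau> ?F])
    show "0 \<le> \<tau>" using \<tau> by simp
  next
    fix r assume r: "0 < r" "r < \<tau>"
    have p: "0 < t + r" "t + r < T" "0 < t - r" "t - r < T" using r \<tau> by auto
    define y where "y = L2inner (v (t + r)) (u (t - r)) - L2inner (u (t + r)) (v (t - r)) +
      M * (2 * energy (t + r) * (0 + 1) - 2 * energy (t - r) * (0 - 1))"
    have "((\<lambda>r. mass (t + r)) has_real_derivative 2 * energy (t + r) * (0 + 1)) (at r)"
      by (rule DERIV_chain2[where g="\<lambda>r. t + r" and x=r, OF has_derivative_mass[OF p(1,2)]]) (intro derivative_intros)
    moreover have "((\<lambda>r. mass (t - r)) has_real_derivative 2 * energy (t - r) * (0 - 1)) (at r)"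
      by (rule DERIV_chain2[where g="\<lambda>r. t - r" and x=r, OF has_derivative_mass[OF p(3,4)]]) (intro derivative_intros)
    moreover have "(?g has_real_derivative L2inner (v (t + r)) (u (t - r)) - L2inner (u (t + r)) (v (t - r))) (at r)"
      by (rule has_derivative_L2inner_reflected[OF u_C0 v]) (use p r in auto)
    ultimately have "(?F has_real_derivative y) (at r)"
      unfolding y_def by (intro DERIV_add DERIV_cmult DERIV_diff)
    moreover have "0 \<le> y"
    proof -
      have "\<bar>L2inner (v (t + r)) (u (t - r)) - L2inner (u (t + r)) (v (t - r))\<bar> \<le>
          A_LL * loglip_modulus \<bar>(t + r) - (t - r)\<bar> * (real CARD('n) / (2 * \<kappa>)) * (energy (t + r) + energy (t - r))"
        by (rule skew_bound) (use p r \<tau> in auto)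
      also have "\<bar>(t + r) - (t - r)\<bar> = 2 * r" using r by simp
      also have "A_LL * loglip_modulus (2 * r) * (real CARD('n) / (2 * \<kappa>)) * (energy (t + r) + energy (t - r)) \<le>
          A_LL * loglip_modulus (2 * \<tau>) * (real CARD('n) / (2 * \<kappa>)) * (energy (t + r) + energy (t - r))"
        using r \<tau> A_LL \<kappa> energy_nonneg[of "t + r"] energy_nonneg[of "t - r"] p
        by (intro mult_right_mono mult_left_mono loglip_modulus_mono) auto
      also have "\<dots> = M * (2 * energy (t + r) + 2 * energy (t - r))"
        using \<kappa> by (simp add: M_def field_simps)
      finally show ?thesis by (simp add: y_def)
    qed
    ultimately show "\<exists>y. (?F has_real_derivative y) (at r) \<and> 0 \<le> y" by blast
  next
    have im: "(\<lambda>r. t + r) ` {0..\<tau>} \<subseteq> {0..T}" "(\<lambda>r. t - r) ` {0..\<tau>} \<subseteq> {0..T}" using \<tau> by auto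
    have "continuous_on {0..\<tau>} ?g"
      by (rule continuous_on_L2inner_compose[OF u_C0 _ im(1) _ im(2)]) (intro continuous_intros)+
    moreover have "continuous_on {0..\<tau>} (\<lambda>r. mass (t + r))"
      by (rule continuous_on_compose2[OF continuous_on_mass _ im(1)]) (intro continuous_intros)
    moreover have "continuous_on {0..\<tau>} (\<lambda>r. mass (t - r))"
      by (rule continuous_on_compose2[OF continuous_on_mass _ im(2)]) (intro continuous_intros)
    ultimately show "continuous_on {0..\<tau>} ?F" by (intro continuous_intros)
  qed
  then have "mass t \<le> ?g \<tau> + M * (mass (t + \<tau>) - mass (t - \<tau>))" by (simp add: mass_def)
  also have "?g \<tau> \<le> L2norm (u (t + \<tau>)) * L2norm (u (t - \<tau>))"
    using L2_Cauchy_Schwarz[OF u_L2 u_L2, of "t + \<tau>" "t - \<tau>"] \<tau> by simp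
  also have "L2norm (u (t + \<tau>)) * L2norm (u (t - \<tau>)) = sqrt (mass (t + \<tau>) * mass (t - \<tau>))"
    by (simp add: mass_def L2norm_square[symmetric] real_sqrt_mult L2norm_nonneg)
  finally show "mass t \<le> sqrt (mass (t + \<tau>) * mass (t - \<tau>)) +
      A_LL * real CARD('n) / (4 * \<kappa>) * loglip_modulus (2 * \<tau>) * (mass (t + \<tau>) - mass (t - \<tau>))"
    by (simp add: M_def)
qed

end

subsection \<open>Conclusion\<close>

lemma integral_exp_decay_le:
  fixes H :: "real \<Rightarrow> real"
  assumes T: "0 \<le> T" and \<sigma>: "0 < \<sigma>" and M: "0 \<le> M" and H: "continuous_on {0..T} H"
    and le: "\<And>t. t \<in> {0..T} \<Longrightarrow> H t \<le> X + M * exp (- ((T - t) / \<sigma>))"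
  shows "(LINT t:{0..T}|lborel. H t) \<le> T * X + M * \<sigma>"
proof -
  let ?f = "\<lambda>t. X + M * exp (- ((T - t) / \<sigma>))" and ?F = "\<lambda>t. X * t + M * \<sigma> * exp (- ((T - t) / \<sigma>))"
  have F: "(?F has_real_derivative ?f t) (at t)" for t
    using \<sigma> by (auto intro!: derivative_eq_intros)
  have cont: "continuous_on {0..T} ?f" using \<sigma> by (intro continuous_intros) auto
  have intf: "set_integrable lborel {0..T} ?f" and intH: "set_integrable lborel {0..T} H"
    using borel_integrable_atLeastAtMost'[OF cont] borel_integrable_atLeastAtMost'[OF H] by auto
  have "(LINT t:{0..T}|lborel. H t) \<le> (LINT t:{0..T}|lborel. ?f t)"
    using le by (intro set_integral_mono intf intH)
  also have "\<dots> = ?F T - ?F 0"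
    unfolding set_lebesgue_integral_def
    using integral_FTC_Icc_real[OF T, of ?F ?f] F \<sigma> by (simp add: mult.commute continuous_intros)
  also have "\<dots> \<le> T * X + M * \<sigma>" using M \<sigma> by (simp add: mult.commute)
  finally show ?thesis .
qed

context backward_solution
begin

lemma L2norm_eq_sqrt_mass: "L2norm (u t) = sqrt (mass t)"
  by (simp add: mass_def L2norm_square[symmetric] L2norm_nonneg)

lemma gradsq_le_H1norm: "gradsq t \<le> (H1norm (u t))\<^sup>2"
  by (simp add: H1norm_def gradsq_def sum_nonneg)

text \<open>The exponential factor is no gain at \<open>T\<close> itself, but its time integral is
  of order \<sigma>. Under the \<open>H1\<close> bound the mass is Lipschitz in time, so the value
  at \<open>T\<close> is compared with that at \<open>T - sqrt \<sigma>\<close>, where the factor is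
  \<open>exp (- 1 / sqrt \<sigma>)\<close> and thus at most \<open>sqrt \<sigma>\<close>.\<close>

lemma mass_estimates:
  assumes D: "0 \<le> D" "L2norm (u T) \<le> D" and \<sigma>: "0 < \<sigma>" and X: "mass 0 * exp (T / \<sigma> ^ m + 1) \<le> X"
    and decay: "\<And>t. 0 \<le> t \<Longrightarrow> t \<le> T \<Longrightarrow>
      mass t \<le> mass 0 * exp (T / \<sigma> ^ m + 1) + mass T * exp (3 - (T - t) / \<sigma>)"
  shows "(LINT t:{0..T}|lborel. mass t) \<le> T * X + D\<^sup>2 * exp 3 * \<sigma>"
    and "sqrt \<sigma> \<le> T \<Longrightarrow> (\<And>t. t \<in> {0..T} \<Longrightarrow> H1norm (u t) \<le> D) \<Longrightarrow>
      mass T \<le> X + (exp 3 + 2 * inverse \<kappa>) * D\<^sup>2 * sqrt \<sigma>"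
proof -
  have "mass T \<le> D\<^sup>2" using D power_mono[OF D(2) L2norm_nonneg, of 2] by (simp add: mass_def L2norm_square)
  have le: "mass t \<le> X + D\<^sup>2 * exp 3 * exp (- ((T - t) / \<sigma>))" if "t \<in> {0..T}" for t
  proof -
    have "mass T * exp (3 - (T - t) / \<sigma>) \<le> D\<^sup>2 * exp (3 - (T - t) / \<sigma>)"
      using \<open>mass T \<le> D\<^sup>2\<close> by (intro mult_right_mono) auto
    also have "\<dots> = D\<^sup>2 * exp 3 * exp (- ((T - t) / \<sigma>))"
      by (simp add: exp_add[symmetric] mult.assoc)
    finally show ?thesis using decay[of t] X that by simp
  qed
  show "(LINT t:{0..T}|lborel. mass t) \<le> T * X + D\<^sup>2 * exp 3 * \<sigma>"
    by (rule integral_exp_decay_le[OF _ \<sigma> _ continuous_on_mass le]) (use T in auto)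
  assume s: "sqrt \<sigma> \<le> T" and H1: "\<And>t. t \<in> {0..T} \<Longrightarrow> H1norm (u t) \<le> D"
  have "0 < sqrt \<sigma>" using \<sigma> by simp
  have "gradsq t \<le> D\<^sup>2" if "0 < t" "t < T" for t
  proof -
    have "0 \<le> H1norm (u t)" by (simp add: H1norm_def sum_nonneg)
    then have "(H1norm (u t))\<^sup>2 \<le> D\<^sup>2" using H1[of t] that by (intro power_mono) auto
    then show ?thesis using gradsq_le_H1norm[of t] by linarith
  qed
  then have "mass T - mass (T - sqrt \<sigma>) \<le> 2 * inverse \<kappa> * D\<^sup>2 * (T - (T - sqrt \<sigma>))"
    by (intro mass_increment_le) (use s \<sigma> in auto)
  moreover have "mass (T - sqrt \<sigma>) \<le> X + D\<^sup>2 * exp 3 * sqrt \<sigma>"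
  proof -
    have "(T - (T - sqrt \<sigma>)) / \<sigma> = 1 / sqrt \<sigma>" using \<sigma> by (simp add: real_div_sqrt field_simps)
    then have "mass (T - sqrt \<sigma>) \<le> X + D\<^sup>2 * exp 3 * exp (- (1 / sqrt \<sigma>))"
      using le[of "T - sqrt \<sigma>"] s \<sigma> by simp
    also have "exp (- (1 / sqrt \<sigma>)) \<le> sqrt \<sigma>"
    proof -
      have "1 / sqrt \<sigma> \<le> exp (1 / sqrt \<sigma>)" using exp_ge_add_one_self[of "1 / sqrt \<sigma>"] by linarith
      then have "inverse (exp (1 / sqrt \<sigma>)) \<le> inverse (1 / sqrt \<sigma>)"
        using \<open>0 < sqrt \<sigma>\<close> by (intro le_imp_inverse_le) auto
      then show ?thesis by (simp add: exp_minus)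
    qed
    finally show ?thesis by (simp add: mult_left_mono)
  qed
  ultimately show "mass T \<le> X + (exp 3 + 2 * inverse \<kappa>) * D\<^sup>2 * sqrt \<sigma>"
    by (simp add: algebra_simps)
qed

lemma L2norm_le_final: "t \<in> {0..T} \<Longrightarrow> L2norm (u t) \<le> L2norm (u T)"
  using mass_mono[of t T] by (simp add: L2norm_eq_sqrt_mass)

lemma Sup_L2norm_le:
  assumes "L2norm (u T) \<le> c" shows "(SUP t\<in>{0..T}. L2norm (u t)) \<le> c"
proof (rule cSUP_least)
  show "{0..T} \<noteq> {}" using T by simp
  show "L2norm (u t) \<le> c" if "t \<in> {0..T}" for t using L2norm_le_final[OF that] assms by linarith
qed

lemma integral_L2norm_square: "(LINT t:{0..T}|lborel. (L2norm (u t))\<^sup>2) = (LINT t:{0..T}|lborel. mass t)"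
  by (simp add: mass_def L2norm_square)

end

theorem theoremD:
  fixes T \<kappa> A A_LL D :: real
  assumes "T > 0" and "0 < \<kappa>" and "\<kappa> < 1" and "D > 0"
  shows "\<exists>\<rho> \<delta> K. \<rho> > 0 \<and> 0 < \<delta> \<and> \<delta> \<le> 1 \<and> K > 0 \<and>
    (\<forall>(a :: 'n::finite \<Rightarrow> 'n \<Rightarrow> real \<Rightarrow> real^'n \<Rightarrow> real) (u :: real \<Rightarrow> real^'n \<Rightarrow> complex).
       admissible_coeffs T \<kappa> A A_LL a \<longrightarrow>
       u \<in> solution_space T \<longrightarrow>
       solves_backward_parabolic T a u \<longrightarrow>
       L2norm (u 0) \<le> \<rho> \<longrightarrow>
       (\<forall>t\<in>{0..T}. L2norm (u t) \<le> D) \<longrightarrow>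
         (LINT t:{0..T}|lborel. (L2norm (u t))\<^sup>2)
            \<le> (if L2norm (u 0) = 0 then 0
                else K * (1 / \<bar>ln (L2norm (u 0))\<bar> powr (2 * \<delta>)))
         \<and> ((\<forall>t\<in>{0..T}. u t \<in> H1 \<and> H1norm (u t) \<le> D) \<longrightarrow>
              (SUP t\<in>{0..T}. L2norm (u t))
                \<le> (if L2norm (u 0) = 0 then 0
                    else K * (1 / \<bar>ln (L2norm (u 0))\<bar> powr \<delta>))))"
proof -
  note T = assms(1) and \<kappa> = assms(2) and D = assms(4)
  \<comment> \<open>The constants are chosen before the coefficients are given, when the sign of
    \<open>A_LL\<close> is unknown; monotonicity of the mass later allows \<open>A_LL\<close> to be
    replaced by its absolute value.\<close>
  define C where "C = \<bar>A_LL\<bar> * real CARD('n) / (4 * \<kappa>)"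
  have C: "0 \<le> C" using \<kappa> by (simp add: C_def)
  obtain J :: nat and \<sigma>0 :: real where \<sigma>0: "0 < \<sigma>0" "\<sigma>0 \<le> 1"
    and decay: "\<And>H \<sigma> t. almost_log_convex C T H \<Longrightarrow> (\<And>t. t \<in> {0..T} \<Longrightarrow> 0 \<le> H t) \<Longrightarrow>
      (\<And>s t. 0 \<le> s \<Longrightarrow> s \<le> t \<Longrightarrow> t \<le> T \<Longrightarrow> H s \<le> H t) \<Longrightarrow>
      0 < \<sigma> \<Longrightarrow> \<sigma> \<le> \<sigma>0 \<Longrightarrow> 0 \<le> t \<Longrightarrow> t \<le> T \<Longrightarrow>
      H t \<le> H 0 * exp (T / \<sigma> ^ (3 ^ J) + 1) + H T * exp (3 - (T - t) / \<sigma>)"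
    using almost_log_convex_decay[OF T C] by metis
  define m :: nat where "m = 3 ^ J"
  have m: "1 \<le> m" by (simp add: m_def)
  \<comment> \<open>The bound by \<open>T\<^sup>2\<close> keeps the time
    \<open>T - sqrt \<sigma>\<close> nonnegative.\<close>
  define \<sigma>1 where "\<sigma>1 = min \<sigma>0 (T\<^sup>2)"
  have \<sigma>1: "0 < \<sigma>1" "\<sigma>1 \<le> \<sigma>0" "\<sigma>1 \<le> T\<^sup>2" "\<sigma>1 \<le> 1" using \<sigma>0 T by (auto simp: \<sigma>1_def)
  \<comment> \<open>The mass will be bounded by a multiple of \<open>sqrt \<sigma>\<close> with
    \<open>\<sigma> ^ m\<close> of order \<open>1 / \<Lambda>\<close>, where \<Lambda> is the
    absolute logarithm of the initial norm. This is the power \<open>1 / (2 * m)\<close>, that is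
    \<open>2 * \<delta>\<close>; the square root for the norm leaves \<delta>.\<close>
  define \<delta> where "\<delta> = 1 / (4 * real m)"
  have \<delta>: "0 < \<delta>" "\<delta> \<le> 1" using m by (auto simp: \<delta>_def)
  \<comment> \<open>The two entries of the maximum ensure \<open>1 \<le> \<Lambda>\<close> and, for
    the \<sigma> chosen below, \<open>\<sigma> \<le> \<sigma>1\<close>.\<close>
  define \<rho> where "\<rho> = exp (- max 1 (T / \<sigma>1 ^ m))"
  define B where "B = exp 1 / T + (exp 3 + 2 * inverse \<kappa>) * D\<^sup>2"
  have B: "0 < B" using T \<kappa> by (simp add: B_def add_pos_nonneg)
  \<comment> \<open>The summand 1 gives \<open>K \<le> K\<^sup>2\<close>, so the same
    \<open>K\<close> still serves after the square root of the mass is taken.\<close>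
  define K where "K = 1 + (1 + T) * B * T powr (2 * \<delta>)"
  have K: "1 \<le> K" using T B by (simp add: K_def)
  show ?thesis
  proof (rule exI[of _ \<rho>], rule exI[of _ \<delta>], rule exI[of _ K], intro conjI allI impI)
    show "0 < \<rho>" by (simp add: \<rho>_def)
    show "0 < K" using K by simp
  next
    fix a :: "'n \<Rightarrow> 'n \<Rightarrow> real \<Rightarrow> real^'n \<Rightarrow> real" and u :: "real \<Rightarrow> real^'n \<Rightarrow> complex"
    assume adm: "admissible_coeffs T \<kappa> A A_LL a" and u: "u \<in> solution_space T"
      and sol: "solves_backward_parabolic T a u" and u0: "L2norm (u 0) \<le> \<rho>"
      and uD: "\<forall>t\<in>{0..T}. L2norm (u t) \<le> D"
    obtain v where v: "backward_solution T \<kappa> A A_LL a u v"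
      using sol adm u T \<kappa> unfolding solves_backward_parabolic_def backward_solution_def by blast
    interpret backward_solution T \<kappa> A A_LL a u v by (rule v)
    have alc: "almost_log_convex C T mass"
      unfolding almost_log_convex_def
    proof (intro allI impI, elim conjE)
      fix t \<tau> :: real assume \<tau>: "0 < \<tau>" "2 * \<tau> \<le> 1" "0 \<le> t - \<tau>" "t + \<tau> \<le> T"
      have "mass t \<le> sqrt (mass (t + \<tau>) * mass (t - \<tau>)) +
          A_LL * real CARD('n) / (4 * \<kappa>) * loglip_modulus (2 * \<tau>) * (mass (t + \<tau>) - mass (t - \<tau>))"
        using almost_log_convex_mass \<tau> unfolding almost_log_convex_def by blast
      also have "A_LL * real CARD('n) / (4 * \<kappa>) * loglip_modulus (2 * \<tau>) * (mass (t + \<tau>) - mass (t - \<tau>)) \<le>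
          C * loglip_modulus (2 * \<tau>) * (mass (t + \<tau>) - mass (t - \<tau>))"
        unfolding C_def using \<kappa> \<tau> mass_mono[of "t - \<tau>" "t + \<tau>"]
        by (intro mult_right_mono divide_right_mono loglip_modulus_nonneg) auto
      finally show "mass t \<le> sqrt (mass (t + \<tau>) * mass (t - \<tau>)) +
          C * loglip_modulus (2 * \<tau>) * (mass (t + \<tau>) - mass (t - \<tau>))" by simp
    qed
    have dec: "mass t \<le> mass 0 * exp (T / \<sigma> ^ m + 1) + mass T * exp (3 - (T - t) / \<sigma>)"
      if "0 < \<sigma>" "\<sigma> \<le> \<sigma>1" "0 \<le> t" "t \<le> T" for \<sigma> t
      unfolding m_def using decay[OF alc mass_nonneg mass_mono] that \<sigma>1 by simp
    have uT: "L2norm (u T) \<le> D" using uD T by simp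
    have sT: "sqrt \<sigma> \<le> T" if "\<sigma> \<le> \<sigma>1" for \<sigma>
      using that \<sigma>1 T by (intro real_le_lsqrt) auto
    note est1 = mass_estimates(1)[OF less_imp_le[OF D] uT]
    note est2 = mass_estimates(2)[OF less_imp_le[OF D] uT]
    have "(LINT t:{0..T}|lborel. mass t)
            \<le> (if L2norm (u 0) = 0 then 0 else K * (1 / \<bar>ln (L2norm (u 0))\<bar> powr (2 * \<delta>))) \<and>
      ((\<forall>t\<in>{0..T}. H1norm (u t) \<le> D) \<longrightarrow> L2norm (u T)
                \<le> (if L2norm (u 0) = 0 then 0 else K * (1 / \<bar>ln (L2norm (u 0))\<bar> powr \<delta>)))"
    proof (cases "L2norm (u 0) = 0")
      case True
      then have m0: "mass 0 = 0" by (simp add: mass_def L2norm_square[symmetric])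
      \<comment> \<open>With vanishing initial mass the growth term is 0 for every \<sigma>, so
        \<sigma> may tend to 0 freely.\<close>
      have pos: "\<forall>\<^sub>F \<sigma> in at_right 0. 0 < \<sigma> \<and> \<sigma> \<le> \<sigma>1"
        using \<sigma>1(1) by (auto simp: eventually_at_right_field intro!: exI[of _ \<sigma>1])
      have e1: "(LINT t:{0..T}|lborel. mass t) \<le> D\<^sup>2 * exp 3 * \<sigma>" if "0 < \<sigma>" "\<sigma> \<le> \<sigma>1" for \<sigma>
        using est1[OF that(1), of m 0, OF _ dec[OF that]] m0 by simp
      have "((\<lambda>\<sigma>. D\<^sup>2 * exp 3 * \<sigma>) \<longlongrightarrow> D\<^sup>2 * exp 3 * 0) (at_right (0::real))" by (intro tendsto_intros)
      then have i0: "(LINT t:{0..T}|lborel. mass t) \<le> D\<^sup>2 * exp 3 * 0"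
        by (rule tendsto_lowerbound) (use pos e1 in \<open>auto elim!: eventually_mono\<close>)
      have "L2norm (u T) \<le> 0" if H1: "\<forall>t\<in>{0..T}. H1norm (u t) \<le> D"
      proof -
        have e2: "mass T \<le> (exp 3 + 2 * inverse \<kappa>) * D\<^sup>2 * sqrt \<sigma>" if "0 < \<sigma>" "\<sigma> \<le> \<sigma>1" for \<sigma>
          using est2[OF that(1), of m 0, OF _ dec[OF that] sT[OF that(2)]] m0 H1 by simp
        have "((\<lambda>\<sigma>. (exp 3 + 2 * inverse \<kappa>) * D\<^sup>2 * sqrt \<sigma>) \<longlongrightarrow> (exp 3 + 2 * inverse \<kappa>) * D\<^sup>2 * sqrt 0) (at_right 0)"
          by (intro tendsto_intros)
        then have "mass T \<le> (exp 3 + 2 * inverse \<kappa>) * D\<^sup>2 * sqrt 0"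
          by (rule tendsto_lowerbound) (use pos e2 in \<open>auto elim!: eventually_mono\<close>)
        then show ?thesis by (simp add: L2norm_eq_sqrt_mass)
      qed
      then show ?thesis using True i0 by simp
    next
      case False
      define r where "r = L2norm (u 0)"
      have r: "0 < r" using False L2norm_nonneg[of "u 0"] by (simp add: r_def)
      define \<Lambda> where "\<Lambda> = - ln r"
      have rL: "r = exp (- \<Lambda>)" using r by (simp add: \<Lambda>_def)
      have "exp (- \<Lambda>) \<le> exp (- max 1 (T / \<sigma>1 ^ m))" using u0 by (simp add: rL[symmetric] r_def \<rho>_def)
      then have \<Lambda>: "1 \<le> \<Lambda>" "T / \<sigma>1 ^ m \<le> \<Lambda>" by auto
      have ab: "\<bar>ln r\<bar> = \<Lambda>" using \<Lambda> by (simp add: \<Lambda>_def)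
      \<comment> \<open>\<open>s\<close> will be \<open>sqrt \<sigma>\<close>, with \<sigma> chosen
        such that \<open>T / \<sigma> ^ m\<close> equals \<Lambda>. The growth factor
        \<open>exp (\<Lambda> + 1)\<close> is then beaten by the initial mass
        \<open>exp (- 2 * \<Lambda>)\<close>.\<close>
      define s where "s = (T / \<Lambda>) powr (2 * \<delta>)"
      have s: "0 < s" using T \<Lambda> by (simp add: s_def)
      define \<sigma> where "\<sigma> = s\<^sup>2"
      have \<sigma>: "0 < \<sigma>" using s by (simp add: \<sigma>_def)
      have sq: "sqrt \<sigma> = s" using s by (simp add: \<sigma>_def)
      have \<sigma>m: "\<sigma> ^ m = T / \<Lambda>"
      proof -
        have "\<sigma> ^ m = s ^ (2 * m)" by (simp add: \<sigma>_def power_mult)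
        also have "\<dots> = s powr real (2 * m)" by (rule powr_realpow[OF s, symmetric])
        also have "\<dots> = (T / \<Lambda>) powr 1" using m by (simp add: s_def powr_powr \<delta>_def)
        finally show ?thesis using T \<Lambda> by simp
      qed
      have "T / \<Lambda> \<le> \<sigma>1 ^ m" using \<Lambda> \<sigma>1(1) by (simp add: field_simps)
      then have "\<not> \<sigma>1 ^ m < \<sigma> ^ m" by (simp add: \<sigma>m)
      then have \<sigma>\<sigma>1: "\<sigma> \<le> \<sigma>1" using power_strict_mono[of \<sigma>1 \<sigma> m] \<sigma>1(1) m by linarith
      have \<sigma>le: "\<sigma> \<le> 1" "\<sigma> ^ m \<le> \<sigma>" using \<sigma> \<sigma>\<sigma>1 \<sigma>1(4) m power_decreasing[of 1 m \<sigma>] by auto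
      have \<sigma>s: "\<sigma> \<le> s" using \<sigma>le s power_le_one_iff[of s 2] by (simp add: \<sigma>_def power2_eq_square mult_left_le)
      define X where "X = exp 1 / T * s"
      have X: "mass 0 * exp (T / \<sigma> ^ m + 1) \<le> X"
      proof -
        have m0: "mass 0 = exp (- \<Lambda>) * exp (- \<Lambda>)"
          by (simp add: mass_def L2norm_square[symmetric] r_def[symmetric] rL power2_eq_square)
        have "mass 0 * exp (T / \<sigma> ^ m + 1) = exp 1 * exp (- \<Lambda>)"
          using T \<Lambda> unfolding m0 \<sigma>m by (simp add: exp_add[symmetric])
        also have "exp (- \<Lambda>) \<le> 1 / \<Lambda>"
        proof -
          have "\<Lambda> \<le> exp \<Lambda>" using exp_ge_add_one_self[of \<Lambda>] by linarith
          then show ?thesis using \<Lambda> by (simp add: exp_minus field_simps)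
        qed
        also have "1 / \<Lambda> = \<sigma> ^ m / T" using T by (simp add: \<sigma>m)
        also have "\<dots> \<le> s / T" using \<sigma>le \<sigma>s T by (intro divide_right_mono) auto
        finally show ?thesis by (simp add: X_def)
      qed
      have sL: "s = T powr (2 * \<delta>) * (1 / \<Lambda> powr (2 * \<delta>))"
        using T \<Lambda> by (simp add: s_def powr_divide)
      have "(LINT t:{0..T}|lborel. mass t) \<le> T * X + D\<^sup>2 * exp 3 * \<sigma>"
        by (rule est1[OF \<sigma> X dec[OF \<sigma> \<sigma>\<sigma>1]])
      also have "\<dots> \<le> T * X + D\<^sup>2 * exp 3 * s" using \<sigma>s by (intro add_left_mono mult_left_mono) auto
      also have "\<dots> = (T * (exp 1 / T) + D\<^sup>2 * exp 3) * s" by (simp add: X_def algebra_simps)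
      also have "\<dots> \<le> ((1 + T) * B) * s"
      proof (intro mult_right_mono less_imp_le[OF s])
        have p: "0 \<le> exp 1 / T" "0 \<le> D\<^sup>2 * exp 3" "0 \<le> 2 * inverse \<kappa> * D\<^sup>2" using T \<kappa> by auto
        have B': "B = exp 1 / T + D\<^sup>2 * exp 3 + 2 * inverse \<kappa> * D\<^sup>2" by (simp add: B_def algebra_simps)
        have "exp 1 / T \<le> B" "D\<^sup>2 * exp 3 \<le> B" using p unfolding B' by linarith+
        then have "T * (exp 1 / T) + D\<^sup>2 * exp 3 \<le> T * B + B"
          using T by (intro add_mono mult_left_mono) auto
        then show "T * (exp 1 / T) + D\<^sup>2 * exp 3 \<le> (1 + T) * B" by (simp add: algebra_simps)
      qed
      also have "\<dots> = ((1 + T) * B * T powr (2 * \<delta>)) * (1 / \<Lambda> powr (2 * \<delta>))" by (simp add: sL)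
      also have "\<dots> \<le> K * (1 / \<Lambda> powr (2 * \<delta>))" by (intro mult_right_mono) (auto simp: K_def)
      finally have c1: "(LINT t:{0..T}|lborel. mass t) \<le> K * (1 / \<Lambda> powr (2 * \<delta>))" .
      have c2: "L2norm (u T) \<le> K * (1 / \<Lambda> powr \<delta>)" if H1: "\<forall>t\<in>{0..T}. H1norm (u t) \<le> D"
      proof -
        have "mass T \<le> X + (exp 3 + 2 * inverse \<kappa>) * D\<^sup>2 * sqrt \<sigma>"
          using H1 by (intro est2[OF \<sigma> X dec[OF \<sigma> \<sigma>\<sigma>1] sT[OF \<sigma>\<sigma>1]]) auto
        also have "\<dots> = B * s" by (simp add: sq X_def B_def algebra_simps)
        also have "\<dots> \<le> ((1 + T) * B) * s" using T B s by (intro mult_right_mono) (auto simp: algebra_simps)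
        also have "\<dots> = ((1 + T) * B * T powr (2 * \<delta>)) * (1 / \<Lambda> powr (2 * \<delta>))" by (simp add: sL)
        also have "\<dots> \<le> K\<^sup>2 * (1 / \<Lambda> powr (2 * \<delta>))"
        proof (intro mult_right_mono)
          have "(1 + T) * B * T powr (2 * \<delta>) \<le> K" by (simp add: K_def)
          also have "K \<le> K\<^sup>2" using K by (simp add: power2_eq_square)
          finally show "(1 + T) * B * T powr (2 * \<delta>) \<le> K\<^sup>2" .
        qed simp
        also have "\<dots> = (K * (1 / \<Lambda> powr \<delta>))\<^sup>2"
          using \<Lambda> by (simp add: power_mult_distrib power_divide power2_eq_square powr_add[symmetric])
        finally have "sqrt (mass T) \<le> \<bar>K * (1 / \<Lambda> powr \<delta>)\<bar>" by (metis real_sqrt_abs real_sqrt_le_mono)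
        then show ?thesis using K by (simp add: L2norm_eq_sqrt_mass)
      qed
      show ?thesis using c1 c2 False by (simp add: ab[symmetric] r_def)
    qed
    note main = this
    show "(LINT t:{0..T}|lborel. (L2norm (u t))\<^sup>2)
            \<le> (if L2norm (u 0) = 0 then 0 else K * (1 / \<bar>ln (L2norm (u 0))\<bar> powr (2 * \<delta>)))"
      unfolding integral_L2norm_square using main by blast
    show "(SUP t\<in>{0..T}. L2norm (u t)) \<le> (if L2norm (u 0) = 0 then 0 else K * (1 / \<bar>ln (L2norm (u 0))\<bar> powr \<delta>))"
      if "\<forall>t\<in>{0..T}. u t \<in> H1 \<and> H1norm (u t) \<le> D"
      by (rule Sup_L2norm_le) (use main that in blast)
  qed (use \<delta> in auto)
qed

end
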